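(* Let $\gamma>1$, $0<r_0<r_1$, $\Omega=\{z=(z_1,z_2,z_3): r_0<z_1<r_1,\ z_2\in\mathbb T_{2\pi},\ -1<z_3<1\}$, let $(\bar\rho_s,\bar U_{1s},\bar U_{2s})$ be a background subsonic flow with sound speed $\bar c_s$ and Mach numbers $\bar M_{1s},\bar M_{2s}$ (all functions of $z_1$, defined in the context), and let $\mathcal A=(\mathcal A_{ij})$, $\mathcal B=(\mathcal B_{ij})$ be the matrices given in the context. Given $\hat{\mathbf F}=(\hat F_1,\hat F_2,\hat F_3)$, $\hat G$, $\tilde g_0$, $\tilde g_1$ as in the context, the linear boundary value problem $$\begin{cases}\partial_{z_i}(\mathcal A_{ij}\partial_{z_j}\psi)+\partial_{z_1}\Big(\frac{z_1\bar\rho_s\bar U_{1s}}{\bar c_s^2}\phi\Big)+\partial_{z_2}\Big(\frac{\bar\rho_s\bar U_{2s}}{\bar c_s^2}\phi\Big)=\operatorname{div}_z\hat{\mathbf F},\\ \partial_{z_i}(\mathcal B_{ij}\partial_{z_j}\phi)+\frac{z_1\bar\rho_s\bar U_{1s}}{\bar c_s^2}\partial_{z_1}\psi+\frac{\bar\rho_s\bar U_{2s}}{\bar c_s^2}\partial_{z_2}\psi-\frac{z_1\bar\rho_s}{\bar c_s^2}\phi=\hat G,\end{cases}\quad\text{in }\Omega,$$ $$\begin{cases}\big(r_k\bar\rho_s(1-\bar M_{1s}^2)\partial_{z_1}\psi-\frac{\bar\rho_s\bar U_{1s}\bar U_{2s}}{\bar c_s^2}\partial_{z_2}\psi\big)(r_k,z_2,z_3)=\tilde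 g_k(z_2,z_3),\quad k=0,1,\\ \partial_{z_3}\psi(z_1,z_2,\pm1)=0,\\ \phi(r_0,z_2,z_3)=\phi(r_1,z_2,z_3)=0,\\ \partial_{z_3}\phi(z_1,z_2,\pm1)=0,\end{cases}$$ admits a unique weak solution $(\psi,\phi)\in H^1(\Omega)\times H^1(\Omega)$ (in the sense defined in the context), and $$\|(\psi,\phi)\|_{H^1(\Omega)}\le C\Big(\|(\hat{\mathbf F},\hat G)\|_{L^2(\Omega)}+\|\tilde g_0-\hat F_1\|_{L^2(\Gamma^0)}+\|\tilde g_1-\hat F_1\|_{L^2(\Gamma^1)}+\|\hat F_3\|_{L^2(\Gamma^{w\pm})}\Big)$$ for some positive constant $C$.
   Context: Repeated indices are summed from 1 to 3; functions are $2\pi$-periodic in $z_2$; $\Gamma^k=\{z_1=r_k\}\cap\partial\Omega$ ($k=0,1$), $\Gamma^{w\pm}=\{z_3=\pm1\}\cap\partial\Omega$; $dz=dz_1dz_2dz_3$. Background subsonic flow: smooth functions $\bar\rho_s>0$, $\bar U_{1s}>0$, $\bar U_{2s}$ of $z_1=r\in[r_0,r_1]$, which together with $\bar A\equiv A_0>0$ and $\bar E$ solve $(r\bar\rho\bar U_1)'=0$, $\bar U_1\bar U_1'+\frac1{\bar\rho}(\bar A\bar\rho^\gamma)'-\frac1r\bar U_2^2=\bar E$, $\bar U_1\bar U_2'+\frac1r\bar U_1\bar U_2=0$, $\bar U_1\bar A'=0$, $\bar E'+\frac1r\bar E=\bar\rho-b_0$, with data at $r_0$ equal to constants $\rho_0>b_0>0$,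 $U_{10}>0$, $U_{20}\in\mathbb R$, $A_0>0$, $E_0>0$ satisfying $\gamma A_0\rho_0^{\gamma-1}>U_{10}^2+U_{20}^2$. Set $\bar c_s^2=\gamma A_0\bar\rho_s^{\gamma-1}$, $\bar M_{is}=\bar U_{is}/\bar c_s$; then $\bar M_{1s}^2+\bar M_{2s}^2<1$ on $[r_0,r_1]$. $$\mathcal A=\begin{pmatrix}z_1\bar\rho_s(1-\bar M_{1s}^2)&-\bar\rho_s\bar M_{1s}\bar M_{2s}&0\\-\bar\rho_s\bar M_{1s}\bar M_{2s}&\frac1{z_1}\bar\rho_s(1-\bar M_{2s}^2)&0\\0&0&z_1\bar\rho_s\end{pmatrix},\qquad\mathcal B=\begin{pmatrix}z_1&0&0\\0&\frac1{z_1}&0\\0&0&z_1\end{pmatrix}.$$ Data: $\hat{\mathbf F}\in (C^{1,\beta}(\bar\Omega))^3$, $\hat G\in C^\beta(\bar\Omega)$, $\tilde g_k\in C^{1,\beta}(\bar\Gamma^k)$ for some $\beta\in(0,1)$. Weak solution: let $\mathcal H=\{(\eta,\xi)\in H^1(\Omega)\times H^1(\Omega):\int_\Omega\eta\,dz=0,\ \xi(r_0,\cdot)=\xi(r_1,\cdot)=0\}$. A pair $(\psi,\phi)\in\mathcal H$ is a weak solution if for all $(\eta,\xi)\in\mathcal H$, $$\begin{aligned}&\int_\Omega\Big(\mathcal A_{ij}\partial_{z_j}\psi\,\partial_{z_i}\eta+\tfrac{z_1\bar\rho_s\bar U_{1s}}{\bar c_s^2}\phi\,\partial_{z_1}\eta+\tfrac{\bar\rho_s\bar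 U_{2s}}{\bar c_s^2}\phi\,\partial_{z_2}\eta+\mathcal B_{ij}\partial_{z_j}\phi\,\partial_{z_i}\xi-\tfrac{z_1\bar\rho_s\bar U_{1s}}{\bar c_s^2}\partial_{z_1}\psi\,\xi-\tfrac{\bar\rho_s\bar U_{2s}}{\bar c_s^2}\partial_{z_2}\psi\,\xi+\tfrac{z_1\bar\rho_s}{\bar c_s^2}\phi\xi\Big)dz\\&=\int_\Omega(\hat F_i\partial_{z_i}\eta-\hat G\xi)\,dz+\int_{\Gamma^1}(\tilde g_1-\hat F_1)\eta\,dz_2dz_3-\int_{\Gamma^0}(\tilde g_0-\hat F_1)\eta\,dz_2dz_3-\int_{\Gamma^{w+}}\hat F_3\eta\,dz_1dz_2+\int_{\Gamma^{w-}}\hat F_3\eta\,dz_1dz_2.\end{aligned}$$ *)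

theory Defs
  imports "HOL-Analysis.Analysis"
begin

subsection \<open>The domain\<close>

text \<open>
  Points are \<open>z :: real ^ 3\<close>. A function on \<open>(r0, r1) \<times> T \<times> (-1, 1)\<close>, with \<open>T\<close> the circle of
  length \<open>2 pi\<close>, is a function on \<open>real ^ 3\<close> that is \<open>2 pi\<close>-periodic in \<open>z $ 2\<close>. Integrals are taken
  over the fundamental cell \<open>Omega\<close>; pointwise regularity up to the boundary is imposed on
  the closed strip \<open>Omega_bar\<close>, in which \<open>z $ 2\<close> is unrestricted. For periodic functions,
  Hoelder continuity on the strip is Hoelder continuity for the distance of the torus.
\<close>

definition Omega :: "real \<Rightarrow> real \<Rightarrow> (real ^ 3) set" where
  "Omega r0 r1 = {z. r0 < z $ 1 \<and> z $ 1 < r1 \<and> 0 < z $ 2 \<and> z $ 2 < 2 * pi \<and> -1 < z $ 3 \<and> z $ 3 < 1}"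

definition Omega_bar :: "real \<Rightarrow> real \<Rightarrow> (real ^ 3) set" where
  "Omega_bar r0 r1 = {z. r0 \<le> z $ 1 \<and> z $ 1 \<le> r1 \<and> -1 \<le> z $ 3 \<and> z $ 3 \<le> 1}"

definition periodic_z2 :: "(real ^ 3 \<Rightarrow> 'a) \<Rightarrow> bool" where
  "periodic_z2 f \<longleftrightarrow> (\<forall>z. f (z + axis 2 (2 * pi)) = f z)"

text \<open>
  The faces of the boundary are parametrised over open rectangles: \<open>z $ 1 = r\<close> by
  \<open>(z2, z3) \<in> cell_end\<close>, and \<open>z $ 3 = s\<close> by \<open>(z1, z2) \<in> cell_wall r0 r1\<close>.
  \<open>closed_end\<close> is the closed face \<open>z $ 1 = r\<close> with \<open>z2\<close> unrestricted, for periodic functions.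
\<close>

definition cell_end :: "(real \<times> real) set" where
  "cell_end = {0<..<2 * pi} \<times> {-1<..<1}"

definition cell_wall :: "real \<Rightarrow> real \<Rightarrow> (real \<times> real) set" where
  "cell_wall r0 r1 = {r0<..<r1} \<times> {0<..<2 * pi}"

definition closed_end :: "(real \<times> real) set" where
  "closed_end = UNIV \<times> {-1..1}"

definition end_pt :: "real \<Rightarrow> real \<times> real \<Rightarrow> real ^ 3" where
  "end_pt r = (\<lambda>(z2, z3). vector [r, z2, z3])"

definition wall_pt :: "real \<Rightarrow> real \<times> real \<Rightarrow> real ^ 3" where
  "wall_pt s = (\<lambda>(z1, z2). vector [z1, z2, s])"


subsection \<open>Function spaces\<close>

definition holder_on :: "real \<Rightarrow> 'a::metric_space set \<Rightarrow> ('a \<Rightarrow> 'b::metric_space) \<Rightarrow> bool" where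
  "holder_on \<beta> S f \<longleftrightarrow> (\<exists>K. \<forall>x\<in>S. \<forall>y\<in>S. dist (f x) (f y) \<le> K * dist x y powr \<beta>)"

definition C1_holder_on ::
    "real \<Rightarrow> 'a::real_normed_vector set \<Rightarrow> ('a \<Rightarrow> 'b::real_normed_vector) \<Rightarrow> bool" where
  "C1_holder_on \<beta> S f \<longleftrightarrow>
     (\<exists>f' :: 'a \<Rightarrow> 'a \<Rightarrow>\<^sub>L 'b.
        (\<forall>x\<in>S. (f has_derivative blinfun_apply (f' x)) (at x within S)) \<and> holder_on \<beta> S f')"

definition smooth_on_Icc :: "real \<Rightarrow> real \<Rightarrow> (real \<Rightarrow> real) \<Rightarrow> bool" where
  "smooth_on_Icc a b f \<longleftrightarrow>
     (\<exists>D :: nat \<Rightarrow> real \<Rightarrow> real.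
        (\<forall>x\<in>{a..b}. D 0 x = f x) \<and>
        (\<forall>n. \<forall>x\<in>{a..b}. (D n has_real_derivative D (Suc n) x) (at x within {a..b})))"

definition partial :: "3 \<Rightarrow> (real ^ 3 \<Rightarrow> real) \<Rightarrow> real ^ 3 \<Rightarrow> real" where
  "partial i f z = frechet_derivative f (at z) (axis i 1)"

primrec Ck :: "nat \<Rightarrow> (real ^ 3 \<Rightarrow> real) \<Rightarrow> bool" where
  "Ck 0 f \<longleftrightarrow> continuous_on UNIV f"
| "Ck (Suc k) f \<longleftrightarrow> (\<forall>z. f differentiable (at z)) \<and> (\<forall>i. Ck k (partial i f))"

definition smooth_periodic :: "(real ^ 3 \<Rightarrow> real) \<Rightarrow> bool" where
  "smooth_periodic f \<longleftrightarrow> (\<forall>k. Ck k f) \<and> periodic_z2 f"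

text \<open>
  Compact support in \<open>(r0, r1) \<times> T \<times> (-1, 1)\<close> constrains only \<open>z $ 1\<close> and \<open>z $ 3\<close>. Test functions need
  not vanish at \<open>z $ 2 = 0\<close> and \<open>z $ 2 = 2 * pi\<close>, so the weak gradient below is the one on the torus.
\<close>

definition test_function :: "real \<Rightarrow> real \<Rightarrow> (real ^ 3 \<Rightarrow> real) \<Rightarrow> bool" where
  "test_function r0 r1 f \<longleftrightarrow> smooth_periodic f \<and>
     (\<exists>\<delta>>0. \<forall>z. f z \<noteq> 0 \<longrightarrow> r0 + \<delta> \<le> z $ 1 \<and> z $ 1 \<le> r1 - \<delta> \<and> -1 + \<delta> \<le> z $ 3 \<and> z $ 3 \<le> 1 - \<delta>)"

definition L2_on :: "'a::euclidean_space set \<Rightarrow> ('a \<Rightarrow> 'b::euclidean_space) \<Rightarrow> bool" where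
  "L2_on S f \<longleftrightarrow> f \<in> borel_measurable (lebesgue_on S) \<and>
                 integrable (lebesgue_on S) (\<lambda>x. (norm (f x))\<^sup>2)"

definition L2_norm :: "'a::euclidean_space set \<Rightarrow> ('a \<Rightarrow> 'b::euclidean_space) \<Rightarrow> real" where
  "L2_norm S f = sqrt (\<integral>x. (norm (f x))\<^sup>2 \<partial>(lebesgue_on S))"

definition has_weak_grad ::
    "real \<Rightarrow> real \<Rightarrow> (real ^ 3 \<Rightarrow> real) \<Rightarrow> (real ^ 3 \<Rightarrow> real ^ 3) \<Rightarrow> bool" where
  "has_weak_grad r0 r1 u g \<longleftrightarrow> L2_on (Omega r0 r1) g \<and>
     (\<forall>f i. test_function r0 r1 f \<longrightarrow>
        (\<integral>z. u z * partial i f z \<partial>(lebesgue_on (Omega r0 r1))) =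
        - (\<integral>z. g z $ i * f z \<partial>(lebesgue_on (Omega r0 r1))))"

definition H1 :: "real \<Rightarrow> real \<Rightarrow> (real ^ 3 \<Rightarrow> real) set" where
  "H1 r0 r1 = {u. periodic_z2 u \<and> L2_on (Omega r0 r1) u \<and> (\<exists>g. has_weak_grad r0 r1 u g)}"

definition wgrad :: "real \<Rightarrow> real \<Rightarrow> (real ^ 3 \<Rightarrow> real) \<Rightarrow> real ^ 3 \<Rightarrow> real ^ 3" where
  "wgrad r0 r1 u = (SOME g. has_weak_grad r0 r1 u g)"

definition H1_norm :: "real \<Rightarrow> real \<Rightarrow> (real ^ 3 \<Rightarrow> real) \<Rightarrow> real" where
  "H1_norm r0 r1 u =
     sqrt ((L2_norm (Omega r0 r1) u)\<^sup>2 + (L2_norm (Omega r0 r1) (wgrad r0 r1 u))\<^sup>2)"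

text \<open>
  Traces are the \<open>L2\<close>-limits of restrictions of smooth functions converging in \<open>H1\<close>. The
  face is given by a parametrisation \<open>p\<close> over \<open>Q\<close>.
\<close>

definition has_trace ::
    "real \<Rightarrow> real \<Rightarrow> (real \<times> real) set \<Rightarrow> (real \<times> real \<Rightarrow> real ^ 3) \<Rightarrow>
     (real ^ 3 \<Rightarrow> real) \<Rightarrow> (real \<times> real \<Rightarrow> real) \<Rightarrow> bool" where
  "has_trace r0 r1 Q p u T \<longleftrightarrow> L2_on Q T \<and>
     (\<exists>v. (\<forall>n::nat. smooth_periodic (v n)) \<and>
          (\<lambda>n. H1_norm r0 r1 (\<lambda>z. v n z - u z)) \<longlonglongrightarrow> 0 \<and>
          (\<lambda>n. L2_norm Q (\<lambda>y. v n (p y) - T y)) \<longlonglongrightarrow> 0)"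

definition trace_end :: "real \<Rightarrow> real \<Rightarrow> real \<Rightarrow> (real ^ 3 \<Rightarrow> real) \<Rightarrow> real \<times> real \<Rightarrow> real" where
  "trace_end r0 r1 r u = (SOME T. has_trace r0 r1 cell_end (end_pt r) u T)"

definition trace_wall :: "real \<Rightarrow> real \<Rightarrow> real \<Rightarrow> (real ^ 3 \<Rightarrow> real) \<Rightarrow> real \<times> real \<Rightarrow> real" where
  "trace_wall r0 r1 s u = (SOME T. has_trace r0 r1 (cell_wall r0 r1) (wall_pt s) u T)"


subsection \<open>The background flow\<close>

text \<open>
  Derivatives are one-sided at the end points of \<open>{r0..r1}\<close>. Subsonicity is required only of
  the data at \<open>r0\<close>; on the whole interval it is a consequence.
\<close>

definition background_flow ::
    "real \<Rightarrow> real \<Rightarrow> real \<Rightarrow> real \<Rightarrow> real \<Rightarrow> real \<Rightarrow> real \<Rightarrow> real \<Rightarrow> real \<Rightarrow>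
     (real \<Rightarrow> real) \<Rightarrow> (real \<Rightarrow> real) \<Rightarrow> (real \<Rightarrow> real) \<Rightarrow> (real \<Rightarrow> real) \<Rightarrow> (real \<Rightarrow> real) \<Rightarrow> bool" where
  "background_flow \<gamma> r0 r1 b0 \<rho>0 U10 U20 A0 E0 \<rho> U1 U2 A E \<longleftrightarrow>
     smooth_on_Icc r0 r1 \<rho> \<and> smooth_on_Icc r0 r1 U1 \<and> smooth_on_Icc r0 r1 U2 \<and>
     smooth_on_Icc r0 r1 E \<and>
     (\<forall>r\<in>{r0..r1}. \<rho> r > 0 \<and> U1 r > 0 \<and> A r = A0) \<and>
     (\<forall>r\<in>{r0..r1}.
        let D = (\<lambda>f. vector_derivative f (at r within {r0..r1})) in
          D (\<lambda>s. s * \<rho> s * U1 s) = 0 \<and>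
          U1 r * D U1 + 1 / \<rho> r * D (\<lambda>s. A s * \<rho> s powr \<gamma>) - 1 / r * (U2 r)\<^sup>2 = E r \<and>
          U1 r * D U2 + 1 / r * U1 r * U2 r = 0 \<and>
          U1 r * D A = 0 \<and>
          D E + 1 / r * E r = \<rho> r - b0) \<and>
     \<rho> r0 = \<rho>0 \<and> U1 r0 = U10 \<and> U2 r0 = U20 \<and> E r0 = E0 \<and>
     \<rho>0 > b0 \<and> b0 > 0 \<and> U10 > 0 \<and> A0 > 0 \<and> E0 > 0 \<and>
     \<gamma> * A0 * \<rho>0 powr (\<gamma> - 1) > U10\<^sup>2 + U20\<^sup>2"

definition sound_speed :: "real \<Rightarrow> real \<Rightarrow> (real \<Rightarrow> real) \<Rightarrow> real \<Rightarrow> real" where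
  "sound_speed \<gamma> A0 \<rho> r = sqrt (\<gamma> * A0 * \<rho> r powr (\<gamma> - 1))"

definition matA ::
    "real \<Rightarrow> real \<Rightarrow> (real \<Rightarrow> real) \<Rightarrow> (real \<Rightarrow> real) \<Rightarrow> (real \<Rightarrow> real) \<Rightarrow> real ^ 3 \<Rightarrow> real ^ 3 ^ 3" where
  "matA \<gamma> A0 \<rho> U1 U2 z =
     (let r = z $ 1; M1 = U1 r / sound_speed \<gamma> A0 \<rho> r; M2 = U2 r / sound_speed \<gamma> A0 \<rho> r in
      vector [vector [r * \<rho> r * (1 - M1\<^sup>2), - \<rho> r * M1 * M2, 0],
              vector [- \<rho> r * M1 * M2, 1 / r * \<rho> r * (1 - M2\<^sup>2), 0],
              vector [0, 0, r * \<rho> r]])"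

definition matB :: "real ^ 3 \<Rightarrow> real ^ 3 ^ 3" where
  "matB z = vector [vector [z $ 1, 0, 0], vector [0, 1 / z $ 1, 0], vector [0, 0, z $ 1]]"


subsection \<open>Weak solutions\<close>

definition admissible :: "real \<Rightarrow> real \<Rightarrow> ((real ^ 3 \<Rightarrow> real) \<times> (real ^ 3 \<Rightarrow> real)) set" where
  "admissible r0 r1 = {(\<eta>, \<xi>). \<eta> \<in> H1 r0 r1 \<and> \<xi> \<in> H1 r0 r1 \<and>
     (\<integral>z. \<eta> z \<partial>(lebesgue_on (Omega r0 r1))) = 0 \<and>
     has_trace r0 r1 cell_end (end_pt r0) \<xi> (\<lambda>_. 0) \<and>
     has_trace r0 r1 cell_end (end_pt r1) \<xi> (\<lambda>_. 0)}"

definition weak_lhs ::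
    "real \<Rightarrow> real \<Rightarrow> real \<Rightarrow> real \<Rightarrow> (real \<Rightarrow> real) \<Rightarrow> (real \<Rightarrow> real) \<Rightarrow> (real \<Rightarrow> real) \<Rightarrow>
     (real ^ 3 \<Rightarrow> real) \<Rightarrow> (real ^ 3 \<Rightarrow> real) \<Rightarrow> (real ^ 3 \<Rightarrow> real) \<Rightarrow> (real ^ 3 \<Rightarrow> real) \<Rightarrow> real" where
  "weak_lhs \<gamma> r0 r1 A0 \<rho> U1 U2 \<psi> \<phi> \<eta> \<xi> =
     (\<integral>z. (let r = z $ 1; c2 = (sound_speed \<gamma> A0 \<rho> r)\<^sup>2;
               d = wgrad r0 r1 in
        (\<Sum>i\<in>UNIV. \<Sum>j\<in>UNIV. matA \<gamma> A0 \<rho> U1 U2 z $ i $ j * d \<psi> z $ j * d \<eta> z $ i)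
        + r * \<rho> r * U1 r / c2 * \<phi> z * d \<eta> z $ 1
        + \<rho> r * U2 r / c2 * \<phi> z * d \<eta> z $ 2
        + (\<Sum>i\<in>UNIV. \<Sum>j\<in>UNIV. matB z $ i $ j * d \<phi> z $ j * d \<xi> z $ i)
        - r * \<rho> r * U1 r / c2 * d \<psi> z $ 1 * \<xi> z
        - \<rho> r * U2 r / c2 * d \<psi> z $ 2 * \<xi> z
        + r * \<rho> r / c2 * \<phi> z * \<xi> z) \<partial>(lebesgue_on (Omega r0 r1)))"

definition weak_rhs ::
    "real \<Rightarrow> real \<Rightarrow> (real ^ 3 \<Rightarrow> real ^ 3) \<Rightarrow> (real ^ 3 \<Rightarrow> real) \<Rightarrow>
     (real \<times> real \<Rightarrow> real) \<Rightarrow> (real \<times> real \<Rightarrow> real) \<Rightarrow>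
     (real ^ 3 \<Rightarrow> real) \<Rightarrow> (real ^ 3 \<Rightarrow> real) \<Rightarrow> real" where
  "weak_rhs r0 r1 F G g0 g1 \<eta> \<xi> =
     (\<integral>z. (\<Sum>i\<in>UNIV. F z $ i * wgrad r0 r1 \<eta> z $ i) - G z * \<xi> z \<partial>(lebesgue_on (Omega r0 r1)))
     + (\<integral>y. (g1 y - F (end_pt r1 y) $ 1) * trace_end r0 r1 r1 \<eta> y \<partial>(lebesgue_on cell_end))
     - (\<integral>y. (g0 y - F (end_pt r0 y) $ 1) * trace_end r0 r1 r0 \<eta> y \<partial>(lebesgue_on cell_end))
     - (\<integral>y. F (wall_pt 1 y) $ 3 * trace_wall r0 r1 1 \<eta> y \<partial>(lebesgue_on (cell_wall r0 r1)))
     + (\<integral>y. F (wall_pt (-1) y) $ 3 * trace_wall r0 r1 (-1) \<eta> y \<partial>(lebesgue_on (cell_wall r0 r1)))"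

text \<open>
  Weak solutions of the boundary value problem
    \<open>div (A grad psi) + d1 (z1 rho U1 / c^2 phi) + d2 (rho U2 / c^2 phi) = div F\<close>,
    \<open>div (B grad phi) + z1 rho U1 / c^2 d1 psi + rho U2 / c^2 d2 psi - z1 rho / c^2 phi = G\<close>
  with conormal derivative \<open>g_k\<close> of \<open>psi\<close> and \<open>phi = 0\<close> on \<open>z1 = r_k\<close>, and \<open>d3 psi = d3 phi = 0\<close>
  on \<open>z3 = 1\<close> and \<open>z3 = -1\<close>. The Neumann conditions are encoded in the variational identity.
\<close>

definition weak_solution ::
    "real \<Rightarrow> real \<Rightarrow> real \<Rightarrow> real \<Rightarrow> (real \<Rightarrow> real) \<Rightarrow> (real \<Rightarrow> real) \<Rightarrow> (real \<Rightarrow> real) \<Rightarrow>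
     (real ^ 3 \<Rightarrow> real ^ 3) \<Rightarrow> (real ^ 3 \<Rightarrow> real) \<Rightarrow>
     (real \<times> real \<Rightarrow> real) \<Rightarrow> (real \<times> real \<Rightarrow> real) \<Rightarrow>
     (real ^ 3 \<Rightarrow> real) \<Rightarrow> (real ^ 3 \<Rightarrow> real) \<Rightarrow> bool" where
  "weak_solution \<gamma> r0 r1 A0 \<rho> U1 U2 F G g0 g1 \<psi> \<phi> \<longleftrightarrow>
     (\<psi>, \<phi>) \<in> admissible r0 r1 \<and>
     (\<forall>(\<eta>, \<xi>) \<in> admissible r0 r1.
        weak_lhs \<gamma> r0 r1 A0 \<rho> U1 U2 \<psi> \<phi> \<eta> \<xi> = weak_rhs r0 r1 F G g0 g1 \<eta> \<xi>)"

definition regular_data ::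
    "real \<Rightarrow> real \<Rightarrow> real \<Rightarrow> (real ^ 3 \<Rightarrow> real ^ 3) \<Rightarrow> (real ^ 3 \<Rightarrow> real) \<Rightarrow>
     (real \<times> real \<Rightarrow> real) \<Rightarrow> (real \<times> real \<Rightarrow> real) \<Rightarrow> bool" where
  "regular_data \<beta> r0 r1 F G g0 g1 \<longleftrightarrow>
     periodic_z2 F \<and> C1_holder_on \<beta> (Omega_bar r0 r1) F \<and>
     periodic_z2 G \<and> holder_on \<beta> (Omega_bar r0 r1) G \<and>
     (\<forall>g\<in>{g0, g1}. (\<forall>z2 z3. g (z2 + 2 * pi, z3) = g (z2, z3)) \<and> C1_holder_on \<beta> closed_end g)"

end

theory Submission
  imports Defs "HOL-Library.Function_Algebras"
begin

text \<open>
  The coupling terms of the bilinear form are skew and cancel on the diagonal. The matrix \<open>A\<close> is uniformly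
  positive definite, because along the background flow the density and \<open>r E\<close> increase while the moduli of the two velocities
  decrease, so that it stays subsonic. The term \<open>z1 rho / c^2 phi^2\<close> controls \<open>phi\<close> and the Poincare inequality
  controls \<open>psi\<close>; hence the form is coercive on the pairs in \<open>admissible r0 r1\<close>. Traces are bounded on \<open>H1\<close>, so
  the right-hand side is a bounded functional and the Lax-Milgram theorem applies.

  The facts needed about \<open>H1\<close> of the strip come from the Neumann eigenfunctions
  \<open>e = cos (k pi (z1 - r0) / (r1 - r0)) cos (m z2 + theta) cos (l pi (z3 + 1) / 2)\<close> of the Laplacian, with
  eigenvalues \<open>lam\<close>. By the Stone-Weierstrass theorem an integrable function orthogonal to all of them vanishes.
  As their normal derivatives vanish on the boundary, the \<open>H1\<close> inner product of any \<open>u\<close> with \<open>e\<close> is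
  \<open>(1 + lam)\<close> times the integral of \<open>u e\<close>; so their span is dense in \<open>H1\<close>, which gives the existence of traces, and
  the spectral gap gives the Poincare inequality.
\<close>

text \<open>Elements of \<open>H1\<close> are functions, not classes modulo null sets, and
  \<open>wgrad\<close>, \<open>trace_end\<close> and \<open>trace_wall\<close> are arbitrary
  choices. Norms therefore vanish on some nonzero functions, and gradients and traces are linear
  only almost everywhere. Hence the Hilbert space theory for a semidefinite inner product, and
  uniqueness up to null sets. Traces are defined through functions that are smooth on the whole
  space. The eigenfunctions supply such approximants directly, with neither extension across the
  faces nor mollification. The obstacle is that they do not vanish near the faces, so they are not
  test functions; a cutoff argument enlarges the class against which a weak gradient may be tested.
  The final constant is \<open>K / \<alpha>\<close>: the coercivity constant \<open>\<alpha>\<close>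
  depends on the strip and the flow, and \<open>K\<close> is \<open>2\<close> plus the trace
  constants of the four faces. Both are fixed before the data are introduced.\<close>

instantiation "fun" :: (type, real_vector) real_vector
begin
text \<open>With this pointwise action \<open>subspace\<close> and \<open>span\<close> apply to sets
  of functions and, through the product type, to sets of pairs of functions.\<close>

definition scaleR_fun_def: "scaleR a f = (\<lambda>x. a *\<^sub>R f x)"
instance by standard (auto simp: scaleR_fun_def fun_eq_iff algebra_simps)
end

lemma scaleR_fun_apply [simp]: "(a *\<^sub>R f) x = a *\<^sub>R f x"
  by (simp add: scaleR_fun_def)

section \<open>Complete spaces with a semidefinite inner product\<close>

text \<open>The carrier \<open>V\<close> is explicit because the forms in question are integrals,
  which are additive only on square integrable functions.\<close>

locale semi_inner =
  fixes V :: "'v::real_vector set" and ip :: "'v \<Rightarrow> 'v \<Rightarrow> real"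
  assumes subspace_V: "subspace V"
    and ip_sym: "\<lbrakk>u \<in> V; v \<in> V\<rbrakk> \<Longrightarrow> ip u v = ip v u"
    and ip_add_left: "\<lbrakk>u \<in> V; v \<in> V; w \<in> V\<rbrakk> \<Longrightarrow> ip (u + v) w = ip u w + ip v w"
    and ip_scaleR_left: "\<lbrakk>u \<in> V; w \<in> V\<rbrakk> \<Longrightarrow> ip (a *\<^sub>R u) w = a * ip u w"
    and ip_ge_0: "u \<in> V \<Longrightarrow> 0 \<le> ip u u"
begin

lemma V_closed [simp, intro]:
  "0 \<in> V" "\<lbrakk>u \<in> V; v \<in> V\<rbrakk> \<Longrightarrow> u + v \<in> V" "\<lbrakk>u \<in> V; v \<in> V\<rbrakk> \<Longrightarrow> u - v \<in> V"
  "u \<in> V \<Longrightarrow> a *\<^sub>R u \<in> V"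
  using subspace_V by (auto simp: subspace_0 subspace_add subspace_diff subspace_scale)

lemma ip_add_right: "\<lbrakk>u \<in> V; v \<in> V; w \<in> V\<rbrakk> \<Longrightarrow> ip w (u + v) = ip w u + ip w v"
  using ip_add_left ip_sym by auto

lemma ip_scaleR_right: "\<lbrakk>u \<in> V; w \<in> V\<rbrakk> \<Longrightarrow> ip w (a *\<^sub>R u) = a * ip w u"
  using ip_scaleR_left ip_sym by auto

lemma ip_diff_left: "\<lbrakk>u \<in> V; v \<in> V; w \<in> V\<rbrakk> \<Longrightarrow> ip (u - v) w = ip u w - ip v w"
  using ip_add_left[of "u - v" v w] by simp

lemma ip_diff_right: "\<lbrakk>u \<in> V; v \<in> V; w \<in> V\<rbrakk> \<Longrightarrow> ip w (u - v) = ip w u - ip w v"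
  using ip_add_right[of "u - v" v w] by simp

lemma ip_zero [simp]: "w \<in> V \<Longrightarrow> ip 0 w = 0" "w \<in> V \<Longrightarrow> ip w 0 = 0"
  using ip_scaleR_left[of 0 w 0] ip_scaleR_right[of 0 w 0] by auto

lemmas ip_simps = ip_add_left ip_add_right ip_scaleR_left ip_scaleR_right ip_diff_left ip_diff_right

definition nrm :: "'v \<Rightarrow> real" where "nrm u = sqrt (ip u u)"

lemma nrm_ge_0 [simp]: "u \<in> V \<Longrightarrow> 0 \<le> nrm u"
  by (simp add: nrm_def ip_ge_0)

lemma nrm_sq: "u \<in> V \<Longrightarrow> (nrm u)\<^sup>2 = ip u u"
  by (simp add: nrm_def ip_ge_0)

lemma ip_square_expand:
  assumes "u \<in> V" "v \<in> V"
  shows "ip (u - t *\<^sub>R v) (u - t *\<^sub>R v) = ip u u - 2 * t * ip u v + t\<^sup>2 * ip v v"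
  using assms ip_sym[OF assms] by (simp add: ip_simps algebra_simps power2_eq_square)

text \<open>A nonnegative quadratic in \<open>t\<close> has nonpositive discriminant; the decisive
  point is \<open>t = a / b\<close>. For \<open>b = 0\<close> a linear function bounded above has
  slope zero. The case \<open>c = 0\<close> turns a first-order variation into
  orthogonality.\<close>

lemma quadratic_bound:
  fixes a b :: real
  assumes "\<And>t. 2 * t * a \<le> c + t\<^sup>2 * b" "0 \<le> b" "0 \<le> c"
  shows "a\<^sup>2 \<le> c * b"
proof (cases "b = 0")
  case True
  have "a = 0"
  proof (rule ccontr)
    assume "a \<noteq> 0"
    then have "2 * ((c + 1) / a) * a = 2 * (c + 1)" by simp
    then show False using assms(1)[of "(c + 1) / a"] assms(3) True by simp
  qed
  then show ?thesis using True by simp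
next
  case False
  then have b: "b > 0" using assms by simp
  have "2 * (a / b) * a \<le> c + (a / b)\<^sup>2 * b" by (rule assms)
  then show ?thesis using b by (simp add: field_simps power2_eq_square)
qed

lemma Cauchy_Schwarz:
  assumes "u \<in> V" "v \<in> V"
  shows "\<bar>ip u v\<bar> \<le> nrm u * nrm v"
proof -
  have "(ip u v)\<^sup>2 \<le> ip u u * ip v v"
  proof (rule quadratic_bound)
    fix t
    show "2 * t * ip u v \<le> ip u u + t\<^sup>2 * ip v v"
      using ip_square_expand[OF assms, of t] ip_ge_0[of "u - t *\<^sub>R v"] assms by auto
  qed (use assms ip_ge_0 in auto)
  then have "\<bar>ip u v\<bar> \<le> sqrt (ip u u * ip v v)"
    using real_le_rsqrt[of "\<bar>ip u v\<bar>" "ip u u * ip v v"] by simp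
  then show ?thesis by (simp add: nrm_def real_sqrt_mult)
qed

lemma nrm_triangle:
  assumes "u \<in> V" "v \<in> V"
  shows "nrm (u + v) \<le> nrm u + nrm v"
proof (rule power2_le_imp_le)
  have "(nrm (u + v))\<^sup>2 = ip u u + 2 * ip u v + ip v v"
    using assms ip_sym[OF assms] by (simp add: nrm_sq ip_simps)
  also have "\<dots> \<le> (nrm u + nrm v)\<^sup>2"
    using Cauchy_Schwarz[OF assms] nrm_sq assms by (simp add: power2_sum)
  finally show "(nrm (u + v))\<^sup>2 \<le> (nrm u + nrm v)\<^sup>2" .
qed (use assms in auto)

lemma nrm_scaleR: "u \<in> V \<Longrightarrow> nrm (a *\<^sub>R u) = \<bar>a\<bar> * nrm u"
  by (simp add: nrm_def ip_simps real_sqrt_mult flip: power2_eq_square mult.assoc)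

lemma nrm_minus_commute: "\<lbrakk>u \<in> V; v \<in> V\<rbrakk> \<Longrightarrow> nrm (u - v) = nrm (v - u)"
  using nrm_scaleR[of "v - u" "-1"] by simp

lemma nrm_triangle_diff:
  assumes "u \<in> V" "v \<in> V" "w \<in> V"
  shows "nrm (u - w) \<le> nrm (u - v) + nrm (v - w)"
  using nrm_triangle[of "u - v" "v - w"] assms by auto

lemma nrm_diff_abs:
  assumes "u \<in> V" "v \<in> V"
  shows "\<bar>nrm u - nrm v\<bar> \<le> nrm (u - v)"
  using nrm_triangle[of "u - v" v] nrm_triangle[of "v - u" u] nrm_minus_commute[of u v] assms by auto

text \<open>Lipschitz continuity is assumed instead of linearity, so that norms pass to the limit as
  well as integrals.\<close>

lemma tendsto_by_nrm:
  fixes f :: "'v \<Rightarrow> real"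
  assumes "\<forall>n. Y n \<in> V" "p \<in> V" "(\<lambda>n. nrm (Y n - p)) \<longlonglongrightarrow> 0"
    and "\<And>u v. \<lbrakk>u \<in> V; v \<in> V\<rbrakk> \<Longrightarrow> \<bar>f u - f v\<bar> \<le> K * nrm (u - v)"
  shows "(\<lambda>n. f (Y n)) \<longlonglongrightarrow> f p"
proof -
  have "(\<lambda>n. K * nrm (Y n - p)) \<longlonglongrightarrow> 0" using tendsto_mult_right_zero[OF assms(3)] by simp
  then have "(\<lambda>n. f (Y n) - f p) \<longlonglongrightarrow> 0"
    by (rule Lim_null_comparison[rotated]) (use assms in auto)
  then show ?thesis by (simp add: LIM_zero_iff)
qed

lemma tendsto_ip_left:
  assumes "\<forall>n. Y n \<in> V" "p \<in> V" "(\<lambda>n. nrm (Y n - p)) \<longlonglongrightarrow> 0" "w \<in> V"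
  shows "(\<lambda>n. ip (Y n) w) \<longlonglongrightarrow> ip p w"
proof (rule tendsto_by_nrm[OF assms(1-3)])
  fix u v assume uv: "u \<in> V" "v \<in> V"
  have "\<bar>ip (u - v) w\<bar> \<le> nrm (u - v) * nrm w" using Cauchy_Schwarz uv assms(4) by auto
  then show "\<bar>ip u w - ip v w\<bar> \<le> nrm w * nrm (u - v)"
    using uv assms(4) by (simp add: ip_simps mult.commute)
qed

end

locale semi_hilbert = semi_inner +
  assumes complete: "\<lbrakk>\<forall>n. X n \<in> V; \<forall>e>0. \<exists>N. \<forall>m\<ge>N. \<forall>n\<ge>N. nrm (X m - X n) < e\<rbrakk>
      \<Longrightarrow> \<exists>L\<in>V. (\<lambda>n. nrm (X n - L)) \<longlonglongrightarrow> 0"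
begin

text \<open>\<open>W\<close> need not be closed: the projection \<open>p\<close> is a limit of
  elements of \<open>W\<close> and may lie outside it. The approximating sequence is therefore part
  of the result, in place of the closure of \<open>W\<close>.\<close>

lemma best_approximation:
  assumes W: "subspace W" "W \<subseteq> V" and u: "u \<in> V"
  obtains p Y where "p \<in> V" "\<forall>n. Y n \<in> W" "(\<lambda>n. nrm (Y n - p)) \<longlonglongrightarrow> 0" "\<forall>y\<in>W. ip (u - p) y = 0"
proof -
  define Q where "Q y = ip (u - y) (u - y)" for y
  define d where "d = (INF y\<in>W. Q y)"
  have W0: "W \<noteq> {}" using subspace_0[OF W(1)] by auto
  have bdd: "bdd_below (Q ` W)" using W u by (auto simp: Q_def intro!: bdd_belowI[of _ 0] ip_ge_0)
  have dle: "d \<le> Q y" if "y \<in> W" for y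
    unfolding d_def by (rule cINF_lower[OF bdd that])
  have "\<exists>y\<in>W. Q y < d + 1 / real (Suc n)" for n
    using cINF_less_iff[OF W0 bdd, of "d + 1 / real (Suc n)"] by (simp add: d_def)
  then obtain Y where Y: "\<And>n. Y n \<in> W" "\<And>n. Q (Y n) < d + 1 / real (Suc n)" by metis
  have YV: "Y n \<in> V" for n using Y W by auto
  \<comment> \<open>Parallelogram law: the midpoint of \<open>Y m\<close> and \<open>Y n\<close>
    lies in \<open>W\<close>, so its squared distance to \<open>u\<close> is at least
    \<open>d\<close>, which cancels against the two nearly minimal values.\<close>
  have par: "ip (Y m - Y n) (Y m - Y n) \<le> 2 / real (Suc m) + 2 / real (Suc n)" for m n
  proof -
    let ?h = "(1/2) *\<^sub>R (Y m + Y n)"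
    have "ip (Y m - Y n) (Y m - Y n) = 2 * Q (Y m) + 2 * Q (Y n) - 4 * Q ?h"
      unfolding Q_def using u YV[of m] YV[of n] ip_sym[of u "Y m"] ip_sym[of u "Y n"]
        ip_sym[of "Y m" "Y n"]
      by (simp add: ip_simps field_simps)
    moreover have "?h \<in> W" using Y W(1) by (simp add: subspace_add subspace_scale)
    ultimately show ?thesis using dle[of ?h] Y(2)[of m] Y(2)[of n] by simp
  qed
  have "\<forall>e>0. \<exists>N. \<forall>m\<ge>N. \<forall>n\<ge>N. nrm (Y m - Y n) < e"
  proof (intro allI impI)
    fix e :: real assume e: "e > 0"
    then obtain N where N: "1 / real (Suc N) < e\<^sup>2 / 4"
      using nat_approx_posE[of "e\<^sup>2 / 4"] by (metis divide_pos_pos zero_less_numeral zero_less_power)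
    have "nrm (Y m - Y n) < e" if "m \<ge> N" "n \<ge> N" for m n
    proof -
      have "1 / real (Suc m) \<le> 1 / real (Suc N)" "1 / real (Suc n) \<le> 1 / real (Suc N)"
        using that by (auto simp: field_simps)
      then have "ip (Y m - Y n) (Y m - Y n) < e\<^sup>2" using par[of m n] N by linarith
      then show ?thesis unfolding nrm_def using e real_less_lsqrt[of e] by simp
    qed
    then show "\<exists>N. \<forall>m\<ge>N. \<forall>n\<ge>N. nrm (Y m - Y n) < e" by blast
  qed
  then obtain p where p: "p \<in> V" "(\<lambda>n. nrm (Y n - p)) \<longlonglongrightarrow> 0" using complete[of Y] YV by auto
  have "ip (u - p) y = 0" if y: "y \<in> W" for y
  proof -
    have yV: "y \<in> V" using y W by auto
    have lim: "(\<lambda>n. ip (u - Y n) y) \<longlonglongrightarrow> ip (u - p) y"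
      using tendsto_diff[OF tendsto_const[of "ip u y"] tendsto_ip_left[OF _ p yV]] YV u p(1) yV
      by (simp add: ip_simps)
    \<comment> \<open>A variation of \<open>Y n\<close> in the direction \<open>y\<close> stays in
      \<open>W\<close> and gains at most \<open>1 / Suc n\<close>. In the limit the error is gone,
      and the inequality for all \<open>t\<close> forces the linear term to vanish.\<close>
    have "2 * t * ip (u - p) y \<le> 0 + t\<^sup>2 * ip y y" for t
    proof (rule LIMSEQ_le)
      show "(\<lambda>n. 2 * t * ip (u - Y n) y) \<longlonglongrightarrow> 2 * t * ip (u - p) y" by (intro tendsto_intros lim)
      show "(\<lambda>n. 1 / real (Suc n) + t\<^sup>2 * ip y y) \<longlonglongrightarrow> 0 + t\<^sup>2 * ip y y"
        using LIMSEQ_inverse_real_of_nat by (intro tendsto_intros) (simp add: inverse_eq_divide)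
      have "2 * t * ip (u - Y n) y \<le> 1 / real (Suc n) + t\<^sup>2 * ip y y" for n
      proof -
        have "Y n + t *\<^sub>R y \<in> W" using Y y W(1) by (simp add: subspace_add subspace_scale)
        from dle[OF this] have "d \<le> ip (u - Y n - t *\<^sub>R y) (u - Y n - t *\<^sub>R y)"
          by (simp add: Q_def algebra_simps)
        also have "\<dots> = Q (Y n) - 2 * t * ip (u - Y n) y + t\<^sup>2 * ip y y"
          unfolding Q_def by (rule ip_square_expand) (use u YV yV in auto)
        finally show ?thesis using Y(2)[of n] by linarith
      qed
      then show "\<exists>N. \<forall>n\<ge>N. 2 * t * ip (u - Y n) y \<le> 1 / real (Suc n) + t\<^sup>2 * ip y y" by blast
    qed
    then have "(ip (u - p) y)\<^sup>2 \<le> 0 * ip y y"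
      by (rule quadratic_bound) (use yV ip_ge_0 in auto)
    then show ?thesis by simp
  qed
  then show thesis using that p Y(1) by blast
qed

text \<open>The component of \<open>u\<close> orthogonal to \<open>W\<close> has norm zero, so a
  sequence that converges to the projection converges to \<open>u\<close> as well.\<close>

lemma dense_if_orthogonal_trivial:
  assumes W: "subspace W" "W \<subseteq> V" and u: "u \<in> V"
    and triv: "\<And>w. \<lbrakk>w \<in> V; \<forall>y\<in>W. ip w y = 0\<rbrakk> \<Longrightarrow> ip w w = 0"
  obtains Y where "\<forall>n. Y n \<in> W" "(\<lambda>n. nrm (Y n - u)) \<longlonglongrightarrow> 0"
proof -
  obtain p Y where p: "p \<in> V" "\<forall>n. Y n \<in> W" "(\<lambda>n. nrm (Y n - p)) \<longlonglongrightarrow> 0"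
    "\<forall>y\<in>W. ip (u - p) y = 0" using best_approximation[OF W u] by blast
  have "nrm (u - p) = 0" using triv[of "u - p"] p u by (auto simp: nrm_def)
  then have *: "nrm (p - u) = 0" using nrm_minus_commute u p by auto
  have "(\<lambda>n. nrm (Y n - u)) \<longlonglongrightarrow> 0"
  proof (rule tendsto_sandwich[OF _ _ tendsto_const p(3)])
    show "\<forall>\<^sub>F n in sequentially. nrm (Y n - u) \<le> nrm (Y n - p)"
      using nrm_triangle_diff[of _ p u] * p u W by (auto intro!: always_eventually)
  qed (use p u W in \<open>auto intro!: always_eventually nrm_ge_0\<close>)
  then show thesis using that p by blast
qed

text \<open>The representer is a rescaled vector \<open>z\<close> orthogonal to the kernel.
  Boundedness makes the kernel closed, so the projection \<open>p\<close> of \<open>u\<close> onto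
  it still satisfies \<open>l p = 0\<close>.\<close>

lemma riesz:
  assumes add: "\<And>u v. \<lbrakk>u \<in> V; v \<in> V\<rbrakk> \<Longrightarrow> l (u + v) = l u + l v"
    and scale: "\<And>a u. u \<in> V \<Longrightarrow> l (a *\<^sub>R u) = a * l u"
    and bdd: "\<And>u. u \<in> V \<Longrightarrow> \<bar>l u\<bar> \<le> K * nrm u"
  obtains f where "f \<in> V" "\<forall>v\<in>V. l v = ip f v"
proof (cases "\<forall>v\<in>V. l v = 0")
  case True
  then show thesis using that[of 0] by auto
next
  case False
  then obtain u where u: "u \<in> V" "l u \<noteq> 0" by auto
  have diff: "l (a - b) = l a - l b" if "a \<in> V" "b \<in> V" for a b
    using add[of "a - b" b] that by simp
  define W where "W = {v\<in>V. l v = 0}"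
  have W: "subspace W" "W \<subseteq> V"
    using add scale scale[of 0 0] by (auto simp: W_def subspace_def)
  obtain p Y where p: "p \<in> V" "\<forall>n. Y n \<in> W" "(\<lambda>n. nrm (Y n - p)) \<longlonglongrightarrow> 0"
    "\<forall>y\<in>W. ip (u - p) y = 0" using best_approximation[OF W u(1)] by blast
  have "(\<lambda>n. l (Y n)) \<longlonglongrightarrow> l p"
    by (rule tendsto_by_nrm[OF _ p(1,3), where K=K]) (use p W bdd diff in \<open>auto simp flip: diff\<close>)
  moreover have "l (Y n) = 0" for n using p(2) by (auto simp: W_def)
  ultimately have lp: "l p = 0" by (simp add: LIMSEQ_const_iff)
  define z where "z = u - p"
  have z: "z \<in> V" "l z \<noteq> 0" using diff u p lp by (auto simp: z_def)
  \<comment> \<open>A bounded functional vanishes on vectors of norm zero, so even the semidefinite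
    form is nonzero at \<open>z\<close>.\<close>
  have zz: "ip z z \<noteq> 0" using bdd[OF z(1)] z(2) by (auto simp: nrm_def)
  have "l v = ip ((l z / ip z z) *\<^sub>R z) v" if v: "v \<in> V" for v
  proof -
    have "v - (l v / l z) *\<^sub>R z \<in> W" using v z diff scale by (auto simp: W_def)
    then have "ip z (v - (l v / l z) *\<^sub>R z) = 0" using p(4) by (auto simp: z_def)
    then show ?thesis using v z zz by (simp add: ip_simps field_simps)
  qed
  then show thesis using that[OF V_closed(4)[OF z(1)]] by blast
qed

text \<open>
  The \<open>y\<close> that represent some \<open>B u\<close> form the subspace \<open>R\<close>, which coercivity makes closed; a vector \<open>w\<close> orthogonal to
  \<open>R\<close> satisfies \<open>B w w = 0\<close>.
\<close>

lemma lax_milgram: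
  assumes B1: "\<And>u v w. \<lbrakk>u \<in> V; v \<in> V; w \<in> V\<rbrakk> \<Longrightarrow> B (u + v) w = B u w + B v w"
    and B2: "\<And>a u w. \<lbrakk>u \<in> V; w \<in> V\<rbrakk> \<Longrightarrow> B (a *\<^sub>R u) w = a * B u w"
    and B3: "\<And>u v w. \<lbrakk>u \<in> V; v \<in> V; w \<in> V\<rbrakk> \<Longrightarrow> B w (u + v) = B w u + B w v"
    and B4: "\<And>a u w. \<lbrakk>u \<in> V; w \<in> V\<rbrakk> \<Longrightarrow> B w (a *\<^sub>R u) = a * B w u"
    and Bb: "\<And>u v. \<lbrakk>u \<in> V; v \<in> V\<rbrakk> \<Longrightarrow> \<bar>B u v\<bar> \<le> K * nrm u * nrm v"
    and co: "\<alpha> > 0" "\<And>u. u \<in> V \<Longrightarrow> \<alpha> * (nrm u)\<^sup>2 \<le> B u u"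
    and add: "\<And>u v. \<lbrakk>u \<in> V; v \<in> V\<rbrakk> \<Longrightarrow> l (u + v) = l u + l v"
    and scale: "\<And>a u. u \<in> V \<Longrightarrow> l (a *\<^sub>R u) = a * l u"
    and bdd: "\<And>u. u \<in> V \<Longrightarrow> \<bar>l u\<bar> \<le> D * nrm u"
    and D: "0 \<le> D"
  obtains u where "u \<in> V" "\<forall>v\<in>V. B u v = l v" "nrm u \<le> D / \<alpha>" 
proof -
  obtain f where f: "f \<in> V" "\<forall>v\<in>V. l v = ip f v" using riesz[OF add scale bdd] by blast
  have rep: "\<exists>y\<in>V. \<forall>v\<in>V. B u v = ip y v" if "u \<in> V" for u
    by (rule riesz[of "B u" "K * nrm u"]) (use that B3 B4 Bb in auto)
  have Bd: "B (u - v) w = B u w - B v w" if "u \<in> V" "v \<in> V" "w \<in> V" for u v w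
    using B1[of "u - v" v w] that by simp
  define R where "R = {y\<in>V. \<exists>u\<in>V. \<forall>v\<in>V. B u v = ip y v}"
  have "subspace R"
    unfolding subspace_def
  proof (intro conjI ballI allI)
    show "0 \<in> R" using B2[of 0 _ 0] by (auto simp: R_def intro!: bexI[of _ 0])
  next
    fix x y assume "x \<in> R" "y \<in> R"
    then obtain a b where "x \<in> V" "y \<in> V" "a \<in> V" "b \<in> V" "\<forall>v\<in>V. B a v = ip x v" "\<forall>v\<in>V. B b v = ip y v"
      by (auto simp: R_def)
    then show "x + y \<in> R" using B1 by (auto simp: R_def ip_simps intro!: bexI[of _ "a + b"])
  next
    fix c x assume "x \<in> R"
    then obtain a where "x \<in> V" "a \<in> V" "\<forall>v\<in>V. B a v = ip x v" by (auto simp: R_def)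
    then show "c *\<^sub>R x \<in> R" using B2 by (auto simp: R_def ip_simps intro!: bexI[of _ "c *\<^sub>R a"])
  qed
  moreover have RV: "R \<subseteq> V" by (auto simp: R_def)
  ultimately obtain p Y where p: "p \<in> V" "\<forall>n. Y n \<in> R" "(\<lambda>n. nrm (Y n - p)) \<longlonglongrightarrow> 0"
    "\<forall>y\<in>R. ip (f - p) y = 0" using best_approximation[OF _ _ f(1)] by blast
  have YV: "Y n \<in> V" for n using p RV by auto
  obtain U where U: "\<And>n. U n \<in> V" "\<And>n v. v \<in> V \<Longrightarrow> B (U n) v = ip (Y n) v"
    using p(2) unfolding R_def by (simp add: set_eq_iff) metis
  \<comment> \<open>Coercivity for \<open>U m - U n\<close> followed by Cauchy-Schwarz; one factor
    of the norm cancels. Thus preimages of a Cauchy sequence form a Cauchy sequence.\<close>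
  have UY: "nrm (U m - U n) \<le> nrm (Y m - Y n) / \<alpha>" for m n
  proof -
    let ?d = "U m - U n"
    have dV: "?d \<in> V" using U by auto
    have "\<alpha> * (nrm ?d)\<^sup>2 \<le> B ?d ?d" by (rule co(2)[OF dV])
    also have "\<dots> = ip (Y m - Y n) ?d" using U(1)[of m] U(1)[of n] dV U(2) Bd YV by (simp add: ip_diff_left)
    also have "\<dots> \<le> nrm (Y m - Y n) * nrm ?d" using Cauchy_Schwarz[of "Y m - Y n" ?d] YV dV by fastforce
    finally have "nrm ?d * (\<alpha> * nrm ?d) \<le> nrm ?d * nrm (Y m - Y n)"
      by (simp add: power2_eq_square mult_ac)
    moreover have "0 \<le> nrm (Y m - Y n)" "0 \<le> nrm ?d" using YV dV by auto
    ultimately have "\<alpha> * nrm ?d \<le> nrm (Y m - Y n)"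
      by (cases "nrm ?d = 0") auto
    then show ?thesis using co(1) by (simp add: field_simps)
  qed
  have "\<forall>e>0. \<exists>N. \<forall>m\<ge>N. \<forall>n\<ge>N. nrm (U m - U n) < e"
  proof (intro allI impI)
    fix e :: real assume e: "e > 0"
    then have "\<alpha> * e / 2 > 0" using co(1) by simp
    from order_tendstoD(2)[OF p(3) this]
    obtain N where N: "\<forall>n\<ge>N. nrm (Y n - p) < \<alpha> * e / 2" by (auto simp: eventually_sequentially)
    have "nrm (U m - U n) < e" if "m \<ge> N" "n \<ge> N" for m n
    proof -
      have "nrm (Y m - Y n) \<le> nrm (Y m - p) + nrm (p - Y n)" using nrm_triangle_diff YV p(1) by auto
      also have "nrm (p - Y n) = nrm (Y n - p)" using nrm_minus_commute YV p(1) by auto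
      finally have "nrm (Y m - Y n) \<le> nrm (Y m - p) + nrm (Y n - p)" .
      moreover have "nrm (Y m - p) < \<alpha> * e / 2" "nrm (Y n - p) < \<alpha> * e / 2" using N that by auto
      ultimately have "nrm (Y m - Y n) < \<alpha> * e" by simp
      then have "nrm (Y m - Y n) / \<alpha> < e" using co(1) by (simp add: field_simps)
      then show ?thesis using UY[of m n] by linarith
    qed
    then show "\<exists>N. \<forall>m\<ge>N. \<forall>n\<ge>N. nrm (U m - U n) < e" by blast
  qed
  then obtain u where u: "u \<in> V" "(\<lambda>n. nrm (U n - u)) \<longlonglongrightarrow> 0" using complete[of U] U by auto
  have Bu: "B u v = ip p v" if v: "v \<in> V" for v
  proof -
    have "(\<lambda>n. B (U n) v) \<longlonglongrightarrow> B u v"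
      proof (rule tendsto_by_nrm[OF _ u, where K="K * nrm v"])
      fix x y assume "x \<in> V" "y \<in> V"
      then show "\<bar>B x v - B y v\<bar> \<le> K * nrm v * nrm (x - y)"
        using Bb[of "x - y" v] Bd[of x y v] v by (simp add: mult_ac)
    qed (use U in auto)
    moreover have "(\<lambda>n. B (U n) v) \<longlonglongrightarrow> ip p v"
      using tendsto_ip_left[OF _ p(1,3) v] YV U(2)[OF v] by simp
    ultimately show ?thesis by (rule LIMSEQ_unique)
  qed
  define w where "w = f - p"
  have w: "w \<in> V" using f p by (simp add: w_def)
  obtain y where y: "y \<in> V" "\<forall>v\<in>V. B w v = ip y v" using rep[OF w] by blast
  then have "ip w y = 0" using p(4) w by (auto simp: R_def w_def)
  then have "B w w = 0" using y w ip_sym by simp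
  then have w0: "nrm w = 0" using co(1) co(2)[OF w]
    by (simp add: mult_le_0_iff)
  \<comment> \<open>\<open>w\<close> has norm zero but need not be the zero vector, so
    \<open>ip w v = 0\<close> has to come from Cauchy-Schwarz.\<close>
  have eq: "B u v = l v" if v: "v \<in> V" for v
  proof -
    have "ip w v = 0" using Cauchy_Schwarz[OF w v] w0 by simp
    then show ?thesis using Bu[OF v] f v p by (simp add: w_def ip_simps)
  qed
  have "\<alpha> * (nrm u)\<^sup>2 \<le> D * nrm u" using co(2)[OF u(1)] eq[OF u(1)] bdd[OF u(1)] by simp
  then have "nrm u \<le> D / \<alpha>"
    using nrm_ge_0[OF u(1)] co(1) D by (cases "nrm u = 0") (auto simp: power2_eq_square field_simps)
  then show thesis using that u(1) eq by blast
qed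

end

section \<open>Square integrable functions\<close>

text \<open>Vector values are allowed so that a function together with its gradient is one element
  of one L2 space, from which the Sobolev structures are pulled back.\<close>

definition L2_ip :: "'a::euclidean_space set \<Rightarrow> ('a \<Rightarrow> 'b::euclidean_space) \<Rightarrow> ('a \<Rightarrow> 'b) \<Rightarrow> real" where
  "L2_ip S f g = (\<integral>x. f x \<bullet> g x \<partial>(lebesgue_on S))"

lemma L2_on_measurable : "L2_on S f \<Longrightarrow> f \<in> borel_measurable (lebesgue_on S)"
  by (simp add: L2_on_def)

lemma L2_on_integrable: "L2_on S f \<Longrightarrow> integrable (lebesgue_on S) (\<lambda>x. (norm (f x))\<^sup>2)"
  by (simp add: L2_on_def)

lemma L2_onI:
  assumes "f \<in> borel_measurable (lebesgue_on S)" "integrable (lebesgue_on S) g"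
    "AE x in lebesgue_on S. (norm (f x))\<^sup>2 \<le> g x"
  shows "L2_on S f"
proof -
  have "integrable (lebesgue_on S) (\<lambda>x. (norm (f x))\<^sup>2)"
    by (rule Bochner_Integration.integrable_bound[OF assms(2)])
       (use assms(1) in measurable, use assms(3) in eventually_elim, auto)
  then show ?thesis using assms(1) by (simp add: L2_on_def)
qed

lemma L2_on_bound:
  assumes "f \<in> borel_measurable (lebesgue_on S)" "L2_on S g"
    "AE x in lebesgue_on S. norm (f x) \<le> C * norm (g x)"
  shows "L2_on S f"
proof (rule L2_onI[OF assms(1)])
  show "integrable (lebesgue_on S) (\<lambda>x. C\<^sup>2 * (norm (g x))\<^sup>2)"
    using L2_on_integrable[OF assms(2)] by simp
  show "AE x in lebesgue_on S. (norm (f x))\<^sup>2 \<le> C\<^sup>2 * (norm (g x))\<^sup>2"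
    using assms(3) by eventually_elim (auto simp flip: power_mult_distrib intro!: power_mono)
qed

lemma L2_on_add:
  assumes "L2_on S f" "L2_on S g"
  shows "L2_on S (\<lambda>x. f x + g x)"
proof (rule L2_onI)
  show "integrable (lebesgue_on S) (\<lambda>x. 2 * (norm (f x))\<^sup>2 + 2 * (norm (g x))\<^sup>2)"
    using assms[THEN L2_on_integrable] by simp
  have "(norm (a + b))\<^sup>2 \<le> 2 * (norm a)\<^sup>2 + 2 * (norm b)\<^sup>2" for a b :: 'b
  proof -
    have "(norm (a + b))\<^sup>2 \<le> (norm a + norm b)\<^sup>2" by (intro power_mono norm_triangle_ineq) auto
    also have "\<dots> \<le> 2 * (norm a)\<^sup>2 + 2 * (norm b)\<^sup>2"
      using sum_squares_bound[of "norm a" "norm b"] by (simp add: power2_sum)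
    finally show ?thesis .
  qed
  then show "AE x in lebesgue_on S. (norm (f x + g x))\<^sup>2 \<le> 2 * (norm (f x))\<^sup>2 + 2 * (norm (g x))\<^sup>2"
    by simp
qed (use assms[THEN L2_on_measurable] in measurable)

lemma L2_on_scaleR:
  assumes "L2_on S f" shows "L2_on S (\<lambda>x. a *\<^sub>R f x)"
  by (rule L2_on_bound[OF _ assms, where C="\<bar>a\<bar>"])
     (use L2_on_measurable[OF assms] in auto)

lemma L2_on_cmult: "L2_on S f \<Longrightarrow> L2_on S (\<lambda>x. a * f x)" for f :: "'a::euclidean_space \<Rightarrow> real"
  using L2_on_scaleR[of S f a] by simp

lemma L2_on_zero [simp]: "L2_on S (\<lambda>x. 0)"
  by (simp add: L2_on_def)

lemma L2_on_minus: "L2_on S f \<Longrightarrow> L2_on S (\<lambda>x. - f x)"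
  using L2_on_scaleR[of S f "-1"] by simp

lemma L2_on_diff: "\<lbrakk>L2_on S f; L2_on S g\<rbrakk> \<Longrightarrow> L2_on S (\<lambda>x. f x - g x)"
  using L2_on_add[of S f "\<lambda>x. - g x"] L2_on_minus[of S g] by simp

lemma L2_on_Pair_iff: "L2_on S (\<lambda>x. (f x, g x)) \<longleftrightarrow> L2_on S f \<and> L2_on S g"
proof safe
  assume *: "L2_on S (\<lambda>x. (f x, g x))"
  have m: "f \<in> borel_measurable (lebesgue_on S)" "g \<in> borel_measurable (lebesgue_on S)"
    using measurable_compose[OF L2_on_measurable[OF *], of fst borel]
      measurable_compose[OF L2_on_measurable[OF *], of snd borel]
    by (simp_all add: borel_measurable_continuous_onI continuous_on_fst continuous_on_snd)
  show "L2_on S f" by (rule L2_on_bound[OF m(1) *, where C=1]) (auto simp: norm_Pair real_le_rsqrt)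
  show "L2_on S g" by (rule L2_on_bound[OF m(2) *, where C=1]) (auto simp: norm_Pair real_le_rsqrt)
next
  assume fg: "L2_on S f" "L2_on S g"
  have m: "(\<lambda>x. (f x, g x)) \<in> borel_measurable (lebesgue_on S)"
    using fg by (intro borel_measurable_Pair L2_on_measurable)
  show "L2_on S (\<lambda>x. (f x, g x))"
    by (rule L2_onI[OF m, where g="\<lambda>x. (norm (f x))\<^sup>2 + (norm (g x))\<^sup>2"])
       (use fg[THEN L2_on_integrable] in \<open>auto simp: norm_Pair\<close>)
qed

lemma L2_on_inner_right:
  assumes "L2_on S f" shows "L2_on S (\<lambda>x. f x \<bullet> b)"
  by (rule L2_on_bound[OF _ assms, where C="norm b"])
     (use L2_on_measurable[OF assms] in \<open>auto simp: Cauchy_Schwarz_ineq2 mult.commute[of "norm b"]\<close>)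

lemma L2_on_nth: "L2_on S f \<Longrightarrow> L2_on S (\<lambda>x. f x $ i)"
  for f :: "'a::euclidean_space \<Rightarrow> real ^ 'n"
  using L2_on_inner_right[of S f "axis i 1"] by (simp add: inner_axis)

lemma L2_inner_integrable:
  assumes "L2_on S f" "L2_on S g"
  shows "integrable (lebesgue_on S) (\<lambda>x. f x \<bullet> g x)"
proof (rule Bochner_Integration.integrable_bound)
  show "integrable (lebesgue_on S) (\<lambda>x. (norm (f x))\<^sup>2 + (norm (g x))\<^sup>2)"
    using assms[THEN L2_on_integrable] by simp
  have "\<bar>a \<bullet> b\<bar> \<le> (norm a)\<^sup>2 + (norm b)\<^sup>2" for a b :: 'b
    using Cauchy_Schwarz_ineq2[of a b] sum_squares_bound[of "norm a" "norm b"]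
      mult_nonneg_nonneg[OF norm_ge_zero[of a] norm_ge_zero[of b]] by linarith
  then show "AE x in lebesgue_on S. norm (f x \<bullet> g x) \<le> norm ((norm (f x))\<^sup>2 + (norm (g x))\<^sup>2)"
    by simp
qed (use assms[THEN L2_on_measurable] in measurable)

lemma L2_mult_integrable:
  fixes f g :: "'a::euclidean_space \<Rightarrow> real"
  shows "\<lbrakk>L2_on S f; L2_on S g\<rbrakk> \<Longrightarrow> integrable (lebesgue_on S) (\<lambda>x. f x * g x)"
  using L2_inner_integrable[of S f g] by simp

lemma L2_norm_ge_0 [simp]: "0 \<le> L2_norm S f"
  by (simp add: L2_norm_def integral_nonneg_AE)

lemma L2_norm_sq: "(L2_norm S f)\<^sup>2 = (\<integral>x. (norm (f x))\<^sup>2 \<partial>(lebesgue_on S))"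
  by (simp add: L2_norm_def integral_nonneg_AE)

lemma L2_norm_sq_nn:
  assumes "L2_on S f"
  shows "(\<integral>\<^sup>+x. ennreal ((norm (f x))\<^sup>2) \<partial>(lebesgue_on S)) = ennreal ((L2_norm S f)\<^sup>2)"
  unfolding L2_norm_sq by (rule nn_integral_eq_integral) (use assms in \<open>auto simp: L2_on_def\<close>)

lemma L2_norm_AE_cong:
  assumes "AE x in lebesgue_on S. f x = g x" "f \<in> borel_measurable (lebesgue_on S)"
    "g \<in> borel_measurable (lebesgue_on S)"
  shows "L2_norm S f = L2_norm S g"
  unfolding L2_norm_def using assms by (auto intro!: integral_cong_AE)

lemma L2_norm_eq_0_AE:
  assumes "L2_on S f" "L2_norm S f = 0"
  shows "AE x in lebesgue_on S. f x = 0"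
proof -
  have "(\<integral>x. (norm (f x))\<^sup>2 \<partial>(lebesgue_on S)) = 0" using assms(2) by (simp flip: L2_norm_sq)
  then have "AE x in lebesgue_on S. (norm (f x))\<^sup>2 = 0"
    using integral_nonneg_eq_0_iff_AE[of "lebesgue_on S" "\<lambda>x. (norm (f x))\<^sup>2"] L2_on_integrable[OF assms(1)]
    by simp
  then show ?thesis by simp
qed

lemma semi_inner_L2: "semi_inner {f. L2_on S f} (L2_ip S)"
proof
  show "subspace {f. L2_on S (f :: _ \<Rightarrow> 'b)}"
    by (auto simp: subspace_def zero_fun_def plus_fun_def scaleR_fun_def L2_on_add L2_on_scaleR)
qed (auto simp: L2_ip_def inner_add_left L2_inner_integrable, simp add: inner_commute)

text \<open>Riesz-Fischer: a fast subsequence converges almost everywhere, and Fatou's lemma along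
  it bounds the distance of every late \<open>X m\<close> to the pointwise limit.\<close>

lemma L2_complete:
  fixes X :: "nat \<Rightarrow> 'a::euclidean_space \<Rightarrow> 'b::euclidean_space"
  assumes X: "\<And>n. L2_on S (X n)"
    and C: "\<And>e. e > 0 \<Longrightarrow> \<exists>N. \<forall>m\<ge>N. \<forall>n\<ge>N. L2_norm S (\<lambda>x. X m x - X n x) < e"
  obtains L where "L2_on S L" "(\<lambda>n. L2_norm S (\<lambda>x. X n x - L x)) \<longlonglongrightarrow> 0"
proof -
  let ?M = "lebesgue_on S"
  note [measurable] = L2_on_measurable[OF X]
  obtain N where N: "\<And>k m n. \<lbrakk>m \<ge> N k; n \<ge> N k\<rbrakk> \<Longrightarrow> L2_norm S (\<lambda>x. X m x - X n x) < (1/4) ^ k"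
    using C[of "(1/4) ^ _"] by (metis zero_less_divide_1_iff zero_less_numeral zero_less_power)
  \<comment> \<open>The cumulative sum makes \<open>r\<close> increasing with \<open>r k\<close> at
    least \<open>N k\<close>; the summand \<open>k\<close> makes \<open>r k\<close> at least
    \<open>k\<close>, so that it eventually passes any given index.\<close>
  define r where "r k = k + (\<Sum>j\<le>k. N j)" for k
  have rN: "N k \<le> r k" for k
    unfolding r_def using member_le_sum[of k "{..k}" N] by (simp add: trans_le_add2)
  have rS: "r k \<le> r (Suc k)" for k by (simp add: r_def)
  define D where "D k x = X (r (Suc k)) x - X (r k) x" for k x
  have D: "L2_on S (D k)" for k unfolding D_def by (rule L2_on_diff[OF X X])
  note [measurable] = L2_on_measurable[OF D]
  have "(L2_norm S (D k))\<^sup>2 \<le> ((1/4) ^ k)\<^sup>2" for k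
    using N[of k "r (Suc k)" "r k"] rN[of k] rS[of k] by (intro power_mono) (auto simp: D_def[abs_def])
  then have Dk: "4 ^ k * (L2_norm S (D k))\<^sup>2 \<le> (1/4) ^ k" for k
    by (simp add: field_simps power2_eq_square)
  txt \<open>The weights \<open>4 ^ k\<close> turn integrability of the series into geometric decay of \<open>D k x\<close> for almost all \<open>x\<close>.\<close>
  have "(\<integral>\<^sup>+x. (\<Sum>k. ennreal (4 ^ k * (norm (D k x))\<^sup>2)) \<partial>?M)
      = (\<Sum>k. \<integral>\<^sup>+x. ennreal (4 ^ k * (norm (D k x))\<^sup>2) \<partial>?M)"
    by (intro nn_integral_suminf) measurable
  also have "\<dots> = (\<Sum>k. ennreal (4 ^ k * (L2_norm S (D k))\<^sup>2))"
    by (simp add: ennreal_mult nn_integral_cmult L2_norm_sq_nn[OF D])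
  also have "\<dots> \<le> (\<Sum>k. ennreal ((1/4) ^ k))"
    using Dk by (intro suminf_le) (auto intro!: ennreal_leI)
  also have "\<dots> = ennreal (\<Sum>k. (1/4) ^ k)"
    by (intro suminf_ennreal2) (auto simp: summable_geometric)
  finally have "(\<integral>\<^sup>+x. (\<Sum>k. ennreal (4 ^ k * (norm (D k x))\<^sup>2)) \<partial>?M) \<noteq> \<infinity>"
    by (auto simp: top_unique)
  then have "AE x in ?M. (\<Sum>k. ennreal (4 ^ k * (norm (D k x))\<^sup>2)) \<noteq> \<infinity>"
    by (intro nn_integral_PInf_AE) measurable
  then have conv: "AE x in ?M. convergent (\<lambda>k. X (r k) x)"
  proof eventually_elim
    case (elim x)
    define a where "a k = 4 ^ k * (norm (D k x))\<^sup>2" for k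
    define c where "c = enn2real (\<Sum>k. ennreal (a k))"
    have c: "(\<Sum>k. ennreal (a k)) = ennreal c" "c \<ge> 0"
      using elim unfolding a_def[symmetric] by (simp_all add: c_def less_top)
    have "norm (D k x) \<le> sqrt c * (1/2) ^ k" for k
    proof -
      have "f k \<le> suminf f" for f :: "nat \<Rightarrow> ennreal"
        using sum_le_suminf[of f "{k}"] by simp
      from this[of "\<lambda>k. ennreal (a k)"] have "a k \<le> c"
        unfolding c(1) using c(2) by (simp add: ennreal_le_iff)
      then have "4 ^ k * (norm (D k x))\<^sup>2 \<le> c" by (simp add: a_def)
      moreover have "(2 ^ k)\<^sup>2 = (4::real) ^ k" by (simp add: power2_eq_square flip: power_mult_distrib)
      ultimately have "(2 ^ k * norm (D k x))\<^sup>2 \<le> c" by (simp add: power_mult_distrib)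
      then have "2 ^ k * norm (D k x) \<le> sqrt c" by (rule real_le_rsqrt)
      then show ?thesis by (simp add: field_simps)
    qed
    moreover have "summable (\<lambda>k. sqrt c * (1/2) ^ k)" by (intro summable_mult summable_geometric) simp
    ultimately have "summable (\<lambda>k. norm (D k x))"
      using summable_comparison_test'[of "\<lambda>k. sqrt c * (1/2) ^ k" 0 "\<lambda>k. norm (D k x)"] by simp
    then have "summable (\<lambda>k. D k x)" by (rule summable_norm_cancel)
    then have "convergent (\<lambda>n. \<Sum>k<n. D k x)" by (simp add: summable_iff_convergent)
    moreover have "(\<Sum>k<n. D k x) = X (r n) x - X (r 0) x" for n
      unfolding D_def by (rule sum_lessThan_telescope)
    ultimately have "convergent (\<lambda>n. X (r n) x - X (r 0) x)" by simp
    then show ?case using convergent_add_const_right_iff[of "\<lambda>n. X (r n) x" "- X (r 0) x"] by simp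
  qed
  define f where "f x = lim (\<lambda>k. X (r k) x)" for x
  have f [measurable]: "f \<in> borel_measurable ?M" unfolding f_def by (rule borel_measurable_lim_metric) measurable
  have bound: "(\<integral>\<^sup>+x. ennreal ((norm (X m x - f x))\<^sup>2) \<partial>?M) \<le> ennreal (e\<^sup>2)"
    if e: "e > 0" and K: "\<forall>m\<ge>K. \<forall>n\<ge>K. L2_norm S (\<lambda>x. X m x - X n x) < e" and m: "m \<ge> K" for e K m
  proof -
    have "(\<integral>\<^sup>+x. ennreal ((norm (X m x - f x))\<^sup>2) \<partial>?M)
        = (\<integral>\<^sup>+x. liminf (\<lambda>k. ennreal ((norm (X m x - X (r k) x))\<^sup>2)) \<partial>?M)"
    proof (rule nn_integral_cong_AE, use conv in eventually_elim)
      case (elim x)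
      then have "(\<lambda>k. X (r k) x) \<longlonglongrightarrow> f x" by (simp add: f_def convergent_LIMSEQ_iff)
      then have "(\<lambda>k. ennreal ((norm (X m x - X (r k) x))\<^sup>2)) \<longlonglongrightarrow> ennreal ((norm (X m x - f x))\<^sup>2)"
        by (intro tendsto_intros)
      from lim_imp_Liminf[OF _ this] show ?case by simp
    qed
    also have "\<dots> \<le> liminf (\<lambda>k. \<integral>\<^sup>+x. ennreal ((norm (X m x - X (r k) x))\<^sup>2) \<partial>?M)"
      by (rule nn_integral_liminf) measurable
    also have "\<dots> = liminf (\<lambda>k. ennreal ((L2_norm S (\<lambda>x. X m x - X (r k) x))\<^sup>2))"
      by (simp add: L2_norm_sq_nn L2_on_diff X)
    also have "\<dots> \<le> limsup (\<lambda>k. ennreal ((L2_norm S (\<lambda>x. X m x - X (r k) x))\<^sup>2))"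
      by (rule Liminf_le_Limsup) simp
    also have "\<dots> \<le> ennreal (e\<^sup>2)"
    proof (rule Limsup_bounded)
      show "\<forall>\<^sub>F k in sequentially. ennreal ((L2_norm S (\<lambda>x. X m x - X (r k) x))\<^sup>2) \<le> ennreal (e\<^sup>2)"
        unfolding eventually_sequentially
      proof (intro exI[of _ K] allI impI)
        fix k assume "k \<ge> K"
        then have "r k \<ge> K" by (simp add: r_def)
        then have "L2_norm S (\<lambda>x. X m x - X (r k) x) \<le> e" using K m less_imp_le by blast
        then show "ennreal ((L2_norm S (\<lambda>x. X m x - X (r k) x))\<^sup>2) \<le> ennreal (e\<^sup>2)"
          by (intro ennreal_leI power_mono) auto
      qed
    qed
    finally show ?thesis .
  qed
  have L2d: "L2_on S (\<lambda>x. X m x - f x) \<and> L2_norm S (\<lambda>x. X m x - f x) \<le> e"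
    if e: "e > 0" and K: "\<forall>m\<ge>K. \<forall>n\<ge>K. L2_norm S (\<lambda>x. X m x - X n x) < e" and m: "m \<ge> K" for e K m
  proof
    have "(\<integral>\<^sup>+x. ennreal ((norm (X m x - f x))\<^sup>2) \<partial>?M) < \<infinity>"
      using bound[OF that] by (simp add: le_less_trans)
    then show L: "L2_on S (\<lambda>x. X m x - f x)"
      unfolding L2_on_def by (auto intro!: integrableI_bounded)
    show "L2_norm S (\<lambda>x. X m x - f x) \<le> e"
      using bound[OF that] L2_norm_sq_nn[OF L] e by (simp add: ennreal_le_iff power2_le_iff_abs_le)
  qed
  obtain K where "\<forall>m\<ge>K. \<forall>n\<ge>K. L2_norm S (\<lambda>x. X m x - X n x) < 1" using C[of 1] by auto
  then have "L2_on S (\<lambda>x. X K x - f x)" using L2d[of 1 K K] by auto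
  from L2_on_diff[OF X this] have "L2_on S (\<lambda>x. X K x - (X K x - f x))" .
  moreover have "(\<lambda>x. X K x - (X K x - f x)) = f" by (simp add: fun_eq_iff)
  ultimately have "L2_on S f" by metis
  moreover have "(\<lambda>n. L2_norm S (\<lambda>x. X n x - f x)) \<longlonglongrightarrow> 0"
  proof (rule LIMSEQ_I)
    fix e :: real assume "e > 0"
    then obtain K where "\<forall>m\<ge>K. \<forall>n\<ge>K. L2_norm S (\<lambda>x. X m x - X n x) < e / 2" using C[of "e/2"] by auto
    then have "L2_norm S (\<lambda>x. X m x - f x) \<le> e / 2" if "m \<ge> K" for m using L2d[of "e/2" K m] that \<open>e > 0\<close> by auto
    moreover have "e / 2 < e" using \<open>e > 0\<close> by simp
    ultimately have "\<forall>n\<ge>K. L2_norm S (\<lambda>x. X n x - f x) < e" using le_less_trans by blast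
    then show "\<exists>no. \<forall>n\<ge>no. norm (L2_norm S (\<lambda>x. X n x - f x) - 0) < e"
      by (intro exI[of _ K]) simp
  qed
  ultimately show thesis using that by blast
qed

lemma semi_hilbert_L2: "semi_hilbert {f. L2_on S f} (L2_ip S)"
proof -
  interpret semi_inner "{f. L2_on S (f :: _ \<Rightarrow> 'b)}" "L2_ip S" by (rule semi_inner_L2)
  have n: "nrm f = L2_norm S f" for f
    by (simp add: nrm_def L2_ip_def L2_norm_def dot_square_norm)
  show ?thesis
  proof unfold_locales
    fix X :: "nat \<Rightarrow> _ \<Rightarrow> 'b"
    assume "\<forall>n. X n \<in> {f. L2_on S f}" "\<forall>e>0. \<exists>N. \<forall>m\<ge>N. \<forall>n\<ge>N. nrm (X m - X n) < e"
    then have X: "L2_on S (X n)" and C: "e > 0 \<Longrightarrow> \<exists>N. \<forall>m\<ge>N. \<forall>n\<ge>N. L2_norm S (\<lambda>x. X m x - X n x) < e" for n e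
      by (simp_all add: n fun_diff_def)
    obtain L where "L2_on S L" "(\<lambda>n. L2_norm S (\<lambda>x. X n x - L x)) \<longlonglongrightarrow> 0"
      using L2_complete[OF X C] by blast
    then show "\<exists>L\<in>{f. L2_on S f}. (\<lambda>n. nrm (X n - L)) \<longlonglongrightarrow> 0"
      unfolding n fun_diff_def by blast
  qed
qed

interpretation L2: semi_hilbert "{f. L2_on S f}" "L2_ip S" for S
  by (rule semi_hilbert_L2)

lemma L2_nrm_eq: "L2.nrm S f = L2_norm S f"
  by (simp add: L2.nrm_def L2_ip_def L2_norm_def dot_square_norm)

lemma L2_norm_triangle: "\<lbrakk>L2_on S f; L2_on S g\<rbrakk> \<Longrightarrow> L2_norm S (\<lambda>x. f x + g x) \<le> L2_norm S f + L2_norm S g"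
  using L2.nrm_triangle[of f S g] by (simp add: L2_nrm_eq plus_fun_def)

lemma L2_norm_scaleR: "L2_on S f \<Longrightarrow> L2_norm S (\<lambda>x. a *\<^sub>R f x) = \<bar>a\<bar> * L2_norm S f"
  using L2.nrm_scaleR[of f S a] by (simp add: L2_nrm_eq scaleR_fun_def)

lemma L2_norm_minus [simp]: "L2_norm S (\<lambda>x. - f x) = L2_norm S f"
  by (simp add: L2_norm_def)

lemma L2_norm_diff_abs:
  "\<lbrakk>L2_on S f; L2_on S g\<rbrakk> \<Longrightarrow> \<bar>L2_norm S f - L2_norm S g\<bar> \<le> L2_norm S (\<lambda>x. f x - g x)"
  using L2.nrm_diff_abs[of f S g] by (simp add: L2_nrm_eq fun_diff_def)

lemma L2_Cauchy_Schwarz: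
  "\<lbrakk>L2_on S f; L2_on S g\<rbrakk> \<Longrightarrow> \<bar>\<integral>x. f x \<bullet> g x \<partial>(lebesgue_on S)\<bar> \<le> L2_norm S f * L2_norm S g"
  using L2.Cauchy_Schwarz[of f S g] by (simp add: L2_nrm_eq L2_ip_def)

lemma L2_integral_tendsto:
  assumes "\<And>n. L2_on S (f n)" "L2_on S g" "L2_on S h" "(\<lambda>n. L2_norm S (\<lambda>x. f n x - g x)) \<longlonglongrightarrow> 0"
  shows "(\<lambda>n. \<integral>x. f n x \<bullet> h x \<partial>(lebesgue_on S)) \<longlonglongrightarrow> (\<integral>x. g x \<bullet> h x \<partial>(lebesgue_on S))"
  using L2.tendsto_ip_left[of f S g h] assms by (simp add: L2_nrm_eq L2_ip_def fun_diff_def)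

lemma L2_norm_Pair_sq:
  assumes "L2_on S f" "L2_on S g"
  shows "(L2_norm S (\<lambda>x. (f x, g x)))\<^sup>2 = (L2_norm S f)\<^sup>2 + (L2_norm S g)\<^sup>2"
  unfolding L2_norm_sq using assms by (simp add: norm_Pair L2_on_integrable)

section \<open>Smooth functions\<close>

lemma sum_axis_scaleR: "(\<Sum>i\<in>UNIV. (h $ i) *\<^sub>R axis i (1::real)) = (h :: real ^ 'n)"
  using basis_expansion[of h] by (simp add: scalar_mult_eq_scaleR)

lemma has_derivative_partial:
  assumes "f differentiable (at z)"
  shows "(f has_derivative (\<lambda>h. \<Sum>i\<in>UNIV. h $ i * partial i f z)) (at z)"
proof -
  let ?D = "frechet_derivative f (at z)"
  have D: "(f has_derivative ?D) (at z)" using assms by (simp add: frechet_derivative_works)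
  then interpret bounded_linear ?D by (rule has_derivative_bounded_linear)
  have "?D h = (\<Sum>i\<in>UNIV. h $ i * partial i f z)" for h
    by (subst sum_axis_scaleR[symmetric, of h]) (simp only: sum scaleR partial_def real_scaleR_def)
  then show ?thesis using D by (metis (no_types, lifting) ext)
qed

lemma partial_eqI:
  assumes "(f has_derivative (\<lambda>h. \<Sum>i\<in>UNIV. h $ i * g i)) (at z)"
  shows "partial i f z = g i"
proof -
  have "frechet_derivative f (at z) = (\<lambda>h. \<Sum>i\<in>UNIV. h $ i * g i)"
    using frechet_derivative_at[OF assms] by simp
  then show ?thesis by (simp add: partial_def axis_def if_distrib[of "\<lambda>x. x * _"] cong: if_cong)
qed

lemma partial_add:
  assumes "f differentiable (at z)" "g differentiable (at z)"
  shows "partial i (\<lambda>z. f z + g z) z = partial i f z + partial i g z"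
  by (rule partial_eqI, rule has_derivative_eq_rhs,
      rule has_derivative_add[OF assms[THEN has_derivative_partial]])
     (simp add: algebra_simps sum.distrib)

lemma partial_mult:
  assumes "f differentiable (at z)" "g differentiable (at z)"
  shows "partial i (\<lambda>z. f z * g z) z = f z * partial i g z + partial i f z * g z"
  by (rule partial_eqI, rule has_derivative_eq_rhs,
      rule has_derivative_mult[OF assms[THEN has_derivative_partial]])
     (simp add: algebra_simps sum.distrib sum_distrib_left)

lemma partial_const [simp]: "partial i (\<lambda>z. c) z = 0"
  by (rule partial_eqI) simp

lemma partial_cmult:
  assumes "f differentiable (at z)"
  shows "partial i (\<lambda>z. c * f z) z = c * partial i f z"
  using partial_mult[of "\<lambda>_. c" z f i] assms by simp

lemma Ck_add: "\<lbrakk>Ck k f; Ck k g\<rbrakk> \<Longrightarrow> Ck k (\<lambda>z. f z + g z)"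
proof (induction k arbitrary: f g)
  case (Suc k)
  then have "partial i (\<lambda>z. f z + g z) = (\<lambda>z. partial i f z + partial i g z)" for i
    by (auto simp: partial_add)
  then show ?case using Suc by auto
qed (auto intro: continuous_on_add)

lemma Ck_cmult: "Ck k f \<Longrightarrow> Ck k (\<lambda>z. c * f z)"
proof (induction k arbitrary: f)
  case (Suc k)
  then have "partial i (\<lambda>z. c * f z) = (\<lambda>z. c * partial i f z)" for i
    by (auto simp: partial_cmult)
  then show ?case using Suc by auto
qed (auto intro: continuous_on_mult)

lemma smooth_periodic_add: "\<lbrakk>smooth_periodic f; smooth_periodic g\<rbrakk> \<Longrightarrow> smooth_periodic (\<lambda>z. f z + g z)"
  and smooth_periodic_cmult: "smooth_periodic f \<Longrightarrow> smooth_periodic (\<lambda>z. c * f z)"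
  by (auto simp: smooth_periodic_def periodic_z2_def Ck_add Ck_cmult)

lemma smooth_periodic_diff: "\<lbrakk>smooth_periodic f; smooth_periodic g\<rbrakk> \<Longrightarrow> smooth_periodic (\<lambda>z. f z - g z)"
  using smooth_periodic_add[of f "\<lambda>z. -1 * g z"] smooth_periodic_cmult[of g "-1"] by simp

text \<open>Integration by parts is applied to products, and this class is closed under products by
  a single use of the product rule.\<close>

definition C1 :: "(real ^ 3 \<Rightarrow> real) \<Rightarrow> bool" where
  "C1 f \<longleftrightarrow> (\<forall>z. f differentiable (at z)) \<and> (\<forall>i. continuous_on UNIV (partial i f))"

lemma C1_continuous: "C1 f \<Longrightarrow> continuous_on UNIV f"
  by (auto simp: C1_def intro!: continuous_at_imp_continuous_on differentiable_imp_continuous_within)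

lemma C1_mult: "\<lbrakk>C1 f; C1 g\<rbrakk> \<Longrightarrow> C1 (\<lambda>z. f z * g z)"
proof -
  assume fg: "C1 f" "C1 g"
  then have "partial i (\<lambda>z. f z * g z) = (\<lambda>z. f z * partial i g z + partial i f z * g z)" for i
    by (auto simp: C1_def partial_mult)
  then show ?thesis using fg C1_continuous[of f] C1_continuous[of g]
    by (auto simp: C1_def intro!: continuous_intros)
qed

lemma smooth_periodic_C1: "smooth_periodic f \<Longrightarrow> C1 f"
proof -
  assume "smooth_periodic f"
  then have "Ck (Suc 0) f" unfolding smooth_periodic_def by blast
  then show ?thesis by (simp add: C1_def)
qed

text \<open>\<open>flat 0\<close> is the classical smooth function that is flat at \<open>0\<close>.
  The quotients by \<open>x ^ m\<close> are there because differentiation produces them: the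
  derivative of \<open>flat m\<close> is a combination of \<open>flat (m + 2)\<close> and
  \<open>flat (m + 1)\<close>.\<close>

definition flat :: "nat \<Rightarrow> real \<Rightarrow> real" where
  "flat m x = (if x > 0 then exp (- 1 / x) / x ^ m else 0)"

lemma flat_nonneg: "0 \<le> flat m x"
  by (simp add: flat_def)

lemma power_le_exp:
  fixes y :: real assumes "y \<ge> 0" shows "y ^ n \<le> fact n * exp y"
proof -
  have "y ^ n /\<^sub>R fact n \<le> (\<Sum>n. y ^ n /\<^sub>R fact n)"
    using sum_le_suminf[OF summable_exp_generic[of y], of "{n}"] assms by simp
  then show ?thesis by (simp add: exp_def field_simps)
qed

text \<open>A single term of the exponential series at \<open>1 / x\<close> dominates the negative
  power. The case \<open>n = 2\<close> yields the derivative at \<open>0\<close>, the case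
  \<open>n = 0\<close> yields boundedness.\<close>

lemma flat_bound: "flat m x \<le> fact (m + n) * \<bar>x\<bar> ^ n"
proof (cases "x > 0")
  case True
  have "(1 / x) ^ (m + n) \<le> fact (m + n) * exp (1 / x)" using True by (intro power_le_exp) simp
  then have "exp (- 1 / x) \<le> fact (m + n) * x ^ (m + n)"
    using True by (simp add: field_simps exp_minus power_one_over)
  then show ?thesis using True by (simp add: flat_def field_simps power_add)
qed (simp add: flat_def)

lemma flat_has_derivative:
  "(flat m has_real_derivative (flat (m + 2) x - real m * flat (m + 1) x)) (at x)"
proof -
  consider "x > 0" | "x < 0" | "x = 0" by linarith
  then show ?thesis
  proof cases
    case 1
    have "((\<lambda>x. exp (- 1 / x) / x ^ m) has_real_derivative
        ((exp (- 1 / x) * (1 / x\<^sup>2)) * x ^ m - exp (- 1 / x) * (real m * x ^ (m - 1))) / (x ^ m * x ^ m)) (at x)"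
      using 1 by (auto intro!: derivative_eq_intros simp: power2_eq_square)
    moreover have "((exp (- 1 / x) * (1 / x\<^sup>2)) * x ^ m - exp (- 1 / x) * (real m * x ^ (m - 1))) / (x ^ m * x ^ m)
       = flat (m + 2) x - real m * flat (m + 1) x"
      using 1 by (cases m) (auto simp: flat_def field_simps power2_eq_square)
    ultimately have "((\<lambda>x. exp (- 1 / x) / x ^ m) has_real_derivative flat (m + 2) x - real m * flat (m + 1) x) (at x)"
      by simp
    then show ?thesis
      by (rule has_field_derivative_transform_within_open[where S="{0<..}"]) (use 1 in \<open>auto simp: flat_def\<close>)
  next
    case 2
    have "((\<lambda>x. 0) has_real_derivative 0) (at x)" by simp
    then have "(flat m has_real_derivative 0) (at x)"
      by (rule has_field_derivative_transform_within_open[where S="{..<0}"]) (use 2 in \<open>auto simp: flat_def\<close>)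
    then show ?thesis using 2 by (simp add: flat_def)
  next
    case 3
    have "((\<lambda>h. flat m h / h) \<longlongrightarrow> 0) (at 0)"
    proof (rule Lim_null_comparison)
      show "((\<lambda>h. fact (m + 2) * \<bar>h\<bar>) \<longlongrightarrow> 0) (at (0::real))" by (auto intro!: tendsto_eq_intros)
      have "norm (flat m h / h) \<le> fact (m + 2) * \<bar>h\<bar>" if "h \<noteq> 0" for h
      proof -
        have "\<bar>flat m h\<bar> \<le> (fact (m + 2) * \<bar>h\<bar>) * \<bar>h\<bar>"
          using flat_bound[of m h 2] flat_nonneg[of m h] by (simp only: power2_eq_square abs_of_nonneg mult.assoc)
        then show ?thesis using that by (simp only: real_norm_def abs_divide) (simp add: divide_le_eq)
      qed
      then show "\<forall>\<^sub>F h in at 0. norm (flat m h / h) \<le> fact (m + 2) * \<bar>h\<bar>"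
        by (auto simp: eventually_at intro!: exI[of _ 1])
    qed
    then show ?thesis using 3 by (simp add: has_field_derivative_iff flat_def)
  qed
qed

text \<open>A class of functions that is closed under partial derivatives and contains the eigenfunctions and the cutoffs.\<close>

inductive elem :: "(real ^ 3 \<Rightarrow> real) \<Rightarrow> bool" where
  elem_const: "elem (\<lambda>z. c)"
| elem_coord: "elem (\<lambda>z. z $ i)"
| elem_add: "\<lbrakk>elem f; elem g\<rbrakk> \<Longrightarrow> elem (\<lambda>z. f z + g z)"
| elem_mult: "\<lbrakk>elem f; elem g\<rbrakk> \<Longrightarrow> elem (\<lambda>z. f z * g z)"
| elem_cos: "elem f \<Longrightarrow> elem (\<lambda>z. cos (f z))"
| elem_flat: "elem f \<Longrightarrow> elem (\<lambda>z. flat m (f z))"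

lemma elem_diff: "\<lbrakk>elem f; elem g\<rbrakk> \<Longrightarrow> elem (\<lambda>z. f z - g z)"
  using elem_add[OF _ elem_mult[OF elem_const[of "-1"]], of f g] by simp

lemma elem_minus: "elem f \<Longrightarrow> elem (\<lambda>z. - f z)"
  using elem_mult[OF elem_const[of "-1"], of f] by simp

lemma elem_sin: "elem f \<Longrightarrow> elem (\<lambda>z. sin (f z))"
  using elem_cos[OF elem_diff[OF _ elem_const[of "pi/2"]], of f] by (simp add: cos_diff)

lemmas elem_intros = elem_const elem_coord elem_add elem_mult elem_cos elem_flat elem_diff elem_minus elem_sin

text \<open>Differentiability and membership of the partial derivatives in the class are carried by
  one induction; iterating the result gives derivatives of all orders.\<close>

lemma elem_derivative:
  assumes "elem f"
  shows "\<exists>g. (\<forall>z. (f has_derivative (\<lambda>h. \<Sum>i\<in>UNIV. h $ i * g i z)) (at z)) \<and> (\<forall>i. elem (g i))"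
  using assms
proof induction
  case (elem_const c)
  show ?case by (intro exI[of _ "\<lambda>i z. 0"]) (auto intro!: elem_intros)
next
  case (elem_coord j)
  have "((\<lambda>z. z $ j) has_derivative (\<lambda>h. h $ j)) (at z)" for z :: "real ^ 3"
    by (intro bounded_linear_imp_has_derivative bounded_linear_vec_nth)
  then show ?case
    by (intro exI[of _ "\<lambda>i z. if i = j then 1 else 0"])
       (auto intro!: elem_intros simp: if_distrib[of "\<lambda>x. _ * x"] cong: if_cong)
next
  case (elem_add f g)
  then obtain f' g' where
    *: "\<And>z. (f has_derivative (\<lambda>h. \<Sum>i\<in>UNIV. h $ i * f' i z)) (at z)" "\<And>i. elem (f' i)"
       "\<And>z. (g has_derivative (\<lambda>h. \<Sum>i\<in>UNIV. h $ i * g' i z)) (at z)" "\<And>i. elem (g' i)" by blast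
  show ?case
  proof (intro exI[of _ "\<lambda>i z. f' i z + g' i z"] conjI allI)
    fix z show "((\<lambda>z. f z + g z) has_derivative (\<lambda>h. \<Sum>i\<in>UNIV. h $ i * (f' i z + g' i z))) (at z)"
      by (rule has_derivative_eq_rhs[OF has_derivative_add[OF *(1,3)]])
         (simp add: algebra_simps sum.distrib)
  qed (use * in \<open>auto intro!: elem_intros\<close>)
next
  case mult: (elem_mult f g)
  then obtain f' g' where
    *: "\<And>z. (f has_derivative (\<lambda>h. \<Sum>i\<in>UNIV. h $ i * f' i z)) (at z)" "\<And>i. elem (f' i)"
       "\<And>z. (g has_derivative (\<lambda>h. \<Sum>i\<in>UNIV. h $ i * g' i z)) (at z)" "\<And>i. elem (g' i)" by blast
  show ?case
  proof (intro exI[of _ "\<lambda>i z. f z * g' i z + f' i z * g z"] conjI allI)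
    fix z show "((\<lambda>z. f z * g z) has_derivative (\<lambda>h. \<Sum>i\<in>UNIV. h $ i * (f z * g' i z + f' i z * g z))) (at z)"
      by (rule has_derivative_eq_rhs[OF has_derivative_mult[OF *(1,3)]])
         (simp add: algebra_simps sum.distrib sum_distrib_left)
  qed (use * mult in \<open>auto intro!: elem_intros\<close>)
next
  case cos: (elem_cos f)
  then obtain f' where
    *: "\<And>z. (f has_derivative (\<lambda>h. \<Sum>i\<in>UNIV. h $ i * f' i z)) (at z)" "\<And>i. elem (f' i)" by blast
  show ?case
  proof (intro exI[of _ "\<lambda>i z. - sin (f z) * f' i z"] conjI allI)
    fix z show "((\<lambda>z. cos (f z)) has_derivative (\<lambda>h. \<Sum>i\<in>UNIV. h $ i * (- sin (f z) * f' i z))) (at z)"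
      by (rule has_derivative_eq_rhs[OF has_derivative_cos[OF *(1)]])
         (simp add: algebra_simps sum_distrib_left sum_negf)
  qed (use * cos in \<open>auto intro!: elem_intros\<close>)
next
  case flat: (elem_flat f m)
  then obtain f' where
    *: "\<And>z. (f has_derivative (\<lambda>h. \<Sum>i\<in>UNIV. h $ i * f' i z)) (at z)" "\<And>i. elem (f' i)" by blast
  show ?case
  proof (intro exI[of _ "\<lambda>i z. (flat (m + 2) (f z) - real m * flat (m + 1) (f z)) * f' i z"] conjI allI)
    fix z
    show "((\<lambda>z. flat m (f z)) has_derivative
        (\<lambda>h. \<Sum>i\<in>UNIV. h $ i * ((flat (m + 2) (f z) - real m * flat (m + 1) (f z)) * f' i z))) (at z)"
      by (rule has_derivative_eq_rhs[OF has_derivative_compose[OF *(1)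
            flat_has_derivative[unfolded has_field_derivative_def]]])
         (simp add: sum_distrib_left sum_distrib_right mult_ac)
  qed (use * flat in \<open>auto intro!: elem_intros\<close>)
qed

lemma elem_differentiable: "elem f \<Longrightarrow> f differentiable (at z)"
  using elem_derivative[of f] by (auto simp: differentiable_def)

lemma elem_partial: "elem f \<Longrightarrow> elem (partial i f)"
proof -
  assume "elem f"
  then obtain g where "\<forall>z. (f has_derivative (\<lambda>h. \<Sum>i\<in>UNIV. h $ i * g i z)) (at z)" and g: "elem (g i)"
    using elem_derivative by blast
  then have "partial i f = g i" using partial_eqI[of f "\<lambda>i. g i _"] by (auto intro!: ext)
  then show ?thesis using g by simp
qed

lemma elem_Ck: "elem f \<Longrightarrow> Ck k f"
  by (induction k arbitrary: f)
     (auto simp: elem_differentiable elem_partial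
       intro!: continuous_at_imp_continuous_on differentiable_imp_continuous_within)

lemma elem_smooth_periodic: "\<lbrakk>elem f; periodic_z2 f\<rbrakk> \<Longrightarrow> smooth_periodic f"
  by (simp add: smooth_periodic_def elem_Ck)

lemma elem_continuous: "elem f \<Longrightarrow> continuous_on UNIV f"
  using elem_Ck[of f 0] by simp

section \<open>Integration by parts on boxes\<close>

text \<open>Fubini, the fundamental theorem of calculus and changes of variables are applied on
  \<open>lborel\<close>, while the problem is stated with Lebesgue measure; completion does not
  change the integral of a Borel function.\<close>

lemma lebesgue_on_integral_lborel:
  fixes g :: "'a::euclidean_space \<Rightarrow> 'b::euclidean_space"
  assumes "S \<in> sets borel" "g \<in> borel_measurable borel"
  shows "(\<integral>z. g z \<partial>(lebesgue_on S)) = (\<integral>z. indicator S z *\<^sub>R g z \<partial>lborel)"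
proof -
  have "(\<integral>z. g z \<partial>(lebesgue_on S)) = (\<integral>z. indicator S z *\<^sub>R g z \<partial>lebesgue)"
    by (rule integral_restrict_space) (use assms(1) in auto)
  also have "\<dots> = (\<integral>z. indicator S z *\<^sub>R g z \<partial>lborel)"
    by (rule integral_completion) (use assms in measurable)
  finally show ?thesis .
qed

lemma integrable_indicator_continuous:
  fixes g :: "'a::euclidean_space \<Rightarrow> 'b::euclidean_space"
  assumes "S \<in> sets borel" "bounded S" "continuous_on UNIV g"
  shows "integrable lborel (\<lambda>z. indicator S z *\<^sub>R g z)"
proof -
  obtain a where a: "S \<subseteq> cbox (-a) a" using bounded_subset_cbox_symmetric[OF assms(2)] by blast
  have "integrable lborel (\<lambda>z. indicator (cbox (-a) a) z *\<^sub>R g z)"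
    using borel_integrable_compact[of "cbox (-a) a" g] assms(3) by (auto intro: continuous_on_subset)
  then show ?thesis
  proof (rule Bochner_Integration.integrable_bound)
    have [measurable]: "g \<in> borel_measurable borel" "S \<in> sets borel"
      using assms by (auto intro: borel_measurable_continuous_onI)
    show "(\<lambda>z. indicator S z *\<^sub>R g z) \<in> borel_measurable lborel" by measurable
    show "AE z in lborel. norm (indicat_real S z *\<^sub>R g z) \<le> norm (indicat_real (cbox (-a) a) z *\<^sub>R g z)"
      using a by (auto simp: indicator_def)
  qed
qed

lemma integrable_on_continuous:
  fixes g :: "'a::euclidean_space \<Rightarrow> 'b::euclidean_space"
  assumes "S \<in> sets borel" "bounded S" "continuous_on UNIV g"
  shows "integrable (lebesgue_on S) g"
proof -
  have "integrable lebesgue (\<lambda>z. indicator S z *\<^sub>R g z)"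
    using integrable_indicator_continuous[OF assms] assms(1) by (simp add: integrable_completion)
  then show ?thesis using assms(1) by (subst integrable_restrict_space) auto
qed

text \<open>\<open>T\<close> takes the coordinate of differentiation first and the two face
  coordinates after it. One proof then serves all three directions, and the two opposite faces are
  reached by fixing the first argument.\<close>

context
  fixes T :: "real \<times> (real \<times> real) \<Rightarrow> real ^ 3" and i j k :: 3
  assumes Ti: "\<And>p. T p $ i = fst p" and Tj: "\<And>p. T p $ j = fst (snd p)"
    and Tk: "\<And>p. T p $ k = snd (snd p)"
    and ijk: "i \<noteq> j" "i \<noteq> k" "j \<noteq> k"
begin

lemma all_ijk: "(\<forall>m. P m) \<longleftrightarrow> P i \<and> P j \<and> P (k::3)"
  and prod_ijk: "(\<Prod>m\<in>UNIV. h m) = h i * h j * (h k :: real)"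
proof -
  have "card {i, j, k} = CARD(3)" using ijk by simp
  then have *: "UNIV = {i, j, k}" by (metis card_subset_eq finite subset_UNIV)
  show "(\<forall>m. P m) \<longleftrightarrow> P i \<and> P j \<and> P k" using * by (metis UNIV_I empty_iff insert_iff)
  show "(\<Prod>m\<in>UNIV. h m) = h i * h j * h k" unfolding * using ijk by simp
qed

lemma coords_eq: "T p = fst p *\<^sub>R axis i 1 + fst (snd p) *\<^sub>R axis j 1 + snd (snd p) *\<^sub>R axis k 1"
  unfolding vec_eq_iff all_ijk using ijk by (simp add: Ti Tj Tk axis_def)

lemma coords_continuous: "continuous_on S T"
  unfolding coords_eq[abs_def] by (intro continuous_intros)

lemma coords_vimage_box: "T -` box a b = {a$i<..<b$i} \<times> ({a$j<..<b$j} \<times> {a$k<..<b$k})"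
  unfolding box_def by (auto simp: mem_box_cart Basis_vec_def inner_axis all_ijk Ti Tj Tk)

text \<open>Lebesgue measure is determined by its values on boxes, and the preimage of a box under
  this relabelling of coordinates is a product of intervals with the same side lengths.\<close>

lemma coords_distr: "distr lborel borel T = lborel"
proof (rule lborel_eqI[symmetric])
  have T: "T \<in> borel_measurable lborel" using coords_continuous by (simp add: borel_measurable_continuous_onI)
  fix l u :: "real ^ 3" assume le: "\<And>b. b \<in> Basis \<Longrightarrow> l \<bullet> b \<le> u \<bullet> b"
  have le': "l $ m \<le> u $ m" for m using le[of "axis m 1"] by (simp add: inner_axis)
  have "emeasure (distr lborel borel T) (box l u) = emeasure lborel (T -` box l u)"
    using T by (subst emeasure_distr) auto
  also have "\<dots> = emeasure (lborel \<Otimes>\<^sub>M (lborel \<Otimes>\<^sub>M lborel)) ({l$i<..<u$i} \<times> ({l$j<..<u$j} \<times> {l$k<..<u$k}))"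
    by (simp add: coords_vimage_box lborel_prod)
  also have "\<dots> = ennreal (u$i - l$i) * (ennreal (u$j - l$j) * ennreal (u$k - l$k))"
    by (subst lborel_prod, subst lborel.emeasure_pair_measure_Times, simp, simp add: pair_measureI flip: lborel_prod,
       subst lborel_prod[symmetric], subst lborel.emeasure_pair_measure_Times) (auto simp: le')
  also have "\<dots> = ennreal ((u$i - l$i) * (u$j - l$j) * (u$k - l$k))"
    using le' by (simp add: ennreal_mult mult.assoc)
  also have "(u$i - l$i) * (u$j - l$j) * (u$k - l$k) = (\<Prod>m\<in>UNIV. u $ m - l $ m)"
    by (simp add: prod_ijk)
  also have "\<dots> = (\<Prod>b\<in>Basis. (u - l) \<bullet> b)"
    by (rule prod.reindex_bij_witness[of _ "\<lambda>b. THE m. b = axis m 1" "\<lambda>m. axis m 1"])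
       (auto simp: Basis_vec_def axis_eq_axis inner_axis)
  finally show "emeasure (distr lborel borel T) (box l u) = ennreal (\<Prod>b\<in>Basis. (u - l) \<bullet> b)" .
qed simp

lemma integral_partial_box:
  assumes f: "C1 f" and ab: "a $ i \<le> b $ i"
  shows "(\<integral>z. partial i f z \<partial>(lebesgue_on (box a b))) =
    (\<integral>y. f (T (b $ i, y)) - f (T (a $ i, y)) \<partial>(lebesgue_on ({a$j<..<b$j} \<times> {a$k<..<b$k})))"
proof -
  let ?Q = "{a$j<..<b$j} \<times> {a$k<..<b$k}"
  have Qo: "open ?Q" by (intro open_Times open_greaterThanLessThan)
  have Q: "?Q \<in> sets borel" using Qo by simp
  have T: "T \<in> measurable lborel borel" using coords_continuous by (simp add: borel_measurable_continuous_onI)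
  have cp: "continuous_on UNIV (partial i f)" using f by (simp add: C1_def)
  then have [measurable]: "partial i f \<in> borel_measurable borel" by (rule borel_measurable_continuous_onI)
  let ?g = "\<lambda>z. indicator (box a b) z *\<^sub>R partial i f z"
  have int: "integrable lborel ?g"
    by (rule integrable_indicator_continuous) (auto simp: cp)
  have "(\<integral>z. partial i f z \<partial>(lebesgue_on (box a b))) = (\<integral>z. ?g z \<partial>lborel)"
    by (rule lebesgue_on_integral_lborel) auto
  also have "\<dots> = (\<integral>z. ?g z \<partial>(distr lborel borel T))" by (simp only: coords_distr)
  also have "\<dots> = (\<integral>p. ?g (T p) \<partial>lborel)" by (rule integral_distr[OF T]) measurable
  also have "\<dots> = (\<integral>p. ?g (T p) \<partial>(lborel \<Otimes>\<^sub>M lborel))" by (simp only: lborel_prod)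
  also have "\<dots> = (\<integral>y. (\<integral>x. ?g (T (x, y)) \<partial>lborel) \<partial>lborel)"
  proof -
    have "integrable (distr lborel borel T) ?g" using int by (simp only: coords_distr)
    then have "integrable lborel (\<lambda>p. ?g (T p))" by (subst (asm) integrable_distr_eq[OF T]) auto
    then have "integrable (lborel \<Otimes>\<^sub>M lborel) (\<lambda>(x, y). ?g (T (x, y)))"
      by (simp add: lborel_prod case_prod_beta')
    from lborel_pair.integral_snd[OF this] show ?thesis by (simp add: case_prod_beta')
  qed
  also have "\<dots> = (\<integral>y. indicator ?Q y *\<^sub>R (f (T (b $ i, y)) - f (T (a $ i, y))) \<partial>lborel)"
  proof (rule Bochner_Integration.integral_cong[OF refl])
    fix y
    have der: "((\<lambda>x. f (T (x, y))) has_real_derivative partial i f (T (x, y))) (at x)" for x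
    proof -
      have *: "((\<lambda>x. T (x, y)) has_derivative (\<lambda>h. h *\<^sub>R axis i 1)) (at x)"
        unfolding coords_eq[abs_def] by (auto intro!: derivative_eq_intros)
      have "(\<lambda>h. \<Sum>m\<in>UNIV. (h *\<^sub>R axis i 1) $ m * partial m f (T (x, y))) = (\<lambda>h. partial i f (T (x, y)) * h)"
        by (auto simp: axis_def if_distrib[of "\<lambda>x. x * _"] if_distrib[of "\<lambda>x. _ * x"] cong: if_cong)
      then show ?thesis unfolding has_field_derivative_def
        using has_derivative_compose[OF * has_derivative_partial[of f "T (x, y)"]] f by (simp add: C1_def)
    qed
    have cT: "continuous_on UNIV (\<lambda>x. T (x, y))"
      unfolding coords_eq[abs_def] by (intro continuous_intros)
    have ci: "isCont (\<lambda>x. partial i f (T (x, y))) x" for x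
      using continuous_on_compose2[OF cp cT] by (simp add: continuous_on_eq_continuous_at)
    have [measurable]: "(\<lambda>x. partial i f (T (x, y))) \<in> borel_measurable borel"
      using continuous_on_compose2[OF cp cT] by (simp add: borel_measurable_continuous_onI)
    \<comment> \<open>The open interval of the box may be replaced by the closed one of the
      fundamental theorem, as the two end points form a null set.\<close>
    have "(\<integral>x. ?g (T (x, y)) \<partial>lborel) = (\<integral>x. indicator ?Q y * (partial i f (T (x, y)) * indicator {a$i..b$i} x) \<partial>lborel)"
    proof (rule integral_cong_AE)
      show "AE x in lborel. ?g (T (x, y)) = indicator ?Q y * (partial i f (T (x, y)) * indicator {a$i..b$i} x)"
        using AE_lborel_singleton[of "a $ i"] AE_lborel_singleton[of "b $ i"]
      proof eventually_elim
        case (elim x)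
        have "T (x, y) \<in> box a b \<longleftrightarrow> (x, y) \<in> {a$i<..<b$i} \<times> ?Q"
          unfolding coords_vimage_box[symmetric] by simp
        then show ?case using elim by (auto simp: indicator_def)
      qed
      have "(\<lambda>x. T (x, y)) \<in> borel_measurable borel" using cT by (simp add: borel_measurable_continuous_onI)
      then show "(\<lambda>x. ?g (T (x, y))) \<in> borel_measurable lborel" by measurable
    qed measurable
    also have "\<dots> = indicator ?Q y *\<^sub>R (f (T (b $ i, y)) - f (T (a $ i, y)))"
      using integral_FTC_Icc_real[OF ab der ci] by simp
    finally show "(\<integral>x. ?g (T (x, y)) \<partial>lborel) = indicator ?Q y *\<^sub>R (f (T (b $ i, y)) - f (T (a $ i, y)))" .
  qed
  also have "\<dots> = (\<integral>y. f (T (b $ i, y)) - f (T (a $ i, y)) \<partial>(lebesgue_on ?Q))"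
  proof (rule lebesgue_on_integral_lborel[symmetric, OF Q])
    have "continuous_on UNIV (\<lambda>y. f (T (b $ i, y)) - f (T (a $ i, y)))"
      by (intro continuous_on_diff continuous_on_compose2[OF C1_continuous[OF f]])
         (auto simp: coords_eq[abs_def] intro!: continuous_intros)
    then show "(\<lambda>y. f (T (b $ i, y)) - f (T (a $ i, y))) \<in> borel_measurable borel"
      by (rule borel_measurable_continuous_onI)
  qed
  finally show ?thesis .
qed

end

section \<open>The divergence theorem on the periodic cell\<close>

lemma Omega_box: "Omega r0 r1 = box (vector [r0, 0, -1]) (vector [r1, 2 * pi, 1])"
  by (auto simp: Omega_def mem_box_cart forall_3)

lemma Omega_sets [simp, measurable]: "Omega r0 r1 \<in> sets borel" "Omega r0 r1 \<in> sets lebesgue"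
  and Omega_bounded: "bounded (Omega r0 r1)" and Omega_open: "open (Omega r0 r1)"
  by (simp_all add: Omega_box open_box)

lemma cell_end_sets [simp, measurable]: "cell_end \<in> sets borel" "cell_end \<in> sets lebesgue"
  and cell_end_bounded: "bounded cell_end"
  and cell_wall_sets [simp, measurable]: "cell_wall r0 r1 \<in> sets borel" "cell_wall r0 r1 \<in> sets lebesgue"
  and cell_wall_bounded: "bounded (cell_wall r0 r1)"
proof -
  have "open cell_end" "open (cell_wall r0 r1)" unfolding cell_end_def cell_wall_def
    by (intro open_Times open_greaterThanLessThan)+
  then show "cell_end \<in> sets borel" "cell_end \<in> sets lebesgue" "cell_wall r0 r1 \<in> sets borel"
    "cell_wall r0 r1 \<in> sets lebesgue" by auto
qed (auto simp: cell_end_def cell_wall_def intro!: bounded_Times)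

lemma end_pt_continuous: "continuous_on S (end_pt r)" and wall_pt_continuous: "continuous_on S (wall_pt s)"
proof -
  have "end_pt r = (\<lambda>y. r *\<^sub>R axis 1 1 + fst y *\<^sub>R axis 2 1 + snd y *\<^sub>R axis 3 1)"
    "wall_pt s = (\<lambda>y. fst y *\<^sub>R axis 1 1 + snd y *\<^sub>R axis 2 1 + s *\<^sub>R axis 3 1)"
    by (auto simp: end_pt_def wall_pt_def vec_eq_iff forall_3 axis_def)
  then show "continuous_on S (end_pt r)" "continuous_on S (wall_pt s)" by (auto intro!: continuous_intros)
qed

lemma integral_partial_1:
  assumes "C1 f" "r0 \<le> r1"
  shows "(\<integral>z. partial 1 f z \<partial>(lebesgue_on (Omega r0 r1))) =
    (\<integral>y. f (end_pt r1 y) - f (end_pt r0 y) \<partial>(lebesgue_on cell_end))"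
proof -
  let ?T = "\<lambda>p::real \<times> real \<times> real. vector [fst p, fst (snd p), snd (snd p)] :: real ^ 3"
  have T: "?T (r, y) = end_pt r y" for r y by (simp add: end_pt_def split_beta)
  show ?thesis
    using integral_partial_box[of ?T 1 2 3 f "vector [r0, 0, -1]" "vector [r1, 2 * pi, 1]"] assms
    unfolding T by (simp add: Omega_box cell_end_def)
qed

lemma integral_partial_3:
  assumes "C1 f"
  shows "(\<integral>z. partial 3 f z \<partial>(lebesgue_on (Omega r0 r1))) =
    (\<integral>y. f (wall_pt 1 y) - f (wall_pt (-1) y) \<partial>(lebesgue_on (cell_wall r0 r1)))"
proof -
  let ?T = "\<lambda>p::real \<times> real \<times> real. vector [fst (snd p), snd (snd p), fst p] :: real ^ 3"
  have T: "?T (r, y) = wall_pt r y" for r y by (simp add: wall_pt_def split_beta)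
  show ?thesis
    using integral_partial_box[of ?T 3 1 2 f "vector [r0, 0, -1]" "vector [r1, 2 * pi, 1]"] assms
    unfolding T by (simp add: Omega_box cell_wall_def)
qed

text \<open>The faces \<open>z $ 2 = 0\<close> and \<open>z $ 2 = 2 * pi\<close> carry equal values
  by periodicity and cancel, so the circle direction has no boundary term.\<close>

lemma integral_partial_2:
  assumes "C1 f" "periodic_z2 f"
  shows "(\<integral>z. partial 2 f z \<partial>(lebesgue_on (Omega r0 r1))) = 0"
proof -
  let ?T = "\<lambda>p::real \<times> real \<times> real. vector [fst (snd p), fst p, snd (snd p)] :: real ^ 3"
  have "?T (2 * pi, y) = ?T (0, y) + axis 2 (2 * pi)" for y
    by (simp add: vec_eq_iff forall_3 axis_def)
  then have "f (?T (2 * pi, y)) = f (?T (0, y))" for y using assms(2) by (metis periodic_z2_def)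
  then show ?thesis
    using integral_partial_box[of ?T 2 1 3 f "vector [r0, 0, -1]" "vector [r1, 2 * pi, 1]"] assms
    by (simp add: Omega_box)
qed

section \<open>Totality of the trigonometric eigenfunctions\<close>

lemma partial_product:
  assumes "(f has_real_derivative f') (at (z $ 1))" "(g has_real_derivative g') (at (z $ 2))"
    "(h has_real_derivative h') (at (z $ 3))"
  shows "partial 1 (\<lambda>z. f (z $ 1) * g (z $ 2) * h (z $ 3)) z = f' * g (z $ 2) * h (z $ 3)"
    "partial 2 (\<lambda>z. f (z $ 1) * g (z $ 2) * h (z $ 3)) z = f (z $ 1) * g' * h (z $ 3)"
    "partial 3 (\<lambda>z. f (z $ 1) * g (z $ 2) * h (z $ 3)) z = f (z $ 1) * g (z $ 2) * h'"
proof -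
  have c: "((\<lambda>z. u (z $ i)) has_derivative (\<lambda>v. d * (v $ i))) (at z)"
    if "(u has_real_derivative d) (at (z $ i))" for u d and i :: 3
    using has_derivative_compose[OF bounded_linear_imp_has_derivative[OF bounded_linear_vec_nth[of i]]
        that[unfolded has_field_derivative_def], where s=UNIV] by simp
  define D :: "3 \<Rightarrow> real" where "D = (\<lambda>i. if i = 1 then f' * g (z $ 2) * h (z $ 3)
      else if i = 2 then f (z $ 1) * g' * h (z $ 3) else f (z $ 1) * g (z $ 2) * h')"
  have "((\<lambda>z. f (z $ 1) * g (z $ 2) * h (z $ 3)) has_derivative (\<lambda>v. \<Sum>i\<in>UNIV. v $ i * D i)) (at z)"
    by (rule has_derivative_eq_rhs[OF has_derivative_mult[OF has_derivative_mult[OF c[OF assms(1)] c[OF assms(2)]] c[OF assms(3)]]])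
       (auto simp: D_def sum_3 algebra_simps)
  note * = partial_eqI[OF this]
  show "partial 1 (\<lambda>z. f (z $ 1) * g (z $ 2) * h (z $ 3)) z = f' * g (z $ 2) * h (z $ 3)"
    "partial 2 (\<lambda>z. f (z $ 1) * g (z $ 2) * h (z $ 3)) z = f (z $ 1) * g' * h (z $ 3)"
    "partial 3 (\<lambda>z. f (z $ 1) * g (z $ 2) * h (z $ 3)) z = f (z $ 1) * g (z $ 2) * h'"
    by (simp_all add: * D_def)
qed

text \<open>Inner regularity: up to arbitrarily small measure, the set where \<open>w\<close> is
  positive is a closed set, which is compact by boundedness. A vanishing integral of a positive
  function makes each such compact set null.\<close>

lemma AE_nonpos_if_compact_integrals_zero:
  fixes w :: "'a::euclidean_space \<Rightarrow> real"
  assumes S: "S \<in> sets lebesgue" "bounded S" and w: "integrable (lebesgue_on S) w"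
    and K: "\<And>K. \<lbrakk>compact K; K \<subseteq> S\<rbrakk> \<Longrightarrow> (\<integral>z. w z * indicator K z \<partial>(lebesgue_on S)) = 0"
  shows "AE z in lebesgue_on S. w z \<le> 0"
proof -
  let ?M = "lebesgue_on S"
  define A where "A = {z \<in> S. w z > 0}"
  have AM: "A \<in> sets ?M"
  proof -
    have "{z \<in> space ?M. w z > 0} \<in> sets ?M" using w by measurable
    then show ?thesis by (simp add: A_def)
  qed
  then have A: "A \<in> sets lebesgue" using S by (simp add: sets_restrict_space_iff)
  have "emeasure lebesgue A \<le> ennreal e" if e: "e > 0" for e :: real
  proof -
    obtain T where T: "closed T" "T \<subseteq> A" "A - T \<in> lmeasurable" "emeasure lebesgue (A - T) < ennreal e"
      using sets_lebesgue_inner_closed[OF A e] by blast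
    have TS: "T \<subseteq> S" using T by (auto simp: A_def)
    have "compact T" using T(1) bounded_subset[OF S(2) TS] by (simp add: compact_eq_bounded_closed)
    then have z: "(\<integral>z. w z * indicator T z \<partial>?M) = 0" using TS by (rule K)
    have TM: "T \<in> sets ?M" using TS S(1) T(1) by (auto simp: sets_restrict_space_iff)
    have "integrable ?M (\<lambda>z. w z * indicator T z)"
      using integrable_mult_indicator[OF TM w] by (simp add: mult.commute)
    then have "AE x in ?M. w x * indicator T x = 0"
      using z T(2) by (subst (asm) integral_nonneg_eq_0_iff_AE) (auto simp: A_def indicator_def intro!: AE_I2)
    then have "AE x in ?M. x \<notin> T"
      by eventually_elim (use T(2) in \<open>auto simp: A_def indicator_def split: if_splits\<close>)
    then have "emeasure ?M T = 0"
      using AE_iff_measurable[OF TM, of "\<lambda>x. x \<notin> T"] TS by (auto simp: )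
    then have "emeasure lebesgue T = 0" using TS S(1) by (simp add: emeasure_restrict_space)
    moreover have "A = (A - T) \<union> T" using T(2) by auto
    moreover have "emeasure lebesgue ((A - T) \<union> T) \<le> emeasure lebesgue (A - T) + emeasure lebesgue T"
      using T A by (intro emeasure_subadditive) auto
    ultimately show ?thesis using T(4) by (metis add.right_neutral less_imp_le order_trans)
  qed
  then have "emeasure lebesgue A = 0" by (metis ennreal_le_epsilon add_0 le_zero_eq)
  then have "emeasure ?M A = 0" using A_def S(1) by (subst emeasure_restrict_space) auto
  then have "A \<in> null_sets ?M" using AM by (simp add: null_setsI)
  then show ?thesis
    by (rule AE_I'[of A]) (auto simp: A_def)
qed

lemma AE_zero_if_compact_integrals_zero:
  fixes w :: "'a::euclidean_space \<Rightarrow> real"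
  assumes S: "S \<in> sets lebesgue" "bounded S" and w: "integrable (lebesgue_on S) w"
    and K: "\<And>K. \<lbrakk>compact K; K \<subseteq> S\<rbrakk> \<Longrightarrow> (\<integral>z. w z * indicator K z \<partial>(lebesgue_on S)) = 0"
  shows "AE z in lebesgue_on S. w z = 0"
proof -
  have "AE z in lebesgue_on S. w z \<le> 0"
    by (rule AE_nonpos_if_compact_integrals_zero[OF S w K])
  moreover have "AE z in lebesgue_on S. - w z \<le> 0"
    by (rule AE_nonpos_if_compact_integrals_zero[OF S]) (use w K in auto)
  ultimately show ?thesis by eventually_elim auto
qed

lemma zero_if_abs_le_epsilon_mult:
  fixes x c :: real
  assumes "\<And>e. e > 0 \<Longrightarrow> \<bar>x\<bar> \<le> e * c" "c \<ge> 0"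
  shows "x = 0"
proof (rule ccontr)
  assume "x \<noteq> 0"
  then have "\<bar>x\<bar> \<le> \<bar>x\<bar> / (c + 1) * c" using assms(2) by (intro assms(1)) auto
  then have "\<bar>x\<bar> * (c + 1) \<le> \<bar>x\<bar> * c" using assms(2) by (simp add: field_simps)
  then show False using \<open>x \<noteq> 0\<close> by simp
qed

locale strip =
  fixes r0 r1 :: real
  assumes r0_less: "r0 < r1"
begin

abbreviation "\<Omega> \<equiv> Omega r0 r1"

definition \<kappa> :: real where "\<kappa> = pi / (r1 - r0)"

lemma \<kappa>_pos: "\<kappa> > 0" using r0_less by (simp add: \<kappa>_def)

text \<open>The phase \<open>\<theta>\<close> puts sines and cosines in \<open>z $ 2\<close> into
  one family. The indices are integers so that the differences that arise from products are indices
  again.\<close>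

definition eig :: "int \<Rightarrow> int \<Rightarrow> real \<Rightarrow> int \<Rightarrow> real ^ 3 \<Rightarrow> real" where
  "eig k m \<theta> l = (\<lambda>z. cos (k * \<kappa> * (z $ 1 - r0)) * cos (m * z $ 2 + \<theta>) * cos (l * (pi / 2) * (z $ 3 + 1)))"

definition eigs :: "(real ^ 3 \<Rightarrow> real) set" where
  "eigs = {eig k m \<theta> l | k m \<theta> l. True}"

lemma elem_eig: "elem (eig k m \<theta> l)"
  unfolding eig_def by (intro elem_intros)

lemma periodic_eig: "periodic_z2 (eig k m \<theta> l)"
proof -
  have "cos (real_of_int m * (x + 2 * pi) + \<theta>) = cos (real_of_int m * x + \<theta>)" for x
    using sin_cos_eq_iff[of "real_of_int m * (x + 2 * pi) + \<theta>" "real_of_int m * x + \<theta>"]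
    by (auto simp: algebra_simps intro!: exI[of _ m])
  then show ?thesis by (simp add: periodic_z2_def eig_def axis_def)
qed

lemma smooth_periodic_eig: "smooth_periodic (eig k m \<theta> l)"
  by (intro elem_smooth_periodic elem_eig periodic_eig)

lemma partial_eig:
  "partial 1 (eig k m \<theta> l) z =
     - (k * \<kappa>) * sin (k * \<kappa> * (z $ 1 - r0)) * cos (m * z $ 2 + \<theta>) * cos (l * (pi / 2) * (z $ 3 + 1))"
  "partial 2 (eig k m \<theta> l) z =
     cos (k * \<kappa> * (z $ 1 - r0)) * (- m * sin (m * z $ 2 + \<theta>)) * cos (l * (pi / 2) * (z $ 3 + 1))"
  "partial 3 (eig k m \<theta> l) z =
     cos (k * \<kappa> * (z $ 1 - r0)) * cos (m * z $ 2 + \<theta>) * (- (l * (pi / 2)) * sin (l * (pi / 2) * (z $ 3 + 1)))"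
  unfolding eig_def
  by (rule partial_product[where f="\<lambda>x. cos (k * \<kappa> * (x - r0))" and g="\<lambda>x. cos (m * x + \<theta>)"
        and h="\<lambda>x. cos (l * (pi / 2) * (x + 1))"]; auto intro!: derivative_eq_intros)+

definition freq :: "int \<Rightarrow> int \<Rightarrow> int \<Rightarrow> 3 \<Rightarrow> real" where
  "freq k m l i = (if i = 1 then k * \<kappa> else if i = 2 then m else l * (pi / 2))"

lemma partial_partial_eig:
  "partial i (partial i (eig k m \<theta> l)) z = - (freq k m l i)\<^sup>2 * eig k m \<theta> l z"
proof -
  have "partial 1 (partial 1 (eig k m \<theta> l)) z = - (k * \<kappa>)\<^sup>2 * eig k m \<theta> l z"
    unfolding partial_eig[abs_def]
    by (subst partial_product(1)[where f="\<lambda>x. - (k * \<kappa>) * sin (k * \<kappa> * (x - r0))" and g="\<lambda>x. cos (m * x + \<theta>)"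
        and h="\<lambda>x. cos (l * (pi / 2) * (x + 1))"])
       (auto intro!: derivative_eq_intros simp: eig_def power2_eq_square)
  moreover have "partial 2 (partial 2 (eig k m \<theta> l)) z = - (real_of_int m)\<^sup>2 * eig k m \<theta> l z"
    unfolding partial_eig[abs_def]
    by (subst partial_product(2)[where f="\<lambda>x. cos (k * \<kappa> * (x - r0))" and g="\<lambda>x. - real_of_int m * sin (real_of_int m * x + \<theta>)"
        and h="\<lambda>x. cos (l * (pi / 2) * (x + 1))"])
       (auto intro!: derivative_eq_intros simp: eig_def power2_eq_square)
  moreover have "partial 3 (partial 3 (eig k m \<theta> l)) z = - (l * (pi / 2))\<^sup>2 * eig k m \<theta> l z"
    unfolding partial_eig[abs_def]
    by (subst partial_product(3)[where f="\<lambda>x. cos (k * \<kappa> * (x - r0))" and g="\<lambda>x. cos (m * x + \<theta>)"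
        and h="\<lambda>x. - (l * (pi / 2)) * sin (l * (pi / 2) * (x + 1))"])
       (auto intro!: derivative_eq_intros simp: eig_def power2_eq_square)
  ultimately show ?thesis using exhaust_3[of i] by (auto simp: freq_def)
qed

text \<open>Product-to-sum formulas in the three variables; the eight terms correspond to the
  choices of sign.\<close>

lemma eig_mult_span:
  "(\<lambda>z. eig k m \<theta> l z * eig k' m' \<theta>' l' z) \<in> span eigs"
proof -
  have *: "cos a * cos a' = (cos (a + a') + cos (a - a')) / 2" for a a' :: real
    by (simp add: cos_add cos_diff)
  have alg: "((p + q) / 2) * ((r + s) / 2) * ((t + u) / 2) = 1 / 8 * (p * r * t + p * r * u + p * s * t + p * s * u
      + q * r * t + q * r * u + q * s * t + q * s * u)" for p q r s t u :: real
    by (simp add: field_simps)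
  have e: "eig a b c d \<in> span eigs" for a b c d by (rule span_base) (auto simp: eigs_def)
  have "(\<lambda>z. eig k m \<theta> l z * eig k' m' \<theta>' l' z) = (1/8) *\<^sub>R
     (eig (k + k') (m + m') (\<theta> + \<theta>') (l + l') + eig (k + k') (m + m') (\<theta> + \<theta>') (l - l')
      + eig (k + k') (m - m') (\<theta> - \<theta>') (l + l') + eig (k + k') (m - m') (\<theta> - \<theta>') (l - l')
      + eig (k - k') (m + m') (\<theta> + \<theta>') (l + l') + eig (k - k') (m + m') (\<theta> + \<theta>') (l - l')
      + eig (k - k') (m - m') (\<theta> - \<theta>') (l + l') + eig (k - k') (m - m') (\<theta> - \<theta>') (l - l'))"
  proof
    fix z :: "real ^ 3"
    let ?a = "k * \<kappa> * (z $ 1 - r0)" and ?a' = "k' * \<kappa> * (z $ 1 - r0)"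
    let ?b = "m * z $ 2 + \<theta>" and ?b' = "m' * z $ 2 + \<theta>'"
    let ?c = "l * (pi / 2) * (z $ 3 + 1)" and ?c' = "l' * (pi / 2) * (z $ 3 + 1)"
    have "eig k m \<theta> l z * eig k' m' \<theta>' l' z = (cos ?a * cos ?a') * (cos ?b * cos ?b') * (cos ?c * cos ?c')"
      by (simp add: eig_def)
    also have "\<dots> = ((cos (?a + ?a') + cos (?a - ?a')) / 2) * ((cos (?b + ?b') + cos (?b - ?b')) / 2)
         * ((cos (?c + ?c') + cos (?c - ?c')) / 2)" by (simp only: *)
    also have "?a + ?a' = (k + k') * \<kappa> * (z $ 1 - r0)" by (simp add: algebra_simps)
    also have "?a - ?a' = (k - k') * \<kappa> * (z $ 1 - r0)" by (simp add: algebra_simps)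
    also have "?b + ?b' = (m + m') * z $ 2 + (\<theta> + \<theta>')" by (simp add: algebra_simps)
    also have "?b - ?b' = (m - m') * z $ 2 + (\<theta> - \<theta>')" by (simp add: algebra_simps)
    also have "?c + ?c' = (l + l') * (pi / 2) * (z $ 3 + 1)" by (simp only: of_int_add distrib_right)
    also have "?c - ?c' = (l - l') * (pi / 2) * (z $ 3 + 1)" by (simp only: of_int_diff left_diff_distrib)
    finally show "eig k m \<theta> l z * eig k' m' \<theta>' l' z = ((1/8) *\<^sub>R
     (eig (k + k') (m + m') (\<theta> + \<theta>') (l + l') + eig (k + k') (m + m') (\<theta> + \<theta>') (l - l')
      + eig (k + k') (m - m') (\<theta> - \<theta>') (l + l') + eig (k + k') (m - m') (\<theta> - \<theta>') (l - l')
      + eig (k - k') (m + m') (\<theta> + \<theta>') (l + l') + eig (k - k') (m + m') (\<theta> + \<theta>') (l - l')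
      + eig (k - k') (m - m') (\<theta> - \<theta>') (l + l') + eig (k - k') (m - m') (\<theta> - \<theta>') (l - l'))) z"
      unfolding scaleR_fun_apply plus_fun_apply eig_def real_scaleR_def alg by simp
  qed
  also have "\<dots> \<in> span eigs" by (intro span_scale span_add e)
  finally show ?thesis .
qed

lemma span_eigs_mult:
  assumes "f \<in> span eigs" "g \<in> span eigs"
  shows "(\<lambda>z. f z * g z) \<in> span eigs"
proof -
  have base: "(\<lambda>z. e z * g z) \<in> span eigs" if "e \<in> eigs" for e
    using assms(2)
  proof (induction rule: span_induct_alt)
    case base then show ?case using span_zero[of eigs] by (simp add: zero_fun_def)
  next
    case (step c x y)
    have "(\<lambda>z. e z * (c *\<^sub>R x + y) z) = c *\<^sub>R (\<lambda>z. e z * x z) + (\<lambda>z. e z * y z)"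
      by (auto simp: algebra_simps)
    moreover have "(\<lambda>z. e z * x z) \<in> span eigs" using that step eig_mult_span by (auto simp: eigs_def)
    ultimately show ?case using step by (simp add: span_add span_scale)
  qed
  show ?thesis using assms(1)
  proof (induction rule: span_induct_alt)
    case base then show ?case using span_zero[of eigs] by (simp add: zero_fun_def)
  next
    case (step c x y)
    have "(\<lambda>z. (c *\<^sub>R x + y) z * g z) = c *\<^sub>R (\<lambda>z. x z * g z) + (\<lambda>z. y z * g z)"
      by (auto simp: algebra_simps)
    then show ?case using step base by (simp add: span_add span_scale)
  qed
qed

text \<open>Coordinates in which every polynomial belongs to the span of the eigenfunctions: cosines
  of the rescaled \<open>z $ 1\<close> and \<open>z $ 3\<close>, and the point of the unit circle
  with angle \<open>z $ 2\<close>. Approximation by eigenfunctions becomes polynomial approximation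
  on a compact set in four dimensions.\<close>

definition \<Phi> :: "real ^ 3 \<Rightarrow> real \<times> real \<times> real \<times> real" where
  "\<Phi> z = (cos (\<kappa> * (z $ 1 - r0)), cos (z $ 2), sin (z $ 2), cos (pi / 2 * (z $ 3 + 1)))"

lemma eig_mem: "eig k m \<theta> l \<in> span eigs"
  by (rule span_base) (auto simp: eigs_def)

lemma const_mem: "(\<lambda>z. c) \<in> span eigs"
proof -
  have "(\<lambda>z. c) = c *\<^sub>R eig 0 0 0 0" by (auto simp: eig_def)
  then show ?thesis by (simp add: eig_mem span_scale)
qed

text \<open>Linear forms are covered because the sine of \<open>z $ 2\<close> is an eigenfunction
  with phase \<open>- pi / 2\<close>; products stay in the span by
  \<open>span_eigs_mult\<close>.\<close>

lemma polynomial_\<Phi>_mem: "real_polynomial_function p \<Longrightarrow> (\<lambda>z. p (\<Phi> z)) \<in> span eigs"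
proof (induction rule: real_polynomial_function.induct)
  case (linear f)
  then interpret f: bounded_linear f .
  have "f (a, b, c, d) = a * f (1, 0, 0, 0) + b * f (0, 1, 0, 0) + c * f (0, 0, 1, 0) + d * f (0, 0, 0, 1)"
    for a b c d
  proof -
    have "(a, b, c, d) = a *\<^sub>R (1, 0, 0, 0) + b *\<^sub>R (0, 1, 0, 0) + c *\<^sub>R (0, 0, 1, 0) + d *\<^sub>R (0, 0, 0, 1)" by simp
    then show ?thesis by (simp only: f.add f.scaleR real_scaleR_def)
  qed
  note lin = this
  have "(\<lambda>z. f (\<Phi> z)) = f (1, 0, 0, 0) *\<^sub>R eig 1 0 0 0 + f (0, 1, 0, 0) *\<^sub>R eig 0 1 0 0
       + f (0, 0, 1, 0) *\<^sub>R eig 0 1 (- pi / 2) 0 + f (0, 0, 0, 1) *\<^sub>R eig 0 0 0 1"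
    unfolding \<Phi>_def by (intro ext, subst lin) (simp add: eig_def cos_diff mult_ac)
  then show ?case by (simp add: eig_mem span_add span_scale)
next
  case (const c) show ?case by (rule const_mem)
next
  case (add f g) then show ?case using span_add[of "\<lambda>z. f (\<Phi> z)" eigs "\<lambda>z. g (\<Phi> z)"] by (simp add: plus_fun_def)
next
  case (mult f g) then show ?case using span_eigs_mult by blast
qed

lemma \<Phi>_continuous: "continuous_on S \<Phi>"
  unfolding \<Phi>_def by (intro continuous_intros)

text \<open>The rescaled first and third variables stay between \<open>0\<close> and
  \<open>pi\<close>, where the cosine is injective. In the open cell two angles differ by less than
  \<open>2 * pi\<close>, so equal points of the circle have equal angles.\<close>

lemma \<Phi>_inj: "inj_on \<Phi> \<Omega>"
proof (rule inj_onI)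
  fix x y assume xy: "x \<in> \<Omega>" "y \<in> \<Omega>" and eq: "\<Phi> x = \<Phi> y"
  have r: "0 \<le> \<kappa> * (z $ 1 - r0)" "\<kappa> * (z $ 1 - r0) \<le> pi" "0 \<le> pi / 2 * (z $ 3 + 1)" "pi / 2 * (z $ 3 + 1) \<le> pi"
    if "z \<in> \<Omega>" for z
  proof -
    have z: "r0 < z $ 1" "z $ 1 < r1" "0 \<le> z $ 3 + 1" "z $ 3 + 1 \<le> 2" using that by (auto simp: Omega_def)
    show "0 \<le> \<kappa> * (z $ 1 - r0)" "0 \<le> pi / 2 * (z $ 3 + 1)" using z \<kappa>_pos by simp_all
    have "\<kappa> * (z $ 1 - r0) \<le> \<kappa> * (r1 - r0)" using z \<kappa>_pos by simp
    then show "\<kappa> * (z $ 1 - r0) \<le> pi" using r0_less by (simp add: \<kappa>_def)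
    have "pi / 2 * (z $ 3 + 1) \<le> pi / 2 * 2" using z by (intro mult_left_mono) auto
    then show "pi / 2 * (z $ 3 + 1) \<le> pi" by simp
  qed
  have "\<kappa> * (x $ 1 - r0) = \<kappa> * (y $ 1 - r0)"
    by (rule cos_inj_pi) (use eq r[OF xy(1)] r[OF xy(2)] in \<open>auto simp: \<Phi>_def\<close>)
  then have 1: "x $ 1 = y $ 1" using \<kappa>_pos by simp
  have "pi / 2 * (x $ 3 + 1) = pi / 2 * (y $ 3 + 1)"
    by (rule cos_inj_pi) (use eq r[OF xy(1)] r[OF xy(2)] in \<open>auto simp: \<Phi>_def\<close>)
  then have 3: "x $ 3 = y $ 3" by simp
  obtain n :: int where n: "x $ 2 = y $ 2 + 2 * pi * n"
    using eq sin_cos_eq_iff[of "x $ 2" "y $ 2"] by (auto simp: \<Phi>_def)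
  have "\<bar>x $ 2 - y $ 2\<bar> < 2 * pi" using xy by (auto simp: Omega_def)
  then have "\<bar>real_of_int n\<bar> < 1" using n by (simp add: abs_mult)
  then have "n = 0" by linarith
  then show "x = y" using n 1 3 by (simp add: vec_eq_iff forall_3)
qed

lemma eigs_total:
  assumes w: "integrable (lebesgue_on \<Omega>) w"
    and orth: "\<And>f. f \<in> span eigs \<Longrightarrow> (\<integral>z. w z * f z \<partial>(lebesgue_on \<Omega>)) = 0"
  shows "AE z in lebesgue_on \<Omega>. w z = 0"
proof -
  let ?M = "lebesgue_on \<Omega>"
  have mcomp: "(\<lambda>z. g (\<Phi> z)) \<in> borel_measurable ?M" if "continuous_on UNIV g" for g :: "_ \<Rightarrow> real"
  proof -
    have "continuous_on UNIV (\<lambda>z. g (\<Phi> z))" using continuous_on_compose2[OF that \<Phi>_continuous] by auto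
    then have "(\<lambda>z. g (\<Phi> z)) \<in> borel_measurable lborel" by (simp add: borel_measurable_continuous_onI)
    then show ?thesis by (intro measurable_restrict_space1 measurable_completion)
  qed
  have cbox: "\<Omega> \<subseteq> cbox (vector [r0, 0, -1]) (vector [r1, 2 * pi, 1])" by (simp add: Omega_box box_subset_cbox)
  let ?S = "\<Phi> ` cbox (vector [r0, 0, -1]) (vector [r1, 2 * pi, 1])"
  have S: "compact ?S" by (intro compact_continuous_image \<Phi>_continuous compact_cbox)
  \<comment> \<open>Orthogonality passes from polynomials to continuous functions of
    \<open>\<Phi>\<close>: a uniform error \<open>e\<close> on the image of the closed box costs at
    most \<open>e\<close> times the L1 norm of \<open>w\<close>.\<close>
  have cont: "(\<integral>z. w z * g (\<Phi> z) \<partial>?M) = 0" if g: "continuous_on UNIV g" "\<And>y. \<bar>g y\<bar> \<le> 1" for g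
  proof -
    have ig: "integrable ?M (\<lambda>z. w z * g (\<Phi> z))"
    proof (rule Bochner_Integration.integrable_bound[OF w])
      show "(\<lambda>z. w z * g (\<Phi> z)) \<in> borel_measurable ?M"
        by (rule borel_measurable_times[OF borel_measurable_integrable[OF w] mcomp[OF g(1)]])
      show "AE z in ?M. norm (w z * g (\<Phi> z)) \<le> norm (w z)"
        using g(2) by (intro AE_I2) (simp add: abs_mult mult_left_le)
    qed
    have "\<bar>\<integral>z. w z * g (\<Phi> z) \<partial>?M\<bar> \<le> e * (\<integral>z. \<bar>w z\<bar> \<partial>?M)" if e: "e > 0" for e
    proof -
      obtain p where p: "real_polynomial_function p" "\<And>x. x \<in> ?S \<Longrightarrow> \<bar>g x - p x\<bar> < e"
        using Stone_Weierstrass_real_polynomial_function[OF S continuous_on_subset[OF g(1)] e] by blast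
      have pc: "continuous_on UNIV p" using p(1)
        by (simp add: continuous_at_imp_continuous_on continuous_real_polymonial_function)
      have d: "\<bar>g (\<Phi> z) - p (\<Phi> z)\<bar> \<le> e" if "z \<in> \<Omega>" for z using p(2)[of "\<Phi> z"] that cbox by fastforce
      have i2: "integrable ?M (\<lambda>z. w z * (g (\<Phi> z) - p (\<Phi> z)))"
      proof (rule Bochner_Integration.integrable_bound)
        show "integrable ?M (\<lambda>z. e * w z)" using w by simp
        show "(\<lambda>z. w z * (g (\<Phi> z) - p (\<Phi> z))) \<in> borel_measurable ?M"
          using w mcomp[OF g(1)] mcomp[OF pc] by measurable
        show "AE z in ?M. norm (w z * (g (\<Phi> z) - p (\<Phi> z))) \<le> norm (e * w z)"
          using d e by (intro AE_I2) (auto simp: abs_mult mult.commute[of e] intro!: mult_left_mono)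
      qed
      have "integrable ?M (\<lambda>z. w z * g (\<Phi> z) - w z * (g (\<Phi> z) - p (\<Phi> z)))" using ig i2 by simp
      then have ip: "integrable ?M (\<lambda>z. w z * p (\<Phi> z))" by (simp add: algebra_simps)
      have "(\<integral>z. w z * g (\<Phi> z) \<partial>?M) = (\<integral>z. w z * g (\<Phi> z) \<partial>?M) - (\<integral>z. w z * p (\<Phi> z) \<partial>?M)"
        using orth[OF polynomial_\<Phi>_mem[OF p(1)]] by simp
      also have "\<dots> = (\<integral>z. w z * (g (\<Phi> z) - p (\<Phi> z)) \<partial>?M)"
        using ig ip by (simp add: right_diff_distrib)
      also have "\<bar>\<dots>\<bar> \<le> (\<integral>z. \<bar>w z * (g (\<Phi> z) - p (\<Phi> z))\<bar> \<partial>?M)" by (rule integral_abs_bound)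
      also have "\<dots> \<le> (\<integral>z. e * \<bar>w z\<bar> \<partial>?M)"
      proof (rule integral_mono)
        show "integrable ?M (\<lambda>z. \<bar>w z * (g (\<Phi> z) - p (\<Phi> z))\<bar>)" using i2 by (rule integrable_abs)
        show "integrable ?M (\<lambda>z. e * \<bar>w z\<bar>)" using w by simp
        show "\<bar>w z * (g (\<Phi> z) - p (\<Phi> z))\<bar> \<le> e * \<bar>w z\<bar>" if "z \<in> space ?M" for z
          using d[of z] that by (simp add: abs_mult mult.commute[of e] mult_left_mono)
      qed
      finally show ?thesis by simp
    qed
    then show ?thesis by (rule zero_if_abs_le_epsilon_mult) (auto intro!: integral_nonneg_AE)
  qed
  show ?thesis
  proof (rule AE_zero_if_compact_integrals_zero[OF _ Omega_bounded w])
    fix K assume K: "compact K" "K \<subseteq> \<Omega>"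
    show "(\<integral>z. w z * indicator K z \<partial>?M) = 0"
    proof (cases "K = {}")
      case False
      \<comment> \<open>Continuous functions that decrease to the indicator of the closed image of
        \<open>K\<close>. Since \<open>\<Phi>\<close> is injective on the cell, their compositions
        with \<open>\<Phi>\<close> tend there to the indicator of \<open>K\<close> itself.\<close>
      define h where "h n y = max 0 (1 - real n * infdist y (\<Phi> ` K))" for n y
      have hc: "continuous_on UNIV (h n)" for n unfolding h_def by (intro continuous_intros)
      have h1: "\<bar>h n y\<bar> \<le> 1" for n y by (auto simp: h_def infdist_nonneg)
      have cl: "closed (\<Phi> ` K)" "\<Phi> ` K \<noteq> {}" using K False
        by (auto intro!: compact_imp_closed compact_continuous_image \<Phi>_continuous)
      have "(\<lambda>n. \<integral>z. w z * h n (\<Phi> z) \<partial>?M) \<longlonglongrightarrow> (\<integral>z. w z * indicator K z \<partial>?M)"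
      proof (rule integral_dominated_convergence[where w="\<lambda>z. \<bar>w z\<bar>"])
        show "(\<lambda>z. w z * indicator K z) \<in> borel_measurable ?M"
        proof (rule borel_measurable_times[OF borel_measurable_integrable[OF w] borel_measurable_indicator])
          show "K \<in> sets ?M" using K by (simp add: sets_restrict_space_iff compact_imp_closed)
        qed
        show "(\<lambda>z. w z * h n (\<Phi> z)) \<in> borel_measurable ?M" for n
          using w mcomp[OF hc] by measurable
        show "AE z in ?M. (\<lambda>n. w z * h n (\<Phi> z)) \<longlonglongrightarrow> w z * indicator K z"
        proof (intro AE_I2 tendsto_mult_left)
          fix z assume z: "z \<in> space ?M"
          show "(\<lambda>n. h n (\<Phi> z)) \<longlonglongrightarrow> indicator K z"
          proof (cases "z \<in> K")
            case True
            then have "infdist (\<Phi> z) (\<Phi> ` K) = 0" by (simp add: infdist_zero)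
            then show ?thesis using True by (simp add: h_def)
          next
            case F: False
            have "\<Phi> z \<notin> \<Phi> ` K"
            proof
              assume "\<Phi> z \<in> \<Phi> ` K"
              then obtain y where y: "y \<in> K" "\<Phi> z = \<Phi> y" by blast
              moreover have "z \<in> \<Omega>" using z by simp
              ultimately have "z = y" using inj_onD[OF \<Phi>_inj] K(2) by blast
              then show False using F y by simp
            qed
            then have "infdist (\<Phi> z) (\<Phi> ` K) \<noteq> 0" using in_closed_iff_infdist_zero[OF cl] by blast
            then have d: "infdist (\<Phi> z) (\<Phi> ` K) > 0"
              using infdist_nonneg[of "\<Phi> z" "\<Phi> ` K"] by linarith
            obtain N :: nat where N: "1 < real N * infdist (\<Phi> z) (\<Phi> ` K)" using d reals_Archimedean3 by blast
            have "h n (\<Phi> z) = 0" if "n \<ge> N" for n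
            proof -
              have "real N * infdist (\<Phi> z) (\<Phi> ` K) \<le> real n * infdist (\<Phi> z) (\<Phi> ` K)"
                using that d by (intro mult_right_mono) auto
              then show ?thesis using N by (simp add: h_def)
            qed
            then show ?thesis using F by (intro tendsto_eventually) (auto simp: eventually_sequentially)
          qed
        qed
        show "AE z in ?M. norm (w z * h n (\<Phi> z)) \<le> \<bar>w z\<bar>" for n
          using h1 by (intro AE_I2) (simp add: abs_mult mult_left_le)
      qed (use w in auto)
      then show ?thesis using cont[OF hc h1] by (simp add: LIMSEQ_const_iff)
    qed simp
  qed simp
qed

end

section \<open>Cutoff functions and weak gradients\<close>

lemma L2_on_continuous:
  fixes f :: "'a::euclidean_space \<Rightarrow> 'b::euclidean_space"
  assumes "S \<in> sets borel" "bounded S" "continuous_on UNIV f"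
  shows "L2_on S f"
  unfolding L2_on_def
proof
  show "f \<in> borel_measurable (lebesgue_on S)"
    using integrable_on_continuous[OF assms] by (rule borel_measurable_integrable)
  show "integrable (lebesgue_on S) (\<lambda>x. (norm (f x))\<^sup>2)"
    by (rule integrable_on_continuous[OF assms(1,2)]) (intro continuous_intros assms(3))
qed

text \<open>Both sides vanish to first order at \<open>0\<close> and \<open>L\<close>. On the left
  half \<open>L - s\<close> is at least \<open>L / 2\<close>; the right half follows by reflection,
  which preserves the modulus of the sine because \<open>k\<close> is an integer. This is how normal
  derivatives of eigenfunctions are bounded by the distance to the faces.\<close>

lemma sin_multiple_bound:
  fixes k :: int
  assumes L: "L > 0" and s: "0 \<le> s" "s \<le> L"
  shows "\<bar>sin (k * (pi / L) * s)\<bar> \<le> (2 * \<bar>k\<bar> * pi / L\<^sup>2) * (s * (L - s))"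
proof -
  have a: "\<bar>sin (k * (pi / L) * x)\<bar> \<le> \<bar>k\<bar> * (pi / L) * x" if "x \<ge> 0" for x :: real
    using abs_sin_x_le_abs_x[of "k * (pi / L) * x"] L that by (simp add: abs_mult)
  have half: "x \<le> 2 / L * (x * (L - x))" if "0 \<le> x" "x \<le> L / 2" for x
  proof -
    have "x * (L / 2) \<le> x * (L - x)" using that by (intro mult_left_mono) auto
    then show ?thesis using L by (simp add: field_simps)
  qed
  have refl: "\<bar>sin (k * (pi / L) * s)\<bar> = \<bar>sin (k * (pi / L) * (L - s))\<bar>"
  proof -
    have z: "sin (k * pi) = 0" by (auto simp: sin_zero_iff_int2)
    then have "(cos (k * pi))\<^sup>2 = 1" using sin_cos_squared_add[of "k * pi"] by simp
    then have "\<bar>cos (k * pi)\<bar> = 1" by (auto simp: power2_eq_1_iff)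
    moreover have "k * (pi / L) * (L - s) = k * pi - k * (pi / L) * s" using L by (simp add: field_simps)
    ultimately show ?thesis using z by (simp add: sin_diff abs_mult)
  qed
  have fin: "\<bar>k\<bar> * (pi / L) * x \<le> (2 * \<bar>k\<bar> * pi / L\<^sup>2) * (x * (L - x))" if "0 \<le> x" "x \<le> L / 2" for x
  proof -
    have "\<bar>k\<bar> * (pi / L) * x \<le> \<bar>k\<bar> * (pi / L) * (2 / L * (x * (L - x)))"
      using half[OF that] L by (intro mult_left_mono) auto
    then show ?thesis by (simp add: power2_eq_square mult_ac)
  qed
  show ?thesis
  proof (cases "s \<le> L / 2")
    case True
    then show ?thesis using a[of s] fin[of s] s by linarith
  next
    case False
    then show ?thesis using a[of "L - s"] fin[of "L - s"] s refl by (simp add: mult.commute)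
  qed
qed

lemma flat_0_le_1: "flat 0 x \<le> 1"
  by (simp add: flat_def)

lemma linear_at_top:
  assumes "t > 0" shows "filterlim (\<lambda>n. real n * t - 1) at_top sequentially"
  unfolding filterlim_at_top
proof
  fix Z :: real
  obtain N :: nat where N: "Z + 1 < real N * t" using reals_Archimedean3[OF assms] by blast
  have "Z \<le> real n * t - 1" if "n \<ge> N" for n
  proof -
    have "real N * t \<le> real n * t" using that assms by simp
    then show ?thesis using N by linarith
  qed
  then show "\<forall>\<^sub>F n in sequentially. Z \<le> real n * t - 1" by (auto simp: eventually_sequentially)
qed

lemma flat_0_tendsto:
  assumes "t > 0" shows "(\<lambda>n. flat 0 (real n * t - 1)) \<longlonglongrightarrow> 1"
proof -
  note x = linear_at_top[OF assms]
  have "(\<lambda>n. inverse (real n * t - 1)) \<longlonglongrightarrow> 0" by (rule tendsto_inverse_0_at_top[OF x])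
  from tendsto_exp[OF tendsto_minus[OF this]] have lim: "(\<lambda>n. exp (- 1 / (real n * t - 1))) \<longlonglongrightarrow> 1" by (simp add: divide_inverse)
  have "\<forall>\<^sub>F n in sequentially. real n * t - 1 > 0" using x[unfolded filterlim_at_top_dense, rule_format, of 0] .
  then have "\<forall>\<^sub>F n in sequentially. exp (- 1 / (real n * t - 1)) = flat 0 (real n * t - 1)"
    by eventually_elim (simp add: flat_def)
  then show ?thesis by (rule Lim_transform_eventually[OF lim])
qed

text \<open>For \<open>x = n * t - 1\<close> this is \<open>n * t * flat 2 (n * t - 1)\<close>, the
  derivative of the cutoff profile times the distance variable \<open>t\<close>. It equals
  \<open>flat 1 x + flat 2 x\<close>, with bounds \<open>1\<close> and \<open>2\<close>.\<close>

lemma flat_2_weighted_bound: "(x + 1) * flat 2 x \<le> 3" "0 \<le> (x + 1) * flat 2 x"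
proof -
  have "x * flat 2 x = flat 1 x" by (auto simp: flat_def power2_eq_square)
  then have "(x + 1) * flat 2 x = flat 1 x + flat 2 x" by (simp add: algebra_simps)
  then show "(x + 1) * flat 2 x \<le> 3" "0 \<le> (x + 1) * flat 2 x"
    using flat_bound[of 1 x 0] flat_bound[of 2 x 0] flat_nonneg[of 1 x] flat_nonneg[of 2 x]
    by (simp_all add: eval_nat_numeral)
qed

text \<open>Away from the face the argument tends to infinity, where \<open>flat 2\<close> is at
  most the inverse square and so beats the linear weight.\<close>

lemma flat_2_weighted_tendsto:
  assumes "t > 0" shows "(\<lambda>n. real n * t * flat 2 (real n * t - 1)) \<longlonglongrightarrow> 0"
proof -
  note x = linear_at_top[OF assms]
  have i: "(\<lambda>n. inverse (real n * t - 1)) \<longlonglongrightarrow> 0" by (rule tendsto_inverse_0_at_top[OF x])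
  have "(\<lambda>n. inverse (real n * t - 1) + (inverse (real n * t - 1))\<^sup>2) \<longlonglongrightarrow> 0 + 0\<^sup>2" by (intro tendsto_intros i)
  then have lim: "(\<lambda>n. inverse (real n * t - 1) + (inverse (real n * t - 1))\<^sup>2) \<longlonglongrightarrow> 0" by simp
  have pos: "\<forall>\<^sub>F n in sequentially. real n * t - 1 > 0" using x[unfolded filterlim_at_top_dense, rule_format, of 0] .
  show ?thesis
  proof (rule Lim_null_comparison[OF _ lim], use pos in eventually_elim)
    case (elim n)
    define y where "y = real n * t - 1"
    have y: "y > 0" using elim by (simp add: y_def)
    have "real n * t * flat 2 (real n * t - 1) = (y + 1) * flat 2 y" by (simp add: y_def)
    moreover have "(y + 1) * flat 2 y \<le> (y + 1) * (1 / y\<^sup>2)"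
      using y by (intro mult_left_mono) (auto simp: flat_def divide_right_mono)
    moreover have "(y + 1) * (1 / y\<^sup>2) = inverse y + (inverse y)\<^sup>2" using y by (simp add: field_simps power2_eq_square)
    ultimately show ?case using flat_2_weighted_bound(2)[of y] by (simp add: y_def)
  qed
qed

context strip
begin

text \<open>The product of the distances to two opposite faces is positive inside, vanishes to first
  order on both faces, and is a polynomial, so that cutoffs built from it stay in the class
  \<open>elem\<close>.\<close>

definition edge1 :: "real ^ 3 \<Rightarrow> real" where "edge1 z = (z $ 1 - r0) * (r1 - z $ 1)"
definition edge3 :: "real ^ 3 \<Rightarrow> real" where "edge3 z = (z $ 3 + 1) * (1 - z $ 3)"

text \<open>The rate of vanishing that compensates the \<open>i\<close>-th derivative of the cutoff.
  In the circle direction there is no face and the cutoff is constant, hence the value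
  \<open>1\<close>.\<close>

definition edge :: "3 \<Rightarrow> real ^ 3 \<Rightarrow> real" where
  "edge i z = (if i = 1 then edge1 z else if i = 2 then 1 else edge3 z)"

definition cut :: "nat \<Rightarrow> real ^ 3 \<Rightarrow> real" where
  "cut n z = flat 0 (real n * edge1 z - 1) * flat 0 (real n * edge3 z - 1)"

lemma edge_pos: "z \<in> \<Omega> \<Longrightarrow> edge1 z > 0" "z \<in> \<Omega> \<Longrightarrow> edge3 z > 0" "z \<in> \<Omega> \<Longrightarrow> edge i z > 0"
  by (auto simp: edge_def edge1_def edge3_def Omega_def)

lemma elem_cut: "elem (cut n)"
  unfolding cut_def edge1_def edge3_def by (intro elem_intros)

lemma periodic_cut: "periodic_z2 (cut n)"
  by (simp add: periodic_z2_def cut_def edge1_def edge3_def axis_def)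

lemma cut_bounds: "0 \<le> cut n z" "cut n z \<le> 1"
  by (auto simp: cut_def flat_nonneg flat_0_le_1 mult_le_one)

lemma cut_tendsto: "z \<in> \<Omega> \<Longrightarrow> (\<lambda>n. cut n z) \<longlonglongrightarrow> 1"
  using tendsto_mult[OF flat_0_tendsto flat_0_tendsto, of "edge1 z" "edge3 z"] edge_pos by (simp add: cut_def)

lemma test_function_cut:
  assumes "elem f" "periodic_z2 f"
  shows "test_function r0 r1 (\<lambda>z. cut n z * f z)"
  unfolding test_function_def
proof
  show "smooth_periodic (\<lambda>z. cut n z * f z)"
    using assms periodic_cut by (intro elem_smooth_periodic elem_mult elem_cut) (auto simp: periodic_z2_def)
  \<comment> \<open>Where the cutoff is nonzero, \<open>n\<close> times each edge function exceeds
    \<open>1\<close>, and dividing by the width bounds both distances from below.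
    \<open>Suc n\<close> in place of \<open>n\<close> keeps the margin positive for
    \<open>n = 0\<close>.\<close>
  have supp: "r0 + 1 / (Suc n * (r1 - r0)) \<le> z $ 1 \<and> z $ 1 \<le> r1 - 1 / (Suc n * (r1 - r0))
      \<and> -1 + 1 / (Suc n * 2) \<le> z $ 3 \<and> z $ 3 \<le> 1 - 1 / (Suc n * 2)" if "cut n z \<noteq> 0" for z
  proof -
    have p: "1 / (c * (b - a)) \<le> x - a \<and> 1 / (c * (b - a)) \<le> b - x"
      if "c * ((x - a) * (b - x)) > 1" "c > 0" "a < b" for a b c x :: real
    proof -
      have "(x - a) * (b - x) > 0" using that by (metis less_trans zero_less_mult_pos zero_less_one)
      then have pos: "x - a > 0" "b - x > 0" using that(3) by (auto simp: zero_less_mult_iff)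
      have "c * ((x - a) * (b - x)) \<le> c * ((x - a) * (b - a))" "c * ((x - a) * (b - x)) \<le> c * ((b - a) * (b - x))"
        using pos that by (auto intro!: mult_left_mono mult_right_mono)
      then show ?thesis using that by (simp add: field_simps)
    qed
    have 1: "real n * edge1 z > 1" "real n * edge3 z > 1"
      using that by (auto simp: cut_def flat_def split: if_splits)
    then have e: "edge1 z > 0" "edge3 z > 0" by (metis less_trans zero_less_one of_nat_0_le_iff zero_less_mult_iff linorder_not_less)+
    have "real (Suc n) * edge1 z > 1" "real (Suc n) * edge3 z > 1" using 1 e by (auto simp: algebra_simps)
    then show ?thesis using p[of "real (Suc n)" "z $ 1" r0 r1] p[of "real (Suc n)" "z $ 3" "-1" 1] r0_less
      by (auto simp: edge1_def edge3_def)
  qed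
  define \<delta> where "\<delta> = min (1 / (Suc n * (r1 - r0))) (1 / (Suc n * 2))"
  have "\<delta> > 0" using r0_less by (simp add: \<delta>_def)
  moreover have "r0 + \<delta> \<le> z $ 1 \<and> z $ 1 \<le> r1 - \<delta> \<and> -1 + \<delta> \<le> z $ 3 \<and> z $ 3 \<le> 1 - \<delta>"
    if "cut n z * f z \<noteq> 0" for z
  proof -
    have "\<delta> \<le> 1 / (Suc n * (r1 - r0))" "\<delta> \<le> 1 / (Suc n * 2)" by (simp_all add: \<delta>_def)
    moreover have "cut n z \<noteq> 0" using that by auto
    ultimately show ?thesis using supp[of z] by linarith
  qed
  ultimately show "\<exists>\<delta>>0. \<forall>z. cut n z * f z \<noteq> 0 \<longrightarrow>
      r0 + \<delta> \<le> z $ 1 \<and> z $ 1 \<le> r1 - \<delta> \<and> -1 + \<delta> \<le> z $ 3 \<and> z $ 3 \<le> 1 - \<delta>" by blast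
qed

lemma partial_cut:
  "partial 1 (cut n) z = flat 2 (real n * edge1 z - 1) * (real n * (r0 + r1 - 2 * z $ 1)) * flat 0 (real n * edge3 z - 1)"
  "partial 2 (cut n) z = 0"
  "partial 3 (cut n) z = flat 0 (real n * edge1 z - 1) * (flat 2 (real n * edge3 z - 1) * (real n * (- 2 * z $ 3)))"
proof -
  define f where "f x = flat 0 (real n * ((x - r0) * (r1 - x)) - 1)" for x
  define h where "h x = flat 0 (real n * ((x + 1) * (1 - x)) - 1)" for x
  have c: "cut n = (\<lambda>z. f (z $ 1) * 1 * h (z $ 3))" by (auto simp: cut_def f_def h_def edge1_def edge3_def)
  have d: "(flat 0 has_real_derivative flat 2 x) (at x)" for x using flat_has_derivative[of 0 x] by (simp add: numeral_2_eq_2)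
  have f: "(f has_real_derivative flat 2 (real n * ((x - r0) * (r1 - x)) - 1) * (real n * (r0 + r1 - 2 * x))) (at x)" for x
    unfolding f_def by (rule DERIV_chain2[OF d]) (auto intro!: derivative_eq_intros simp: algebra_simps)
  have h: "(h has_real_derivative flat 2 (real n * ((x + 1) * (1 - x)) - 1) * (real n * (- 2 * x))) (at x)" for x
    unfolding h_def by (rule DERIV_chain2[OF d]) (auto intro!: derivative_eq_intros simp: algebra_simps)
  note p = partial_product[where g="\<lambda>_. 1" and g'=0, OF f DERIV_const h]
  show "partial 1 (cut n) z = flat 2 (real n * edge1 z - 1) * (real n * (r0 + r1 - 2 * z $ 1)) * flat 0 (real n * edge3 z - 1)"
    "partial 2 (cut n) z = 0"
    "partial 3 (cut n) z = flat 0 (real n * edge1 z - 1) * (flat 2 (real n * edge3 z - 1) * (real n * (- 2 * z $ 3)))"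
    unfolding c p by (simp_all add: f_def h_def edge1_def edge3_def)
qed

text \<open>The bound is uniform in \<open>n\<close>, as dominated convergence requires:
  \<open>3\<close> comes from \<open>flat_2_weighted_bound\<close>, and \<open>r1 - r0 + 2\<close>
  dominates the derivatives of both edge functions.\<close>

lemma partial_cut_edge_bound:
  assumes "z \<in> \<Omega>"
  shows "\<bar>partial i (cut n) z * edge i z\<bar> \<le> 3 * (r1 - r0 + 2)"
    and "(\<lambda>n. partial i (cut n) z * edge i z) \<longlonglongrightarrow> 0"
proof -
  have z: "\<bar>r0 + r1 - 2 * z $ 1\<bar> \<le> r1 - r0" "\<bar>- 2 * z $ 3\<bar> \<le> 2" using assms by (auto simp: Omega_def)
  have b: "\<bar>a * x * c\<bar> \<le> 3 * (r1 - r0 + 2)"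
    if "\<bar>a\<bar> \<le> 1" "\<bar>x\<bar> \<le> 3" "\<bar>c\<bar> \<le> r1 - r0 + 2" for a x c :: real
  proof -
    have "\<bar>a * x * c\<bar> = \<bar>a\<bar> * (\<bar>x\<bar> * \<bar>c\<bar>)" by (simp add: abs_mult)
    also have "\<dots> \<le> 1 * (3 * (r1 - r0 + 2))" using that r0_less by (intro mult_mono) auto
    finally show ?thesis by simp
  qed
  have w: "\<bar>real n * t * flat 2 (real n * t - 1)\<bar> \<le> 3" for t
    using flat_2_weighted_bound[of "real n * t - 1"] by simp
  have f: "\<bar>flat 0 x\<bar> \<le> 1" for x using flat_0_le_1[of x] flat_nonneg[of 0 x] by simp
  let ?e1 = "edge1 z" and ?e3 = "edge3 z"
  have 1: "partial 1 (cut n) z * edge 1 z = flat 0 (real n * ?e3 - 1) * (real n * ?e1 * flat 2 (real n * ?e1 - 1)) * (r0 + r1 - 2 * z $ 1)"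
    and 3: "partial 3 (cut n) z * edge 3 z = flat 0 (real n * ?e1 - 1) * (real n * ?e3 * flat 2 (real n * ?e3 - 1)) * (- 2 * z $ 3)" for n
    by (simp_all add: partial_cut edge_def)
  have l1: "(\<lambda>n. partial 1 (cut n) z * edge 1 z) \<longlonglongrightarrow> 1 * 0 * (r0 + r1 - 2 * z $ 1)"
    and l3: "(\<lambda>n. partial 3 (cut n) z * edge 3 z) \<longlonglongrightarrow> 1 * 0 * (- 2 * z $ 3)"
    unfolding 1 3 by (intro tendsto_mult flat_0_tendsto flat_2_weighted_tendsto tendsto_const edge_pos assms)+
  show "\<bar>partial i (cut n) z * edge i z\<bar> \<le> 3 * (r1 - r0 + 2)"
    using exhaust_3[of i]
  proof (elim disjE)
    assume "i = 1" then show ?thesis using b[OF f w] z 1 r0_less by simp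
  next
    assume "i = 2" then show ?thesis using r0_less by (simp add: partial_cut)
  next
    assume "i = 3" then show ?thesis using b[OF f w] z 3 r0_less by simp
  qed
  show "(\<lambda>n. partial i (cut n) z * edge i z) \<longlonglongrightarrow> 0"
    using exhaust_3[of i] l1 l3 by (auto simp: partial_cut)
qed

lemma continuous_bounded_on_Omega:
  assumes "continuous_on UNIV (f :: real ^ 3 \<Rightarrow> real)"
  obtains B where "B > 0" "\<And>z. z \<in> \<Omega> \<Longrightarrow> \<bar>f z\<bar> \<le> B"
proof -
  have "bounded (f ` cbox (vector [r0, 0, -1]) (vector [r1, 2 * pi, 1]))"
    by (intro compact_imp_bounded compact_continuous_image continuous_on_subset[OF assms] compact_cbox) auto
  then obtain B where "B > 0" "\<And>y. y \<in> f ` cbox (vector [r0, 0, -1]) (vector [r1, 2 * pi, 1]) \<Longrightarrow> norm y \<le> B"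
    unfolding bounded_pos by blast
  moreover have "\<Omega> \<subseteq> cbox (vector [r0, 0, -1]) (vector [r1, 2 * pi, 1])" by (simp add: Omega_box box_subset_cbox)
  ultimately show thesis using that[of B] by auto
qed

lemma L2_Omega_continuous: "continuous_on UNIV f \<Longrightarrow> L2_on \<Omega> f" for f :: "real ^ 3 \<Rightarrow> 'b::euclidean_space"
  by (rule L2_on_continuous[OF Omega_sets(1) Omega_bounded])

lemma L2_Omega_integrable: "L2_on \<Omega> u \<Longrightarrow> integrable (lebesgue_on \<Omega>) u" for u :: "real ^ 3 \<Rightarrow> real"
  using L2_mult_integrable[of \<Omega> u "\<lambda>_. 1"] L2_Omega_continuous[of "\<lambda>_. 1 :: real"] by simp

lemma integral_bounded_convergence:
  fixes u :: "real ^ 3 \<Rightarrow> real"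
  assumes u: "integrable (lebesgue_on \<Omega>) u" and s: "\<And>n. continuous_on UNIV (s n)" "continuous_on UNIV f"
    and b: "\<And>n z. z \<in> \<Omega> \<Longrightarrow> \<bar>s n z\<bar> \<le> B" and l: "\<And>z. z \<in> \<Omega> \<Longrightarrow> (\<lambda>n. s n z) \<longlonglongrightarrow> f z"
  shows "(\<lambda>n. \<integral>z. u z * s n z \<partial>(lebesgue_on \<Omega>)) \<longlonglongrightarrow> (\<integral>z. u z * f z \<partial>(lebesgue_on \<Omega>))"
proof (rule integral_dominated_convergence[where w="\<lambda>z. B * \<bar>u z\<bar>"])
  have m: "g \<in> borel_measurable (lebesgue_on \<Omega>)" if "continuous_on UNIV g" for g :: "real ^ 3 \<Rightarrow> real"
    using L2_Omega_continuous[OF that] by (rule L2_on_measurable)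
  show "(\<lambda>z. u z * f z) \<in> borel_measurable (lebesgue_on \<Omega>)"
    by (rule borel_measurable_times[OF borel_measurable_integrable[OF u] m[OF s(2)]])
  show "(\<lambda>z. u z * s n z) \<in> borel_measurable (lebesgue_on \<Omega>)" for n
    by (rule borel_measurable_times[OF borel_measurable_integrable[OF u] m[OF s(1)]])
  show "integrable (lebesgue_on \<Omega>) (\<lambda>z. B * \<bar>u z\<bar>)" using u by simp
  show "AE z in lebesgue_on \<Omega>. (\<lambda>n. u z * s n z) \<longlonglongrightarrow> u z * f z"
    using l by (intro AE_I2 tendsto_mult_left) simp
  show "AE z in lebesgue_on \<Omega>. norm (u z * s n z) \<le> B * \<bar>u z\<bar>" for n
    using b by (intro AE_I2) (simp add: abs_mult mult.commute[of B] mult_left_mono)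
qed

text \<open>
  Test functions must vanish near the lateral boundary, but in the identity for the \<open>i\<close>-th derivative
  it is enough that \<open>f\<close> vanishes to first order there: the derivative of the cutoff, of order \<open>n\<close> on a
  layer of width \<open>1/n\<close>, is compensated by \<open>f\<close>.
\<close>

lemma weak_grad_vanishing_boundary:
  assumes u: "L2_on \<Omega> u" and g: "has_weak_grad r0 r1 u g" and f: "elem f" "periodic_z2 f"
    and C: "\<And>z. z \<in> \<Omega> \<Longrightarrow> \<bar>f z\<bar> \<le> C * edge i z"
  shows "(\<integral>z. u z * partial i f z \<partial>(lebesgue_on \<Omega>)) = - (\<integral>z. g z $ i * f z \<partial>(lebesgue_on \<Omega>))"
proof -
  have gi: "L2_on \<Omega> (\<lambda>z. g z $ i)" using g by (simp add: has_weak_grad_def L2_on_nth)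
  note cont = elem_continuous[OF f(1)] elem_continuous[OF elem_partial[OF f(1)], of i]
  have C0: "C \<ge> 0"
  proof -
    have "vector [(r0 + r1) / 2, pi, 0] \<in> \<Omega>" using r0_less by (simp add: Omega_def)
    from order_trans[OF abs_ge_zero C[OF this]] edge_pos(3)[OF this, of i] show ?thesis
      by (simp add: zero_le_mult_iff)
  qed
  obtain B where B: "B > 0" "\<And>z. z \<in> \<Omega> \<Longrightarrow> \<bar>f z\<bar> \<le> B" using continuous_bounded_on_Omega[OF cont(1)] by blast
  obtain B' where B': "B' > 0" "\<And>z. z \<in> \<Omega> \<Longrightarrow> \<bar>partial i f z\<bar> \<le> B'" using continuous_bounded_on_Omega[OF cont(2)] by blast
  have p: "partial i (\<lambda>z. cut n z * f z) z = cut n z * partial i f z + partial i (cut n) z * f z" for n z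
    by (rule partial_mult) (auto intro: elem_differentiable elem_cut f)
  have eq: "(\<integral>z. u z * partial i (\<lambda>z. cut n z * f z) z \<partial>(lebesgue_on \<Omega>))
      = - (\<integral>z. g z $ i * (cut n z * f z) \<partial>(lebesgue_on \<Omega>))" for n
    using g test_function_cut[OF f] by (auto simp: has_weak_grad_def)
  \<comment> \<open>The hypothesis on \<open>f\<close> trades \<open>f\<close> for
    \<open>edge i\<close>; by \<open>partial_cut_edge_bound\<close> the unwanted term of the product
    rule is then bounded in \<open>n\<close> and tends to zero pointwise.\<close>
  have small: "\<bar>partial i (cut n) z * f z\<bar> \<le> C * \<bar>partial i (cut n) z * edge i z\<bar>" if "z \<in> \<Omega>" for n z
    using mult_left_mono[OF C[OF that], of "\<bar>partial i (cut n) z\<bar>"] edge_pos(3)[OF that, of i]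
    by (simp add: abs_mult mult_ac)
  have "(\<lambda>n. \<integral>z. u z * partial i (\<lambda>z. cut n z * f z) z \<partial>(lebesgue_on \<Omega>))
      \<longlonglongrightarrow> (\<integral>z. u z * partial i f z \<partial>(lebesgue_on \<Omega>))"
  proof (rule integral_bounded_convergence[OF L2_Omega_integrable[OF u] _ cont(2)])
    show "continuous_on UNIV (partial i (\<lambda>z. cut n z * f z))" for n
      by (intro elem_continuous elem_partial elem_mult elem_cut f)
    show "\<bar>partial i (\<lambda>z. cut n z * f z) z\<bar> \<le> B' + C * (3 * (r1 - r0 + 2))" if "z \<in> \<Omega>" for n z
    proof -
      have "\<bar>cut n z * partial i f z\<bar> \<le> 1 * B'"
        unfolding abs_mult using B'(2)[OF that] cut_bounds[of n z] by (intro mult_mono) auto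
      moreover have "C * \<bar>partial i (cut n) z * edge i z\<bar> \<le> C * (3 * (r1 - r0 + 2))"
        by (intro mult_left_mono partial_cut_edge_bound that C0)
      ultimately show ?thesis unfolding p using small[OF that, of n] by linarith
    qed
    show "(\<lambda>n. partial i (\<lambda>z. cut n z * f z) z) \<longlonglongrightarrow> partial i f z" if "z \<in> \<Omega>" for z
    proof -
      have "(\<lambda>n. C * \<bar>partial i (cut n) z * edge i z\<bar>) \<longlonglongrightarrow> 0"
        by (intro tendsto_mult_right_zero tendsto_rabs_zero partial_cut_edge_bound that)
      then have "(\<lambda>n. partial i (cut n) z * f z) \<longlonglongrightarrow> 0"
        by (rule Lim_null_comparison[rotated]) (use small[OF that] in simp)
      from tendsto_add[OF tendsto_mult_right[OF cut_tendsto[OF that], of "partial i f z"] this]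
      show ?thesis unfolding p by simp
    qed
  qed
  moreover have "(\<lambda>n. \<integral>z. g z $ i * (cut n z * f z) \<partial>(lebesgue_on \<Omega>)) \<longlonglongrightarrow> (\<integral>z. g z $ i * f z \<partial>(lebesgue_on \<Omega>))"
  proof (rule integral_bounded_convergence[OF L2_Omega_integrable[OF gi] _ cont(1)])
    show "continuous_on UNIV (\<lambda>z. cut n z * f z)" for n by (intro elem_continuous elem_mult elem_cut f)
    show "\<bar>cut n z * f z\<bar> \<le> 1 * B" if "z \<in> \<Omega>" for n z
      unfolding abs_mult using B(2)[OF that] cut_bounds[of n z] by (intro mult_mono) auto
    show "(\<lambda>n. cut n z * f z) \<longlonglongrightarrow> f z" if "z \<in> \<Omega>" for z
      using tendsto_mult_right[OF cut_tendsto[OF that], of "f z"] by simp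
  qed
  then have "(\<lambda>n. \<integral>z. u z * partial i (\<lambda>z. cut n z * f z) z \<partial>(lebesgue_on \<Omega>)) \<longlonglongrightarrow> - (\<integral>z. g z $ i * f z \<partial>(lebesgue_on \<Omega>))"
    unfolding eq by (rule tendsto_minus)
  ultimately show ?thesis by (rule LIMSEQ_unique)
qed

lemma span_eigs_elem: "f \<in> span eigs \<Longrightarrow> elem f \<and> periodic_z2 f"
proof (induction rule: span_induct_alt)
  case base show ?case by (simp add: zero_fun_def elem_const periodic_z2_def)
next
  case (step c x y)
  then obtain k m \<theta> l where "x = eig k m \<theta> l" by (auto simp: eigs_def)
  then have "elem x" "periodic_z2 x" using elem_eig periodic_eig by auto
  then have "elem (\<lambda>z. c * x z + y z)" "periodic_z2 (\<lambda>z. c * x z + y z)"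
    using step by (auto intro!: elem_intros simp: periodic_z2_def)
  then show ?case by (simp add: plus_fun_def scaleR_fun_def)
qed

text \<open>A cutoff times an eigenfunction is a test function, and the cutoffs tend boundedly to
  \<open>1\<close>. So \<open>w\<close> is orthogonal to every eigenfunction and
  \<open>eigs_total\<close> applies.\<close>

lemma weak_null:
  assumes w: "L2_on \<Omega> w" and null: "\<And>f. test_function r0 r1 f \<Longrightarrow> (\<integral>z. w z * f z \<partial>(lebesgue_on \<Omega>)) = 0"
  shows "AE z in lebesgue_on \<Omega>. w z = (0::real)"
proof (rule eigs_total[OF L2_Omega_integrable[OF w]])
  fix f assume "f \<in> span eigs"
  then have f: "elem f" "periodic_z2 f" using span_eigs_elem by auto
  note cont = elem_continuous[OF f(1)]
  obtain B where B: "B > 0" "\<And>z. z \<in> \<Omega> \<Longrightarrow> \<bar>f z\<bar> \<le> B" using continuous_bounded_on_Omega[OF cont] by blast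
  have "(\<lambda>n. \<integral>z. w z * (cut n z * f z) \<partial>(lebesgue_on \<Omega>)) \<longlonglongrightarrow> (\<integral>z. w z * f z \<partial>(lebesgue_on \<Omega>))"
  proof (rule integral_bounded_convergence[OF L2_Omega_integrable[OF w] _ cont])
    show "continuous_on UNIV (\<lambda>z. cut n z * f z)" for n by (intro elem_continuous elem_mult elem_cut f)
    show "\<bar>cut n z * f z\<bar> \<le> 1 * B" if "z \<in> \<Omega>" for n z
      unfolding abs_mult using B(2)[OF that] cut_bounds[of n z] by (intro mult_mono) auto
    show "(\<lambda>n. cut n z * f z) \<longlonglongrightarrow> f z" if "z \<in> \<Omega>" for z
      using tendsto_mult_right[OF cut_tendsto[OF that], of "f z"] by simp
  qed
  then show "(\<integral>z. w z * f z \<partial>(lebesgue_on \<Omega>)) = 0"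
    using null[OF test_function_cut[OF f]] by (simp add: LIMSEQ_const_iff)
qed

lemma test_function_continuous: "test_function r0 r1 f \<Longrightarrow> continuous_on UNIV f"
  and test_function_partial_continuous: "test_function r0 r1 f \<Longrightarrow> continuous_on UNIV (partial i f)"
  using smooth_periodic_C1[of f] C1_continuous[of f] by (auto simp: test_function_def C1_def)

lemma weak_grad_unique:
  assumes "has_weak_grad r0 r1 u g" "has_weak_grad r0 r1 u h"
  shows "AE z in lebesgue_on \<Omega>. g z = h z"
proof -
  have L: "L2_on \<Omega> g" "L2_on \<Omega> h" using assms by (auto simp: has_weak_grad_def)
  have "AE z in lebesgue_on \<Omega>. g z $ i - h z $ i = 0" for i
  proof (rule weak_null)
    show "L2_on \<Omega> (\<lambda>z. g z $ i - h z $ i)" using L by (intro L2_on_diff L2_on_nth)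
    fix f assume f: "test_function r0 r1 f"
    have Lf: "L2_on \<Omega> f" using f by (intro L2_Omega_continuous test_function_continuous)
    have "(\<integral>z. g z $ i * f z \<partial>(lebesgue_on \<Omega>)) = (\<integral>z. h z $ i * f z \<partial>(lebesgue_on \<Omega>))"
      using assms f by (auto simp: has_weak_grad_def)
    then show "(\<integral>z. (g z $ i - h z $ i) * f z \<partial>(lebesgue_on \<Omega>)) = 0"
      using L2_mult_integrable[OF L2_on_nth[OF L(1)] Lf] L2_mult_integrable[OF L2_on_nth[OF L(2)] Lf]
      by (simp add: left_diff_distrib)
  qed
  then have "AE z in lebesgue_on \<Omega>. \<forall>i. g z $ i - h z $ i = 0" by (simp add: AE_all_countable)
  then show ?thesis by eventually_elim (simp add: vec_eq_iff)
qed

definition grad :: "(real ^ 3 \<Rightarrow> real) \<Rightarrow> real ^ 3 \<Rightarrow> real ^ 3" where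
  "grad v z = (\<chi> i. partial i v z)"

lemma grad_nth [simp]: "grad v z $ i = partial i v z" by (simp add: grad_def)

lemma has_weak_grad_smooth:
  assumes v: "smooth_periodic v"
  shows "has_weak_grad r0 r1 v (grad v)"
  unfolding has_weak_grad_def
proof (intro conjI allI impI)
  have C: "C1 v" by (rule smooth_periodic_C1[OF v])
  have "continuous_on UNIV (grad v)"
    using C by (auto simp: grad_def[abs_def] C1_def intro!: continuous_on_vec_lambda)
  then show "L2_on \<Omega> (grad v)" by (rule L2_Omega_continuous)
  fix f i assume f: "test_function r0 r1 f"
  have Cf: "C1 f" using f by (auto simp: test_function_def intro: smooth_periodic_C1)
  obtain \<delta> where \<delta>: "\<delta> > 0" "\<And>z. f z \<noteq> 0 \<Longrightarrow> r0 + \<delta> \<le> z $ 1 \<and> z $ 1 \<le> r1 - \<delta> \<and> -1 + \<delta> \<le> z $ 3 \<and> z $ 3 \<le> 1 - \<delta>"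
    using f by (auto simp: test_function_def)
  \<comment> \<open>The support condition removes the boundary terms on all four faces of the
    divergence theorem for \<open>v z * f z\<close>.\<close>
  have z: "f (end_pt r0 y) = 0" "f (end_pt r1 y) = 0" "f (wall_pt 1 y) = 0" "f (wall_pt (-1) y) = 0" for y
    using \<delta>(1) \<delta>(2)[of "end_pt r0 y"] \<delta>(2)[of "end_pt r1 y"] \<delta>(2)[of "wall_pt 1 y"] \<delta>(2)[of "wall_pt (-1) y"]
    by (auto simp: end_pt_def wall_pt_def split_beta)
  have "(\<integral>z. partial i (\<lambda>z. v z * f z) z \<partial>(lebesgue_on \<Omega>)) = 0"
    using exhaust_3[of i]
  proof (elim disjE)
    assume "i = 1" then show ?thesis using integral_partial_1[OF C1_mult[OF C Cf], of r0 r1] r0_less z by simp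
  next
    assume "i = 2" then show ?thesis
      using integral_partial_2[OF C1_mult[OF C Cf]] v f
      by (auto simp: smooth_periodic_def test_function_def periodic_z2_def)
  next
    assume "i = 3" then show ?thesis using integral_partial_3[OF C1_mult[OF C Cf], of r0 r1] z by simp
  qed
  moreover have "partial i (\<lambda>z. v z * f z) z = v z * partial i f z + partial i v z * f z" for z
    using C Cf by (intro partial_mult) (auto simp: C1_def)
  moreover have "integrable (lebesgue_on \<Omega>) (\<lambda>z. v z * partial i f z)" "integrable (lebesgue_on \<Omega>) (\<lambda>z. partial i v z * f z)"
    using C Cf C1_continuous[OF C] C1_continuous[OF Cf]
    by (auto simp: C1_def intro!: integrable_on_continuous Omega_bounded continuous_intros)
  ultimately show "(\<integral>z. v z * partial i f z \<partial>(lebesgue_on \<Omega>)) = - (\<integral>z. grad v z $ i * f z \<partial>(lebesgue_on \<Omega>))"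
    by simp
qed

end

section \<open>The Sobolev space\<close>

lemma L2_ip_AE_cong:
  assumes "AE x in lebesgue_on S. f x = f' x" "AE x in lebesgue_on S. g x = g' x"
    "L2_on S f" "L2_on S f'" "L2_on S g" "L2_on S g'"
  shows "L2_ip S f g = L2_ip S f' g'"
  unfolding L2_ip_def
proof (rule integral_cong_AE)
  show "(\<lambda>x. f x \<bullet> g x) \<in> borel_measurable (lebesgue_on S)" "(\<lambda>x. f' x \<bullet> g' x) \<in> borel_measurable (lebesgue_on S)"
    by (intro borel_measurable_integrable L2_inner_integrable assms)+
  show "AE x in lebesgue_on S. f x \<bullet> g x = f' x \<bullet> g' x" using assms(1,2) by eventually_elim simp
qed

text \<open>\<open>J\<close> sends a function to its derivatives and is linear only almost
  everywhere. Completeness of \<open>V\<close> follows from that of L2 once every limit of images is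
  an image up to a null set. This serves both \<open>H1\<close> and the space of admissible
  pairs.\<close>

lemma semi_hilbert_pullback:
  fixes V :: "'v::real_vector set" and J :: "'v \<Rightarrow> 'a::euclidean_space \<Rightarrow> 'b::euclidean_space"
  assumes V: "subspace V" and J: "\<And>u. u \<in> V \<Longrightarrow> L2_on S (J u)"
    and add: "\<And>u v. \<lbrakk>u \<in> V; v \<in> V\<rbrakk> \<Longrightarrow> AE x in lebesgue_on S. J (u + v) x = J u x + J v x"
    and scale: "\<And>a u. u \<in> V \<Longrightarrow> AE x in lebesgue_on S. J (a *\<^sub>R u) x = a *\<^sub>R J u x"
    and closed: "\<And>X L. \<lbrakk>\<forall>n. X n \<in> V; L2_on S L; (\<lambda>n. L2_norm S (\<lambda>x. J (X n) x - L x)) \<longlonglongrightarrow> 0\<rbrakk>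
        \<Longrightarrow> \<exists>u\<in>V. AE x in lebesgue_on S. J u x = L x"
  shows "semi_hilbert V (\<lambda>u v. L2_ip S (J u) (J v))"
proof -
  have cl: "u + v \<in> V" "a *\<^sub>R u \<in> V" "u - v \<in> V" if "u \<in> V" "v \<in> V" for a u v
    using V that by (auto simp: subspace_add subspace_scale subspace_diff)
  have diff: "AE x in lebesgue_on S. J (u - v) x = J u x - J v x" if "u \<in> V" "v \<in> V" for u v
    using add[OF cl(3)[OF that] that(2)] by eventually_elim simp
  have Jadd: "L2_ip S (J (u + v)) (J w) = L2_ip S (J u + J v) (J w)" if "u \<in> V" "v \<in> V" "w \<in> V" for u v w
    by (rule L2_ip_AE_cong) (use that add[of u v] cl J in \<open>auto simp: plus_fun_def L2_on_add\<close>)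
  have Jscale: "L2_ip S (J (a *\<^sub>R u)) (J w) = L2_ip S (a *\<^sub>R J u) (J w)" if "u \<in> V" "w \<in> V" for a u w
    by (rule L2_ip_AE_cong) (use that scale[of u a] cl J in \<open>auto simp: scaleR_fun_def L2_on_scaleR\<close>)
  interpret semi_inner V "\<lambda>u v. L2_ip S (J u) (J v)"
  proof
    fix u v w assume "u \<in> V" "v \<in> V" "w \<in> V"
    then show "L2_ip S (J (u + v)) (J w) = L2_ip S (J u) (J w) + L2_ip S (J v) (J w)"
      unfolding Jadd[OF \<open>u \<in> V\<close> \<open>v \<in> V\<close> \<open>w \<in> V\<close>] by (intro L2.ip_add_left) (auto simp: J)
  next
    fix a u w assume "u \<in> V" "w \<in> V"
    then show "L2_ip S (J (a *\<^sub>R u)) (J w) = a * L2_ip S (J u) (J w)"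
      unfolding Jscale[OF \<open>u \<in> V\<close> \<open>w \<in> V\<close>] by (intro L2.ip_scaleR_left) (auto simp: J)
  next
    fix u v assume "u \<in> V" "v \<in> V"
    then show "L2_ip S (J u) (J v) = L2_ip S (J v) (J u)" by (intro L2.ip_sym) (auto simp: J)
  next
    fix u assume "u \<in> V"
    then show "0 \<le> L2_ip S (J u) (J u)" by (intro L2.ip_ge_0) (auto simp: J)
  qed (rule V)
  have nrm: "nrm u = L2_norm S (J u)" for u by (simp add: nrm_def L2.nrm_def flip: L2_nrm_eq)
  have nd: "nrm (u - v) = L2_norm S (\<lambda>x. J u x - J v x)" if "u \<in> V" "v \<in> V" for u v
    unfolding nrm by (rule L2_norm_AE_cong[OF diff[OF that]])
      (use that cl in \<open>auto intro!: L2_on_measurable L2_on_diff J\<close>)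
  show ?thesis
  proof unfold_locales
    fix X :: "nat \<Rightarrow> 'v" assume X: "\<forall>n. X n \<in> V" and C: "\<forall>e>0. \<exists>N. \<forall>m\<ge>N. \<forall>n\<ge>N. nrm (X m - X n) < e"
    obtain L where L: "L2_on S L" "(\<lambda>n. L2_norm S (\<lambda>x. J (X n) x - L x)) \<longlonglongrightarrow> 0"
      using L2_complete[of S "\<lambda>n. J (X n)"] X C nd J by auto
    obtain u where u: "u \<in> V" "AE x in lebesgue_on S. J u x = L x" using closed[OF X L] by blast
    have "nrm (X n - u) = L2_norm S (\<lambda>x. J (X n) x - L x)" for n
      unfolding nd[OF X[rule_format] u(1)]
      by (rule L2_norm_AE_cong) (use u X L J in \<open>auto intro!: L2_on_measurable L2_on_diff\<close>)
    then have "(\<lambda>n. nrm (X n - u)) \<longlonglongrightarrow> 0" using L(2) by presburger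
    then show "\<exists>u\<in>V. (\<lambda>n. nrm (X n - u)) \<longlonglongrightarrow> 0" using u(1) by blast
  qed
qed

lemma L2_norm_fst_le: "L2_on S (\<lambda>x. (f x, g x)) \<Longrightarrow> L2_norm S f \<le> L2_norm S (\<lambda>x. (f x, g x))"
  and L2_norm_snd_le: "L2_on S (\<lambda>x. (f x, g x)) \<Longrightarrow> L2_norm S g \<le> L2_norm S (\<lambda>x. (f x, g x))"
  by (rule power2_le_imp_le; simp add: L2_norm_Pair_sq L2_on_Pair_iff)+

section \<open>Jets and completeness of the Sobolev space\<close>

context strip
begin

lemma L2_test_integrable:
  assumes "L2_on \<Omega> u" "test_function r0 r1 f"
  shows "integrable (lebesgue_on \<Omega>) (\<lambda>z. u z * f z)" "integrable (lebesgue_on \<Omega>) (\<lambda>z. u z * partial i f z)"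
  using assms test_function_continuous test_function_partial_continuous
  by (auto intro!: L2_mult_integrable L2_Omega_continuous)

lemma has_weak_grad_add:
  assumes "L2_on \<Omega> u" "L2_on \<Omega> v" "has_weak_grad r0 r1 u g" "has_weak_grad r0 r1 v h"
  shows "has_weak_grad r0 r1 (\<lambda>z. u z + v z) (\<lambda>z. g z + h z)"
  unfolding has_weak_grad_def
proof (intro conjI allI impI)
  have L: "L2_on \<Omega> g" "L2_on \<Omega> h" using assms by (auto simp: has_weak_grad_def)
  then show "L2_on \<Omega> (\<lambda>z. g z + h z)" by (rule L2_on_add)
  fix f i assume f: "test_function r0 r1 f"
  show "(\<integral>z. (u z + v z) * partial i f z \<partial>(lebesgue_on \<Omega>)) = - (\<integral>z. (g z + h z) $ i * f z \<partial>(lebesgue_on \<Omega>))"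
    using assms f L2_test_integrable[OF assms(1) f] L2_test_integrable[OF assms(2) f]
      L2_test_integrable[OF L2_on_nth[OF L(1)] f] L2_test_integrable[OF L2_on_nth[OF L(2)] f]
    by (simp add: distrib_right has_weak_grad_def)
qed

lemma has_weak_grad_scaleR:
  assumes "has_weak_grad r0 r1 u g"
  shows "has_weak_grad r0 r1 (\<lambda>z. a * u z) (\<lambda>z. a *\<^sub>R g z)"
  using assms by (simp add: has_weak_grad_def L2_on_scaleR mult.assoc)

lemma H1_D:
  assumes "u \<in> H1 r0 r1"
  shows "L2_on \<Omega> u" "has_weak_grad r0 r1 u (wgrad r0 r1 u)" "L2_on \<Omega> (wgrad r0 r1 u)" "periodic_z2 u"
proof -
  obtain g where "has_weak_grad r0 r1 u g" using assms by (auto simp: H1_def)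
  then show w: "has_weak_grad r0 r1 u (wgrad r0 r1 u)" unfolding wgrad_def by (rule someI[where P="has_weak_grad r0 r1 u"])
  then show "L2_on \<Omega> (wgrad r0 r1 u)" by (simp add: has_weak_grad_def)
qed (use assms in \<open>auto simp: H1_def\<close>)

lemma wgrad_AE: "\<lbrakk>u \<in> H1 r0 r1; has_weak_grad r0 r1 u g\<rbrakk> \<Longrightarrow> AE z in lebesgue_on \<Omega>. wgrad r0 r1 u z = g z"
  by (rule weak_grad_unique[OF H1_D(2)])

lemma subspace_H1: "subspace (H1 r0 r1)"
proof (rule subspaceI)
  have "has_weak_grad r0 r1 (\<lambda>z. 0) (\<lambda>z. 0)" by (simp add: has_weak_grad_def)
  then show "0 \<in> H1 r0 r1" by (auto simp: H1_def zero_fun_def periodic_z2_def)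
next
  fix u v assume u: "u \<in> H1 r0 r1" and v: "v \<in> H1 r0 r1"
  have "has_weak_grad r0 r1 (u + v) (\<lambda>z. wgrad r0 r1 u z + wgrad r0 r1 v z)"
    using has_weak_grad_add[OF H1_D(1)[OF u] H1_D(1)[OF v] H1_D(2)[OF u] H1_D(2)[OF v]] by (simp add: plus_fun_def)
  moreover have "L2_on \<Omega> (u + v)" unfolding plus_fun_def by (rule L2_on_add[OF H1_D(1)[OF u] H1_D(1)[OF v]])
  ultimately show "u + v \<in> H1 r0 r1"
    using H1_D(4)[OF u] H1_D(4)[OF v] by (auto simp: H1_def periodic_z2_def)
next
  fix c u assume u: "u \<in> H1 r0 r1"
  have "has_weak_grad r0 r1 (c *\<^sub>R u) (\<lambda>z. c *\<^sub>R wgrad r0 r1 u z)"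
    using has_weak_grad_scaleR[OF H1_D(2)[OF u]] by (simp add: scaleR_fun_def)
  moreover have "L2_on \<Omega> (c *\<^sub>R u)" unfolding scaleR_fun_def by (rule L2_on_scaleR[OF H1_D(1)[OF u]])
  ultimately show "c *\<^sub>R u \<in> H1 r0 r1"
    using H1_D(4)[OF u] by (auto simp: H1_def periodic_z2_def)
qed

definition jet :: "(real ^ 3 \<Rightarrow> real) \<Rightarrow> real ^ 3 \<Rightarrow> real \<times> (real ^ 3)" where
  "jet u z = (u z, wgrad r0 r1 u z)"

lemma L2_jet: "u \<in> H1 r0 r1 \<Longrightarrow> L2_on \<Omega> (jet u)"
  unfolding jet_def by (simp add: L2_on_Pair_iff H1_D)

lemma L2_norm_jet: "u \<in> H1 r0 r1 \<Longrightarrow> L2_norm \<Omega> (jet u) = H1_norm r0 r1 u"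
  unfolding H1_norm_def jet_def by (simp add: real_sqrt_unique H1_D flip: L2_norm_Pair_sq)

lemma jet_add:
  assumes u: "u \<in> H1 r0 r1" and v: "v \<in> H1 r0 r1"
  shows "AE z in lebesgue_on \<Omega>. jet (u + v) z = jet u z + jet v z"
proof -
  have "u + v \<in> H1 r0 r1" using u v by (rule subspace_add[OF subspace_H1])
  moreover have "has_weak_grad r0 r1 (u + v) (\<lambda>z. wgrad r0 r1 u z + wgrad r0 r1 v z)"
    using has_weak_grad_add[OF H1_D(1)[OF u] H1_D(1)[OF v] H1_D(2)[OF u] H1_D(2)[OF v]] by (simp add: plus_fun_def)
  ultimately have "AE z in lebesgue_on \<Omega>. wgrad r0 r1 (u + v) z = wgrad r0 r1 u z + wgrad r0 r1 v z"
    by (rule wgrad_AE)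
  then show ?thesis by eventually_elim (simp add: jet_def)
qed

lemma jet_scaleR:
  assumes u: "u \<in> H1 r0 r1"
  shows "AE z in lebesgue_on \<Omega>. jet (c *\<^sub>R u) z = c *\<^sub>R jet u z"
proof -
  have "c *\<^sub>R u \<in> H1 r0 r1" using u by (rule subspace_scale[OF subspace_H1])
  moreover have "has_weak_grad r0 r1 (c *\<^sub>R u) (\<lambda>z. c *\<^sub>R wgrad r0 r1 u z)"
    using has_weak_grad_scaleR[OF H1_D(2)[OF u]] by (simp add: scaleR_fun_def)
  ultimately have "AE z in lebesgue_on \<Omega>. wgrad r0 r1 (c *\<^sub>R u) z = c *\<^sub>R wgrad r0 r1 u z"
    by (rule wgrad_AE)
  then show ?thesis by eventually_elim (simp add: jet_def)
qed

lemma periodic_extension: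
  fixes f :: "real ^ 3 \<Rightarrow> real"
  obtains u where "periodic_z2 u" "\<And>z. z \<in> \<Omega> \<Longrightarrow> u z = f z"
proof
  define u where "u z = f (z - axis 2 (2 * pi * \<lfloor>z $ 2 / (2 * pi)\<rfloor>))" for z
  have "u (z + axis 2 (2 * pi)) = u z" for z
  proof -
    have "\<lfloor>(z + axis 2 (2 * pi)) $ 2 / (2 * pi)\<rfloor> = \<lfloor>z $ 2 / (2 * pi)\<rfloor> + 1"
      by (simp add: axis_def add_divide_distrib)
    then have "z + axis 2 (2 * pi) - axis 2 (2 * pi * \<lfloor>(z + axis 2 (2 * pi)) $ 2 / (2 * pi)\<rfloor>)
        = z - axis 2 (2 * pi * \<lfloor>z $ 2 / (2 * pi)\<rfloor>)"
      by (simp add: vec_eq_iff axis_def algebra_simps)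
    then show ?thesis unfolding u_def by (rule arg_cong)
  qed
  then show "periodic_z2 u" by (simp add: periodic_z2_def)
  show "u z = f z" if "z \<in> \<Omega>" for z
  proof -
    have "\<lfloor>z $ 2 / (2 * pi)\<rfloor> = 0" using that by (simp add: floor_eq_iff Omega_def)
    then have "z - axis 2 (2 * pi * \<lfloor>z $ 2 / (2 * pi)\<rfloor>) = z" by (simp add: vec_eq_iff axis_def)
    then show ?thesis unfolding u_def by (rule arg_cong)
  qed
qed

text \<open>A limit in \<open>L2\<close> is only known on the fundamental cell; its values elsewhere are reset by periodicity.\<close>

lemma H1_jet_closed:
  fixes L :: "real ^ 3 \<Rightarrow> real \<times> (real ^ 3)"
  assumes X: "\<forall>n. X n \<in> H1 r0 r1" and L: "L2_on \<Omega> L" "(\<lambda>n. L2_norm \<Omega> (\<lambda>z. jet (X n) z - L z)) \<longlonglongrightarrow> 0"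
  shows "\<exists>u\<in>H1 r0 r1. AE z in lebesgue_on \<Omega>. jet u z = L z"
proof -
  define f g where "f = (\<lambda>z. fst (L z))" and "g = (\<lambda>z. snd (L z))"
  have L': "L = (\<lambda>z. (f z, g z))" by (simp add: f_def g_def)
  have fg: "L2_on \<Omega> f" "L2_on \<Omega> g" using L(1) unfolding L' L2_on_Pair_iff by auto
  have d: "(\<lambda>z. jet (X n) z - L z) = (\<lambda>z. (X n z - f z, wgrad r0 r1 (X n) z - g z))" for n
    by (simp add: jet_def L')
  have Ld: "L2_on \<Omega> (\<lambda>z. (X n z - f z, wgrad r0 r1 (X n) z - g z))" for n
    using X fg by (auto simp: L2_on_Pair_iff H1_D intro!: L2_on_diff)
  have lf: "(\<lambda>n. L2_norm \<Omega> (\<lambda>z. X n z - f z)) \<longlonglongrightarrow> 0"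
    by (rule Lim_null_comparison[OF _ L(2)]) (use L2_norm_fst_le[OF Ld] in \<open>auto simp: d\<close>)
  have lg: "(\<lambda>n. L2_norm \<Omega> (\<lambda>z. wgrad r0 r1 (X n) z - g z)) \<longlonglongrightarrow> 0"
    by (rule Lim_null_comparison[OF _ L(2)]) (use L2_norm_snd_le[OF Ld] in \<open>auto simp: d\<close>)
  obtain u where u: "periodic_z2 u" "\<And>z. z \<in> \<Omega> \<Longrightarrow> u z = f z"
    using periodic_extension[of f] by blast
  have uf: "(\<integral>z. u z * h z \<partial>(lebesgue_on \<Omega>)) = (\<integral>z. f z * h z \<partial>(lebesgue_on \<Omega>))" for h
    by (rule Bochner_Integration.integral_cong) (auto simp: u)
  have "has_weak_grad r0 r1 u g"
    unfolding has_weak_grad_def uf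
  proof (intro conjI allI impI fg)
    fix t i assume t: "test_function r0 r1 t"
    \<comment> \<open>Multiplying \<open>t\<close> by the unit vector \<open>axis i 1\<close> turns
      the pairing with the \<open>i\<close>-th component into an inner product of vector fields, to
      which L2 convergence applies.\<close>
    have Lt: "L2_on \<Omega> (partial i t)" "L2_on \<Omega> (\<lambda>z. t z *\<^sub>R axis i (1::real))"
      using t by (auto intro!: L2_Omega_continuous continuous_intros test_function_continuous test_function_partial_continuous)
    have "(\<lambda>n. \<integral>z. X n z * partial i t z \<partial>(lebesgue_on \<Omega>)) \<longlonglongrightarrow> (\<integral>z. f z * partial i t z \<partial>(lebesgue_on \<Omega>))"
      using L2_integral_tendsto[OF H1_D(1)[OF X[rule_format]] fg(1) Lt(1) lf] by simp
    moreover have "(\<lambda>n. - (\<integral>z. wgrad r0 r1 (X n) z $ i * t z \<partial>(lebesgue_on \<Omega>))) \<longlonglongrightarrow> - (\<integral>z. g z $ i * t z \<partial>(lebesgue_on \<Omega>))"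
      using tendsto_minus[OF L2_integral_tendsto[OF H1_D(3)[OF X[rule_format]] fg(2) Lt(2) lg]]
      by (simp add: inner_axis mult.commute)
    moreover have "(\<integral>z. X n z * partial i t z \<partial>(lebesgue_on \<Omega>)) = - (\<integral>z. wgrad r0 r1 (X n) z $ i * t z \<partial>(lebesgue_on \<Omega>))" for n
      using H1_D(2)[OF X[rule_format, of n]] t by (simp add: has_weak_grad_def)
    ultimately show "(\<integral>z. f z * partial i t z \<partial>(lebesgue_on \<Omega>)) = - (\<integral>z. g z $ i * t z \<partial>(lebesgue_on \<Omega>))"
      using LIMSEQ_unique by auto
  qed
  moreover have "L2_on \<Omega> u"
  proof -
    have "L2_on \<Omega> u \<longleftrightarrow> L2_on \<Omega> f" unfolding L2_on_def
      by (intro conj_cong measurable_cong Bochner_Integration.integrable_cong) (auto simp: u)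
    then show ?thesis using fg by simp
  qed
  ultimately have uH: "u \<in> H1 r0 r1" "has_weak_grad r0 r1 u g" using u(1) by (auto simp: H1_def)
  have "AE z in lebesgue_on \<Omega>. z \<in> \<Omega>" by (intro AE_I2) simp
  then have "AE z in lebesgue_on \<Omega>. jet u z = L z"
    using wgrad_AE[OF uH] by eventually_elim (auto simp: jet_def L' u)
  then show ?thesis using uH by blast
qed

definition H1_ip :: "(real ^ 3 \<Rightarrow> real) \<Rightarrow> (real ^ 3 \<Rightarrow> real) \<Rightarrow> real" where
  "H1_ip u v = L2_ip \<Omega> (jet u) (jet v)"

sublocale H1: semi_hilbert "H1 r0 r1" H1_ip
  unfolding H1_ip_def[abs_def]
  by (rule semi_hilbert_pullback[OF subspace_H1 L2_jet jet_add jet_scaleR H1_jet_closed])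

lemma H1_nrm_eq: "u \<in> H1 r0 r1 \<Longrightarrow> H1.nrm u = H1_norm r0 r1 u"
  unfolding H1.nrm_def H1_ip_def L2_norm_jet[symmetric] by (simp add: L2.nrm_def flip: L2_nrm_eq)

lemma smooth_periodic_H1: "smooth_periodic v \<Longrightarrow> v \<in> H1 r0 r1"
  using has_weak_grad_smooth[of v] C1_continuous[OF smooth_periodic_C1, of v]
  by (auto simp: H1_def smooth_periodic_def intro!: L2_Omega_continuous)

lemma wgrad_smooth: "smooth_periodic v \<Longrightarrow> AE z in lebesgue_on \<Omega>. wgrad r0 r1 v z = grad v z"
  by (rule wgrad_AE[OF smooth_periodic_H1 has_weak_grad_smooth])

lemma L2_grad: "smooth_periodic v \<Longrightarrow> L2_on \<Omega> (grad v)"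
  using has_weak_grad_smooth by (auto simp: has_weak_grad_def)

section \<open>Green's formula and density of the eigenfunctions\<close>

definition lam :: "int \<Rightarrow> int \<Rightarrow> int \<Rightarrow> real" where
  "lam k m l = (\<Sum>i\<in>UNIV. (freq k m l i)\<^sup>2)"

text \<open>The \<open>i\<close>-th derivative contains a sine that vanishes on the two faces normal
  to direction \<open>i\<close>, and the other trigonometric factors are at most \<open>1\<close>.
  In the circle direction boundedness is enough.\<close>

lemma partial_eig_edge: "\<exists>C. \<forall>z\<in>\<Omega>. \<bar>partial i (eig k m \<theta> l) z\<bar> \<le> C * edge i z"
  using exhaust_3[of i]
proof (elim disjE)
  assume i: "i = 1"
  define C where "C = \<bar>k * \<kappa>\<bar> * (2 * \<bar>k\<bar> * pi / (r1 - r0)\<^sup>2)"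
  have "\<bar>partial 1 (eig k m \<theta> l) z\<bar> \<le> C * edge 1 z" if z: "z \<in> \<Omega>" for z
  proof -
    have "\<bar>sin (k * (pi / (r1 - r0)) * (z $ 1 - r0))\<bar> \<le> (2 * \<bar>k\<bar> * pi / (r1 - r0)\<^sup>2) * ((z $ 1 - r0) * ((r1 - r0) - (z $ 1 - r0)))"
      by (rule sin_multiple_bound) (use z r0_less in \<open>auto simp: Omega_def\<close>)
    then have s: "\<bar>sin (k * \<kappa> * (z $ 1 - r0))\<bar> \<le> (2 * \<bar>k\<bar> * pi / (r1 - r0)\<^sup>2) * edge 1 z"
      by (simp add: \<kappa>_def edge_def edge1_def)
    have "\<bar>partial 1 (eig k m \<theta> l) z\<bar> = \<bar>k * \<kappa>\<bar> * \<bar>sin (k * \<kappa> * (z $ 1 - r0))\<bar>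
        * (\<bar>cos (m * z $ 2 + \<theta>)\<bar> * \<bar>cos (l * (pi / 2) * (z $ 3 + 1))\<bar>)"
      by (simp add: partial_eig abs_mult)
    also have "\<dots> \<le> \<bar>k * \<kappa>\<bar> * \<bar>sin (k * \<kappa> * (z $ 1 - r0))\<bar> * 1"
      by (intro mult_left_mono mult_le_one) auto
    also have "\<dots> = \<bar>k * \<kappa>\<bar> * \<bar>sin (k * \<kappa> * (z $ 1 - r0))\<bar>" by simp
    also have "\<dots> \<le> \<bar>k * \<kappa>\<bar> * ((2 * \<bar>k\<bar> * pi / (r1 - r0)\<^sup>2) * edge 1 z)"
      by (rule mult_left_mono[OF s, of "\<bar>k * \<kappa>\<bar>"]) simp
    finally show ?thesis by (simp add: C_def)
  qed
  then show ?thesis using i by blast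
next
  assume i: "i = 2"
  have "continuous_on UNIV (partial 2 (eig k m \<theta> l))" by (intro elem_continuous elem_partial elem_eig)
  from continuous_bounded_on_Omega[OF this] obtain B where "\<And>z. z \<in> \<Omega> \<Longrightarrow> \<bar>partial 2 (eig k m \<theta> l) z\<bar> \<le> B" by blast
  then show ?thesis using i by (auto simp: edge_def intro!: exI[of _ B])
next
  assume i: "i = 3"
  define C where "C = \<bar>l * (pi / 2)\<bar> * (2 * \<bar>l\<bar> * pi / 2\<^sup>2)"
  have "\<bar>partial 3 (eig k m \<theta> l) z\<bar> \<le> C * edge 3 z" if z: "z \<in> \<Omega>" for z
  proof -
    have s: "\<bar>sin (l * (pi / 2) * (z $ 3 + 1))\<bar> \<le> (2 * \<bar>l\<bar> * pi / 2\<^sup>2) * ((z $ 3 + 1) * (2 - (z $ 3 + 1)))"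
      by (rule sin_multiple_bound) (use z in \<open>auto simp: Omega_def\<close>)
    have "\<bar>partial 3 (eig k m \<theta> l) z\<bar> = \<bar>l * (pi / 2)\<bar> * \<bar>sin (l * (pi / 2) * (z $ 3 + 1))\<bar>
        * (\<bar>cos (k * \<kappa> * (z $ 1 - r0))\<bar> * \<bar>cos (m * z $ 2 + \<theta>)\<bar>)"
      by (simp add: partial_eig abs_mult)
    also have "\<dots> \<le> \<bar>l * (pi / 2)\<bar> * \<bar>sin (l * (pi / 2) * (z $ 3 + 1))\<bar> * 1"
      by (intro mult_left_mono mult_le_one) auto
    also have "\<dots> \<le> \<bar>l * (pi / 2)\<bar> * ((2 * \<bar>l\<bar> * pi / 2\<^sup>2) * edge 3 z)"
      using mult_left_mono[OF s, of "\<bar>l * (pi / 2)\<bar>"] by (simp add: edge_def edge3_def)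
    finally show ?thesis by (simp add: C_def)
  qed
  then show ?thesis using i by blast
qed

text \<open>\<open>weak_grad_vanishing_boundary\<close> is applied to the partial derivatives of the
  eigenfunction, which qualify by \<open>partial_eig_edge\<close>; differentiating once more returns
  a multiple of the eigenfunction. No boundary integral arises, although \<open>u\<close> itself is
  unrestricted at the faces.\<close>

lemma green_eig:
  assumes u: "u \<in> H1 r0 r1"
  shows "(\<integral>z. wgrad r0 r1 u z \<bullet> grad (eig k m \<theta> l) z \<partial>(lebesgue_on \<Omega>)) =
    lam k m l * (\<integral>z. u z * eig k m \<theta> l z \<partial>(lebesgue_on \<Omega>))"
proof -
  let ?e = "eig k m \<theta> l"
  have L: "L2_on \<Omega> (partial i ?e)" for i by (intro L2_Omega_continuous elem_continuous elem_partial elem_eig)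
  have per: "periodic_z2 (partial i ?e)" for i
  proof -
    have p: "periodic_z2 f \<Longrightarrow> (\<And>z. f differentiable (at z)) \<Longrightarrow> periodic_z2 (partial i f)" for f
      unfolding periodic_z2_def
    proof
      fix z assume f: "\<forall>z. f (z + axis 2 (2 * pi)) = f z" and d: "\<And>z. f differentiable (at z)"
      have "((\<lambda>x. f (x + axis 2 (2 * pi))) has_derivative (\<lambda>h. \<Sum>i\<in>UNIV. h $ i * partial i f (z + axis 2 (2 * pi)))) (at z)"
      proof (rule has_derivative_compose[OF _ has_derivative_partial[OF d]])
        show "((\<lambda>x. x + axis 2 (2 * pi)) has_derivative (\<lambda>h. h)) (at z)" by (auto intro!: derivative_eq_intros)
      qed
      then have "(f has_derivative (\<lambda>h. \<Sum>i\<in>UNIV. h $ i * partial i f (z + axis 2 (2 * pi)))) (at z)" using f by simp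
      then show "partial i f (z + axis 2 (2 * pi)) = partial i f z" by (rule partial_eqI[symmetric])
    qed
    show ?thesis by (intro p periodic_eig elem_differentiable elem_eig)
  qed
  have "(\<integral>z. wgrad r0 r1 u z \<bullet> grad ?e z \<partial>(lebesgue_on \<Omega>)) = (\<Sum>i\<in>UNIV. \<integral>z. wgrad r0 r1 u z $ i * partial i ?e z \<partial>(lebesgue_on \<Omega>))"
    unfolding inner_vec_def grad_nth inner_real_def
    by (rule Bochner_Integration.integral_sum) (intro L2_mult_integrable L2_on_nth H1_D(3) u L)
  also have "\<dots> = (\<Sum>i\<in>UNIV. (freq k m l i)\<^sup>2 * (\<integral>z. u z * ?e z \<partial>(lebesgue_on \<Omega>)))"
  proof (rule sum.cong[OF refl])
    fix i
    obtain C where "\<And>z. z \<in> \<Omega> \<Longrightarrow> \<bar>partial i ?e z\<bar> \<le> C * edge i z" using partial_eig_edge by blast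
    from weak_grad_vanishing_boundary[OF H1_D(1,2)[OF u] elem_partial[OF elem_eig] per this]
    have "(\<integral>z. wgrad r0 r1 u z $ i * partial i ?e z \<partial>(lebesgue_on \<Omega>)) = - (\<integral>z. - ((freq k m l i)\<^sup>2 * (u z * ?e z)) \<partial>(lebesgue_on \<Omega>))"
      by (simp add: partial_partial_eig mult_ac)
    then show "(\<integral>z. wgrad r0 r1 u z $ i * partial i ?e z \<partial>(lebesgue_on \<Omega>)) = (freq k m l i)\<^sup>2 * (\<integral>z. u z * ?e z \<partial>(lebesgue_on \<Omega>))"
      by simp
  qed
  finally show ?thesis by (simp add: lam_def sum_distrib_right)
qed

lemma H1_ip_smooth:
  assumes "u \<in> H1 r0 r1" "smooth_periodic v"
  shows "H1_ip u v = (\<integral>z. u z * v z \<partial>(lebesgue_on \<Omega>)) + (\<integral>z. wgrad r0 r1 u z \<bullet> grad v z \<partial>(lebesgue_on \<Omega>))"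
proof -
  note v = smooth_periodic_H1[OF assms(2)]
  have L: "L2_on \<Omega> v" using v by (rule H1_D)
  have "H1_ip u v = L2_ip \<Omega> (jet u) (\<lambda>z. (v z, grad v z))" unfolding H1_ip_def
  proof (rule L2_ip_AE_cong)
    show "AE z in lebesgue_on \<Omega>. jet v z = (v z, grad v z)"
      using wgrad_smooth[OF assms(2)] by eventually_elim (simp add: jet_def)
    show "L2_on \<Omega> (\<lambda>z. (v z, grad v z))" using L L2_grad[OF assms(2)] by (simp add: L2_on_Pair_iff)
  qed (use L2_jet[OF v] L2_jet[OF assms(1)] in simp_all)
  also have "\<dots> = (\<integral>z. u z * v z + wgrad r0 r1 u z \<bullet> grad v z \<partial>(lebesgue_on \<Omega>))"
    by (simp add: L2_ip_def jet_def inner_Pair)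
  also have "\<dots> = (\<integral>z. u z * v z \<partial>(lebesgue_on \<Omega>)) + (\<integral>z. wgrad r0 r1 u z \<bullet> grad v z \<partial>(lebesgue_on \<Omega>))"
    by (intro Bochner_Integration.integral_add L2_mult_integrable[OF H1_D(1)[OF assms(1)] L]
        L2_inner_integrable[OF H1_D(3)[OF assms(1)] L2_grad[OF assms(2)]])
  finally show ?thesis .
qed

lemma span_eigs_smooth: "f \<in> span eigs \<Longrightarrow> smooth_periodic f"
  using span_eigs_elem elem_smooth_periodic by blast

lemma lam_nonneg: "0 \<le> lam k m l" by (simp add: lam_def sum_nonneg)

lemma span_eigs_dense:
  assumes u: "u \<in> H1 r0 r1"
  obtains Y where "\<forall>n. Y n \<in> span eigs" "(\<lambda>n. H1.nrm (Y n - u)) \<longlonglongrightarrow> 0"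
proof (rule H1.dense_if_orthogonal_trivial[OF subspace_span _ u])
  show "span eigs \<subseteq> H1 r0 r1" using span_eigs_smooth smooth_periodic_H1 by blast
  fix w assume w: "w \<in> H1 r0 r1" and orth: "\<forall>y\<in>span eigs. H1_ip w y = 0"
  have "L2_on \<Omega> f \<and> (\<integral>z. w z * f z \<partial>(lebesgue_on \<Omega>)) = 0" if "f \<in> span eigs" for f
    using that
  proof (induction rule: span_induct_alt)
    case base show ?case by (simp add: zero_fun_def)
  next
    case (step c x y)
    then obtain k m \<theta> l where x: "x = eig k m \<theta> l" by (auto simp: eigs_def)
    have "0 = H1_ip w x" using orth eig_mem by (simp add: x)
    also have "\<dots> = (1 + lam k m l) * (\<integral>z. w z * x z \<partial>(lebesgue_on \<Omega>))"
      using green_eig[OF w] by (simp add: x H1_ip_smooth[OF w smooth_periodic_eig] algebra_simps)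
    finally have x0: "(\<integral>z. w z * x z \<partial>(lebesgue_on \<Omega>)) = 0" using lam_nonneg[of k m l] by simp
    have L: "L2_on \<Omega> x" "L2_on \<Omega> y"
      using step H1_D(1)[OF smooth_periodic_H1[OF smooth_periodic_eig]] by (simp_all add: x)
    then have "integrable (lebesgue_on \<Omega>) (\<lambda>z. w z * x z)" "integrable (lebesgue_on \<Omega>) (\<lambda>z. w z * y z)"
      using H1_D(1)[OF w] by (auto intro: L2_mult_integrable)
    moreover have "L2_on \<Omega> (\<lambda>z. c * x z + y z)" by (intro L2_on_add L2_on_cmult L)
    ultimately show ?case using x0 step by (simp add: algebra_simps plus_fun_def scaleR_fun_def)
  qed
  then have w0: "AE z in lebesgue_on \<Omega>. w z = 0"
    using eigs_total[OF L2_Omega_integrable[OF H1_D(1)[OF w]]] by blast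
  \<comment> \<open>A null function has the zero field as a weak gradient, so by uniqueness its jet
    is null as well.\<close>
  have "(\<integral>z. w z * partial i f z \<partial>(lebesgue_on \<Omega>)) = 0" for f i
    by (rule integral_eq_zero_AE) (use w0 in eventually_elim, simp)
  then have "has_weak_grad r0 r1 w (\<lambda>z. 0)" by (simp add: has_weak_grad_def)
  from wgrad_AE[OF w this] w0 have "AE z in lebesgue_on \<Omega>. jet w z \<bullet> jet w z = 0"
    by eventually_elim (simp add: jet_def)
  then show "H1_ip w w = 0" unfolding H1_ip_def L2_ip_def by (rule integral_eq_zero_AE)
qed (use that in blast)

end

section \<open>The Poincare inequality\<close>

context strip
begin

lemma H1_norm_smooth_sq:
  assumes "smooth_periodic v"
  shows "(H1_norm r0 r1 v)\<^sup>2 = (\<integral>z. (v z)\<^sup>2 \<partial>(lebesgue_on \<Omega>)) + (\<integral>z. grad v z \<bullet> grad v z \<partial>(lebesgue_on \<Omega>))"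
proof -
  note v = smooth_periodic_H1[OF assms]
  have "(H1_norm r0 r1 v)\<^sup>2 = H1_ip v v" using H1.nrm_sq[OF v] by (simp add: H1_nrm_eq[OF v])
  also have "\<dots> = (\<integral>z. v z * v z \<partial>(lebesgue_on \<Omega>)) + (\<integral>z. wgrad r0 r1 v z \<bullet> grad v z \<partial>(lebesgue_on \<Omega>))"
    by (rule H1_ip_smooth[OF v assms])
  also have "(\<integral>z. wgrad r0 r1 v z \<bullet> grad v z \<partial>(lebesgue_on \<Omega>)) = (\<integral>z. grad v z \<bullet> grad v z \<partial>(lebesgue_on \<Omega>))"
    using L2_ip_AE_cong[OF wgrad_smooth[OF assms] _ H1_D(3)[OF v] L2_grad[OF assms] L2_grad[OF assms] L2_grad[OF assms]]
    by (simp add: L2_ip_def)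
  finally show ?thesis by (simp add: power2_eq_square)
qed

lemma grad_add: "\<lbrakk>smooth_periodic f; smooth_periodic g\<rbrakk> \<Longrightarrow> grad (f + g) z = grad f z + grad g z"
  using partial_add[of f z g] smooth_periodic_C1[of f] smooth_periodic_C1[of g]
  by (simp add: vec_eq_iff C1_def plus_fun_def)

lemma grad_scaleR: "smooth_periodic f \<Longrightarrow> grad (c *\<^sub>R f) z = c *\<^sub>R grad f z"
  using partial_cmult[where f=f and z=z and c=c] smooth_periodic_C1[of f] by (simp add: vec_eq_iff C1_def scaleR_fun_def)

text \<open>The weak eigenvalue equation, tested with all of \<open>H1\<close>, is linear in
  \<open>f\<close> and gives orthogonality of components with different eigenvalues.\<close>

definition eigenvector :: "real \<Rightarrow> (real ^ 3 \<Rightarrow> real) \<Rightarrow> bool" where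
  "eigenvector \<mu> f \<longleftrightarrow> f \<in> span eigs \<and> (\<forall>u\<in>H1 r0 r1.
     (\<integral>z. wgrad r0 r1 u z \<bullet> grad f z \<partial>(lebesgue_on \<Omega>)) = \<mu> * (\<integral>z. u z * f z \<partial>(lebesgue_on \<Omega>)))"

lemma integral_mult_add:
  assumes "u \<in> H1 r0 r1" "smooth_periodic f" "smooth_periodic g"
  shows "(\<integral>z. u z * (f + g) z \<partial>(lebesgue_on \<Omega>)) = (\<integral>z. u z * f z \<partial>(lebesgue_on \<Omega>)) + (\<integral>z. u z * g z \<partial>(lebesgue_on \<Omega>))"
    "(\<integral>z. wgrad r0 r1 u z \<bullet> grad (f + g) z \<partial>(lebesgue_on \<Omega>)) =
      (\<integral>z. wgrad r0 r1 u z \<bullet> grad f z \<partial>(lebesgue_on \<Omega>)) + (\<integral>z. wgrad r0 r1 u z \<bullet> grad g z \<partial>(lebesgue_on \<Omega>))"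
  using L2_mult_integrable[OF H1_D(1)[OF assms(1)] H1_D(1)[OF smooth_periodic_H1[OF assms(2)]]]
    L2_mult_integrable[OF H1_D(1)[OF assms(1)] H1_D(1)[OF smooth_periodic_H1[OF assms(3)]]]
    L2_inner_integrable[OF H1_D(3)[OF assms(1)] L2_grad[OF assms(2)]]
    L2_inner_integrable[OF H1_D(3)[OF assms(1)] L2_grad[OF assms(3)]]
  by (simp_all add: grad_add[OF assms(2,3)] inner_add_right distrib_left)

lemma eigenvector_add: "\<lbrakk>eigenvector \<mu> f; eigenvector \<mu> g\<rbrakk> \<Longrightarrow> eigenvector \<mu> (f + g)"
  using integral_mult_add[of _ f g] span_eigs_smooth[of f] span_eigs_smooth[of g]
  by (simp add: eigenvector_def span_add algebra_simps del: plus_fun_apply)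

lemma eigenvector_scaleR: "eigenvector \<mu> f \<Longrightarrow> eigenvector \<mu> (c *\<^sub>R f)"
  using span_eigs_smooth[of f]
  by (simp add: eigenvector_def span_scale grad_scaleR mult.left_commute)

lemma eigenvector_eig: "eigenvector (lam k m l) (eig k m \<theta> l)"
  by (simp add: eigenvector_def eig_mem green_eig)

lemma eigenvector_zero: "eigenvector \<mu> 0"
proof -
  have "grad 0 z = 0" for z by (simp add: vec_eq_iff zero_fun_def)
  then show ?thesis by (simp add: eigenvector_def span_zero)
qed

text \<open>The least nonzero value of \<open>lam\<close>: the three candidates belong to one index
  equal to \<open>1\<close> and the other two equal to \<open>0\<close>.\<close>

definition gap :: real where "gap = min (\<kappa>\<^sup>2) (min 1 ((pi / 2)\<^sup>2))"

lemma gap_pos: "gap > 0" using \<kappa>_pos by (simp add: gap_def)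

lemma lam_zero_or_ge_gap: "k = 0 \<and> m = 0 \<and> l = 0 \<or> gap \<le> lam k m l"
proof -
  have lam: "lam k m l = (k * \<kappa>)\<^sup>2 + (real_of_int m)\<^sup>2 + (l * (pi / 2))\<^sup>2"
    by (simp add: lam_def freq_def sum_3)
  have sq: "a\<^sup>2 \<le> (real_of_int k * a)\<^sup>2" if "k \<noteq> 0" for k a
  proof -
    have "1 \<le> \<bar>real_of_int k\<bar>" using that by linarith
    then have "1 \<le> (real_of_int k)\<^sup>2" using power_mono[of 1 "\<bar>real_of_int k\<bar>" 2] by simp
    then show ?thesis using mult_right_mono[of 1 "(real_of_int k)\<^sup>2" "a\<^sup>2"] by (simp add: power_mult_distrib)
  qed
  have nn: "0 \<le> (k * \<kappa>)\<^sup>2" "0 \<le> (real_of_int m)\<^sup>2" "0 \<le> (l * (pi / 2))\<^sup>2" by (rule zero_le_power2)+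
  show ?thesis
  proof -
    have "gap \<le> \<kappa>\<^sup>2" "gap \<le> 1" "gap \<le> (pi / 2)\<^sup>2" by (simp_all add: gap_def)
    moreover have "k \<noteq> 0 \<Longrightarrow> \<kappa>\<^sup>2 \<le> (k * \<kappa>)\<^sup>2" "m \<noteq> 0 \<Longrightarrow> 1 \<le> (real_of_int m)\<^sup>2"
      "l \<noteq> 0 \<Longrightarrow> (pi / 2)\<^sup>2 \<le> (l * (pi / 2))\<^sup>2"
      using sq[of k \<kappa>] sq[of m 1] sq[of l "pi / 2"] by simp_all
    ultimately show ?thesis unfolding lam using nn by linarith
  qed
qed

text \<open>Since \<open>0\<close> is an \<open>eigenvector\<close> for every \<open>\<mu>\<close>, the components can be indexed by all real numbers.\<close>

lemma eigenvector_decomposition: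
  assumes "f \<in> span eigs"
  shows "\<exists>\<Lambda> P. finite \<Lambda> \<and> (\<forall>\<mu>. eigenvector \<mu> (P \<mu>)) \<and> (\<forall>\<mu>. \<mu> \<notin> \<Lambda> \<longrightarrow> P \<mu> = 0)
    \<and> (\<exists>c. P 0 = (\<lambda>z. c)) \<and> (\<forall>\<mu>\<in>\<Lambda>. \<mu> = 0 \<or> gap \<le> \<mu>) \<and> f = (\<Sum>\<mu>\<in>\<Lambda>. P \<mu>)"
  using assms
proof (induction rule: span_induct_alt)
  case base
  show ?case by (intro exI[of _ "{}"] exI[of _ "\<lambda>_. 0"]) (use eigenvector_zero in \<open>auto simp: zero_fun_def\<close>)
next
  case (step c e y)
  then obtain k m \<theta> l where e: "e = eig k m \<theta> l" by (auto simp: eigs_def)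
  obtain \<Lambda> P b where P: "finite \<Lambda>" "\<And>\<mu>. eigenvector \<mu> (P \<mu>)" "\<And>\<mu>. \<mu> \<notin> \<Lambda> \<Longrightarrow> P \<mu> = 0"
    "P 0 = (\<lambda>z. b)" "\<And>\<mu>. \<mu> \<in> \<Lambda> \<Longrightarrow> \<mu> = 0 \<or> gap \<le> \<mu>" "y = (\<Sum>\<mu>\<in>\<Lambda>. P \<mu>)" using step by blast
  define \<nu> where "\<nu> = lam k m l"
  define P' where "P' \<mu> = P \<mu> + (if \<mu> = \<nu> then c *\<^sub>R e else 0)" for \<mu>
  show ?case
  proof (intro exI[of _ "insert \<nu> \<Lambda>"] exI[of _ P'] conjI allI ballI impI)
    show "finite (insert \<nu> \<Lambda>)" using P by simp
    show "eigenvector \<mu> (P' \<mu>)" for \<mu>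
      unfolding P'_def using P(2) eigenvector_scaleR[OF eigenvector_eig]
      by (intro eigenvector_add) (auto simp: \<nu>_def e eigenvector_zero)
    show "P' \<mu> = 0" if "\<mu> \<notin> insert \<nu> \<Lambda>" for \<mu> using that P(3) by (simp add: P'_def)
    \<comment> \<open>The eigenvalue \<open>0\<close> forces all three indices to vanish, which
      leaves the constant \<open>cos \<theta>\<close>.\<close>
    show "\<exists>c. P' 0 = (\<lambda>z. c)"
    proof (cases "\<nu> = 0")
      case True
      then have "k = 0 \<and> m = 0 \<and> l = 0" using lam_zero_or_ge_gap[of k m l] gap_pos by (auto simp: \<nu>_def)
      then have "P' 0 = (\<lambda>z. b + c * cos \<theta>)" using True by (auto simp: P'_def P(4) e eig_def fun_eq_iff)
      then show ?thesis by blast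
    next
      case False
      then show ?thesis by (simp add: P'_def P(4)) (auto simp: fun_eq_iff)
    qed
    show "\<mu> = 0 \<or> gap \<le> \<mu>" if "\<mu> \<in> insert \<nu> \<Lambda>" for \<mu>
    proof (cases "\<mu> = \<nu>")
      case True
      have "k = 0 \<and> m = 0 \<and> l = 0 \<Longrightarrow> \<nu> = 0" by (auto simp: \<nu>_def lam_def freq_def sum_3)
      then show ?thesis using lam_zero_or_ge_gap[of k m l] True by (auto simp: \<nu>_def)
    next
      case False then show ?thesis using that P(5) by auto
    qed
    have "(\<Sum>\<mu>\<in>insert \<nu> \<Lambda>. P' \<mu>) = (\<Sum>\<mu>\<in>insert \<nu> \<Lambda>. P \<mu>) + (\<Sum>\<mu>\<in>insert \<nu> \<Lambda>. if \<mu> = \<nu> then c *\<^sub>R e else 0)"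
      unfolding P'_def by (rule sum.distrib)
    also have "(\<Sum>\<mu>\<in>insert \<nu> \<Lambda>. if \<mu> = \<nu> then c *\<^sub>R e else 0) = c *\<^sub>R e"
      using P(1) by (subst sum.delta) auto
    also have "(\<Sum>\<mu>\<in>insert \<nu> \<Lambda>. P \<mu>) = (\<Sum>\<mu>\<in>\<Lambda>. P \<mu>)"
      using P(1,3) by (intro sum.mono_neutral_right) auto
    finally show "c *\<^sub>R e + y = (\<Sum>\<mu>\<in>insert \<nu> \<Lambda>. P' \<mu>)" unfolding P(6) by (simp only: add.commute)
  qed
qed

text \<open>Integrals split only where integrability is known, so additivity of \<open>h\<close> is
  assumed on \<open>span eigs\<close> alone.\<close>

lemma sum_additive_on_span:
  fixes h :: "(real ^ 3 \<Rightarrow> real) \<Rightarrow> real"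
  assumes "finite A" "\<And>a. P a \<in> span eigs" "h 0 = 0"
    and "\<And>f g. \<lbrakk>f \<in> span eigs; g \<in> span eigs\<rbrakk> \<Longrightarrow> h (f + g) = h f + h g"
  shows "h (\<Sum>a\<in>A. P a) = (\<Sum>a\<in>A. h (P a))"
  using assms(1)
proof (induction A)
  case (insert a A)
  have "h (P a + sum P A) = h (P a) + h (sum P A)" by (intro assms(4) assms(2) span_sum)
  then show ?case unfolding sum.insert[OF insert.hyps] insert.IH .
qed (unfold sum.empty, rule assms(3))

text \<open>Distinct components are orthogonal, so both sides become sums over eigenvalues, compared
  term by term. A nonzero eigenvalue is at least \<open>gap\<close>, and the constant mode
  \<open>c\<close> contributes \<open>gap * (c * V)^2\<close> on both sides. The mean is kept
  because approximants of a function with mean zero need not have mean zero; the volume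
  \<open>V\<close> is kept to avoid a division.\<close>

lemma poincare_span:
  assumes f: "f \<in> span eigs"
  defines "V \<equiv> (\<integral>z. 1 \<partial>(lebesgue_on \<Omega>))"
  shows "V * (gap * (\<integral>z. (f z)\<^sup>2 \<partial>(lebesgue_on \<Omega>)))
    \<le> V * (\<integral>z. grad f z \<bullet> grad f z \<partial>(lebesgue_on \<Omega>)) + gap * (\<integral>z. f z \<partial>(lebesgue_on \<Omega>))\<^sup>2"
proof -
  let ?I = "\<lambda>h. \<integral>z. h z \<partial>(lebesgue_on \<Omega>)"
  obtain \<Lambda> P c where P: "finite \<Lambda>" "\<And>\<mu>. eigenvector \<mu> (P \<mu>)" "\<And>\<mu>. \<mu> \<notin> \<Lambda> \<Longrightarrow> P \<mu> = 0"
    "P 0 = (\<lambda>z. c)" "\<And>\<mu>. \<mu> \<in> \<Lambda> \<Longrightarrow> \<mu> = 0 \<or> gap \<le> \<mu>" and fP: "f = (\<Sum>\<mu>\<in>\<Lambda>. P \<mu>)"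
    using eigenvector_decomposition[OF f] by blast
  have Ps: "P \<mu> \<in> span eigs" for \<mu> using P(2) by (simp add: eigenvector_def)
  note sm = span_eigs_smooth[OF Ps] span_eigs_smooth[OF f]
  note H = smooth_periodic_H1[OF sm(1)] smooth_periodic_H1[OF sm(2)]
  have grad0: "grad 0 z = 0" for z by (simp add: vec_eq_iff zero_fun_def)
  have s1: "?I (\<lambda>z. u z * f z) = (\<Sum>\<mu>\<in>\<Lambda>. ?I (\<lambda>z. u z * P \<mu> z))" if "u \<in> H1 r0 r1" for u
    unfolding fP
    by (rule sum_additive_on_span[where h="\<lambda>f. ?I (\<lambda>z. u z * f z)", OF P(1) Ps])
       (use integral_mult_add(1)[OF that] span_eigs_smooth in auto)
  have s2: "?I (\<lambda>z. wgrad r0 r1 u z \<bullet> grad f z) = (\<Sum>\<mu>\<in>\<Lambda>. \<mu> * ?I (\<lambda>z. u z * P \<mu> z))" if "u \<in> H1 r0 r1" for u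
  proof -
    have "?I (\<lambda>z. wgrad r0 r1 u z \<bullet> grad f z) = (\<Sum>\<mu>\<in>\<Lambda>. ?I (\<lambda>z. wgrad r0 r1 u z \<bullet> grad (P \<mu>) z))"
      unfolding fP
      by (rule sum_additive_on_span[where h="\<lambda>f. ?I (\<lambda>z. wgrad r0 r1 u z \<bullet> grad f z)", OF P(1) Ps])
         (use integral_mult_add(2)[OF that] span_eigs_smooth grad0 in auto)
    then show ?thesis using P(2) that by (simp add: eigenvector_def)
  qed
  have wg: "?I (\<lambda>z. wgrad r0 r1 u z \<bullet> grad v z) = ?I (\<lambda>z. grad u z \<bullet> grad v z)"
    if "smooth_periodic u" "smooth_periodic v" for u v
    using L2_ip_AE_cong[OF wgrad_smooth[OF that(1)] _ H1_D(3)[OF smooth_periodic_H1[OF that(1)]] L2_grad[OF that(1)] L2_grad[OF that(2)] L2_grad[OF that(2)]]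
    by (simp add: L2_ip_def)
  \<comment> \<open>Evaluating the symmetric Dirichlet form of two components from either side gives
    one number with two different eigenvalues.\<close>
  have orth: "?I (\<lambda>z. P \<nu> z * P \<mu> z) = 0" if "\<nu> \<noteq> \<mu>" for \<nu> \<mu>
  proof -
    have "\<mu> * ?I (\<lambda>z. P \<nu> z * P \<mu> z) = ?I (\<lambda>z. grad (P \<nu>) z \<bullet> grad (P \<mu>) z)"
      using P(2)[of \<mu>] H(1)[of \<nu>] wg[OF sm(1) sm(1), of \<nu> \<mu>] by (simp add: eigenvector_def)
    also have "\<dots> = \<nu> * ?I (\<lambda>z. P \<mu> z * P \<nu> z)"
      using P(2)[of \<nu>] H(1)[of \<mu>] wg[OF sm(1) sm(1), of \<mu> \<nu>] by (simp add: eigenvector_def inner_commute)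
    finally show ?thesis using that by (simp add: mult.commute)
  qed
  define q where "q \<mu> = ?I (\<lambda>z. P \<mu> z * P \<mu> z)" for \<mu>
  have q0: "0 \<le> q \<mu>" for \<mu> unfolding q_def by (intro integral_nonneg_AE AE_I2) simp
  have fPl: "?I (\<lambda>z. f z * P \<mu> z) = q \<mu>" if "\<mu> \<in> \<Lambda>" for \<mu>
  proof -
    have "?I (\<lambda>z. f z * P \<mu> z) = (\<Sum>\<nu>\<in>\<Lambda>. ?I (\<lambda>z. P \<mu> z * P \<nu> z))"
      using s1[OF H(1), of \<mu>] by (simp add: mult.commute)
    also have "\<dots> = (\<Sum>\<nu>\<in>\<Lambda>. if \<nu> = \<mu> then q \<mu> else 0)"
      by (intro sum.cong refl) (auto simp: orth q_def)
    finally show ?thesis using P(1) that by simp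
  qed
  have f2: "?I (\<lambda>z. (f z)\<^sup>2) = (\<Sum>\<mu>\<in>\<Lambda>. q \<mu>)"
    using s1[OF H(2)] fPl by (simp add: power2_eq_square)
  have g2: "?I (\<lambda>z. grad f z \<bullet> grad f z) = (\<Sum>\<mu>\<in>\<Lambda>. \<mu> * q \<mu>)"
    using s2[OF H(2)] fPl wg[OF sm(2) sm(2)] by simp
  have one: "(\<lambda>z. 1) \<in> H1 r0 r1" "\<And>z. grad (\<lambda>z. 1) z = 0" "smooth_periodic (\<lambda>z. 1)"
    using smooth_periodic_H1 span_eigs_smooth const_mem by (auto simp: vec_eq_iff)
  \<comment> \<open>Testing the eigenvalue equation with the constant \<open>1\<close>, whose
    gradient vanishes, shows that components with nonzero eigenvalue have mean zero.\<close>
  have mean: "?I (\<lambda>z. 1 * P \<mu> z) = 0" if "\<mu> \<noteq> 0" for \<mu>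
  proof -
    have "\<mu> * ?I (\<lambda>z. 1 * P \<mu> z) = ?I (\<lambda>z. grad (\<lambda>z. 1) z \<bullet> grad (P \<mu>) z)"
      using P(2)[of \<mu>, unfolded eigenvector_def, THEN conjunct2, rule_format, OF one(1)] wg[OF one(3) sm(1), of \<mu>] by presburger
    also have "\<dots> = 0" by (simp add: one(2))
    finally show ?thesis using that by simp
  qed
  have "?I f = (\<Sum>\<mu>\<in>\<Lambda>. ?I (\<lambda>z. 1 * P \<mu> z))" using s1[OF one(1)] by simp
  also have "\<dots> = (\<Sum>\<mu>\<in>\<Lambda>. if \<mu> = 0 then c * V else 0)"
    by (intro sum.cong refl) (use mean in \<open>auto simp: P(4) V_def\<close>)
  also have "\<dots> = (if 0 \<in> \<Lambda> then c * V else 0)" using P(1) by simp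
  finally have If: "?I f = (if 0 \<in> \<Lambda> then c * V else 0)" .
  have V0: "0 \<le> V" unfolding V_def by (intro integral_nonneg_AE AE_I2) simp
  have "V * (gap * ?I (\<lambda>z. (f z)\<^sup>2)) = (\<Sum>\<mu>\<in>\<Lambda>. V * (gap * q \<mu>))" by (simp add: f2 sum_distrib_left)
  also have "\<dots> \<le> (\<Sum>\<mu>\<in>\<Lambda>. V * (\<mu> * q \<mu>) + (if \<mu> = 0 then gap * (c * V)\<^sup>2 else 0))"
  proof (rule sum_mono)
    fix \<mu> assume "\<mu> \<in> \<Lambda>"
    show "V * (gap * q \<mu>) \<le> V * (\<mu> * q \<mu>) + (if \<mu> = 0 then gap * (c * V)\<^sup>2 else 0)"
    proof (cases "\<mu> = 0")
      case True
      have "q 0 = c\<^sup>2 * V" by (simp add: q_def P(4) V_def power2_eq_square)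
      then show ?thesis using True by (simp add: power2_eq_square)
    next
      case False
      then have "gap * q \<mu> \<le> \<mu> * q \<mu>" using P(5)[OF \<open>\<mu> \<in> \<Lambda>\<close>] q0 by (auto intro: mult_right_mono)
      then show ?thesis using False V0 by (simp add: mult_left_mono)
    qed
  qed
  also have "\<dots> = V * ?I (\<lambda>z. grad f z \<bullet> grad f z) + gap * (?I f)\<^sup>2"
    using P(1) by (simp add: sum.distrib g2 sum_distrib_left If)
  finally show ?thesis .
qed

lemma wgrad_diff:
  assumes "u \<in> H1 r0 r1" "v \<in> H1 r0 r1"
  shows "AE z in lebesgue_on \<Omega>. wgrad r0 r1 (u - v) z = wgrad r0 r1 u z - wgrad r0 r1 v z"
  using jet_add[OF H1.V_closed(3)[OF assms] assms(2)] by eventually_elim (simp add: jet_def)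

lemma L2_norm_le_H1:
  assumes "u \<in> H1 r0 r1"
  shows "L2_norm \<Omega> u \<le> H1.nrm u" "L2_norm \<Omega> (wgrad r0 r1 u) \<le> H1.nrm u"
  using L2_norm_fst_le[OF L2_jet[OF assms, unfolded jet_def]] L2_norm_snd_le[OF L2_jet[OF assms, unfolded jet_def]]
    L2_norm_jet[OF assms] by (simp_all add: H1_nrm_eq[OF assms] jet_def[abs_def])

lemma H1_tendsto_parts:
  assumes Y: "\<forall>n. Y n \<in> H1 r0 r1" and u: "u \<in> H1 r0 r1" and lim: "(\<lambda>n. H1.nrm (Y n - u)) \<longlonglongrightarrow> 0"
  shows "(\<lambda>n. L2_norm \<Omega> (Y n)) \<longlonglongrightarrow> L2_norm \<Omega> u"
    "(\<lambda>n. L2_norm \<Omega> (wgrad r0 r1 (Y n))) \<longlonglongrightarrow> L2_norm \<Omega> (wgrad r0 r1 u)"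
    "(\<lambda>n. \<integral>z. Y n z \<partial>(lebesgue_on \<Omega>)) \<longlonglongrightarrow> (\<integral>z. u z \<partial>(lebesgue_on \<Omega>))"
proof -
  show "(\<lambda>n. L2_norm \<Omega> (Y n)) \<longlonglongrightarrow> L2_norm \<Omega> u"
  proof (rule H1.tendsto_by_nrm[OF Y u lim, where K=1])
    fix a b assume ab: "a \<in> H1 r0 r1" "b \<in> H1 r0 r1"
    have "\<bar>L2_norm \<Omega> a - L2_norm \<Omega> b\<bar> \<le> L2_norm \<Omega> (a - b)"
      using L2_norm_diff_abs[OF H1_D(1)[OF ab(1)] H1_D(1)[OF ab(2)]] by (simp add: fun_diff_def)
    then show "\<bar>L2_norm \<Omega> a - L2_norm \<Omega> b\<bar> \<le> 1 * H1.nrm (a - b)"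
      using L2_norm_le_H1(1)[OF H1.V_closed(3)[OF ab]] by simp
  qed
  show "(\<lambda>n. L2_norm \<Omega> (wgrad r0 r1 (Y n))) \<longlonglongrightarrow> L2_norm \<Omega> (wgrad r0 r1 u)"
  proof (rule H1.tendsto_by_nrm[OF Y u lim, where K=1])
    fix a b assume ab: "a \<in> H1 r0 r1" "b \<in> H1 r0 r1"
    have "\<bar>L2_norm \<Omega> (wgrad r0 r1 a) - L2_norm \<Omega> (wgrad r0 r1 b)\<bar> \<le> L2_norm \<Omega> (\<lambda>z. wgrad r0 r1 a z - wgrad r0 r1 b z)"
      by (rule L2_norm_diff_abs[OF H1_D(3)[OF ab(1)] H1_D(3)[OF ab(2)]])
    also have "\<dots> = L2_norm \<Omega> (wgrad r0 r1 (a - b))"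
      using wgrad_diff[OF ab] H1_D(3)[OF ab(1)] H1_D(3)[OF ab(2)] H1_D(3)[OF H1.V_closed(3)[OF ab]]
      by (intro L2_norm_AE_cong L2_on_measurable L2_on_diff) auto
    finally show "\<bar>L2_norm \<Omega> (wgrad r0 r1 a) - L2_norm \<Omega> (wgrad r0 r1 b)\<bar> \<le> 1 * H1.nrm (a - b)"
      using L2_norm_le_H1(2)[OF H1.V_closed(3)[OF ab]] by simp
  qed
  have one: "L2_on \<Omega> (\<lambda>_. 1 :: real)" by (rule L2_Omega_continuous) simp
  show "(\<lambda>n. \<integral>z. Y n z \<partial>(lebesgue_on \<Omega>)) \<longlonglongrightarrow> (\<integral>z. u z \<partial>(lebesgue_on \<Omega>))"
  proof (rule H1.tendsto_by_nrm[OF Y u lim, where K="L2_norm \<Omega> (\<lambda>_. 1 :: real)"])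
    fix a b assume ab: "a \<in> H1 r0 r1" "b \<in> H1 r0 r1"
    note d = H1_D(1)[OF H1.V_closed(3)[OF ab]]
    have "(\<integral>z. a z \<partial>(lebesgue_on \<Omega>)) - (\<integral>z. b z \<partial>(lebesgue_on \<Omega>)) = (\<integral>z. (a - b) z \<bullet> 1 \<partial>(lebesgue_on \<Omega>))"
      using L2_Omega_integrable[OF H1_D(1)[OF ab(1)]] L2_Omega_integrable[OF H1_D(1)[OF ab(2)]] by simp
    also have "\<bar>\<dots>\<bar> \<le> L2_norm \<Omega> (a - b) * L2_norm \<Omega> (\<lambda>_. 1 :: real)" by (rule L2_Cauchy_Schwarz[OF d one])
    also have "\<dots> \<le> H1.nrm (a - b) * L2_norm \<Omega> (\<lambda>_. 1 :: real)"
      by (intro mult_right_mono L2_norm_le_H1 H1.V_closed ab) simp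
    finally show "\<bar>(\<integral>z. a z \<partial>(lebesgue_on \<Omega>)) - (\<integral>z. b z \<partial>(lebesgue_on \<Omega>))\<bar>
        \<le> L2_norm \<Omega> (\<lambda>_. 1 :: real) * H1.nrm (a - b)" by (simp add: mult.commute)
  qed
qed

text \<open>The approximants in \<open>span eigs\<close> satisfy the inequality with a mean term.
  Their means tend to the mean of \<open>u\<close>, so this term disappears in the limit. The volume
  is then cancelled, being positive because the cell is open and nonempty.\<close>

lemma poincare:
  assumes u: "u \<in> H1 r0 r1" and mean: "(\<integral>z. u z \<partial>(lebesgue_on \<Omega>)) = 0"
  shows "gap * (L2_norm \<Omega> u)\<^sup>2 \<le> (L2_norm \<Omega> (wgrad r0 r1 u))\<^sup>2"
proof -
  define V where "V = (\<integral>z. 1 \<partial>(lebesgue_on \<Omega>) :: real)"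
  obtain Y where Y: "\<forall>n. Y n \<in> span eigs" "(\<lambda>n. H1.nrm (Y n - u)) \<longlonglongrightarrow> 0" using span_eigs_dense[OF u] .
  have YH: "\<forall>n. Y n \<in> H1 r0 r1" using Y(1) span_eigs_smooth smooth_periodic_H1 by blast
  note lim = H1_tendsto_parts[OF YH u Y(2)]
  have ineq: "V * (gap * (L2_norm \<Omega> (Y n))\<^sup>2) \<le> V * (L2_norm \<Omega> (wgrad r0 r1 (Y n)))\<^sup>2 + gap * (\<integral>z. Y n z \<partial>(lebesgue_on \<Omega>))\<^sup>2" for n
  proof -
    note sm = span_eigs_smooth[OF Y(1)[rule_format, of n]]
    have "(L2_norm \<Omega> (wgrad r0 r1 (Y n)))\<^sup>2 = (L2_norm \<Omega> (grad (Y n)))\<^sup>2"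
      using L2_norm_AE_cong[OF wgrad_smooth[OF sm]] H1_D(3)[OF YH[rule_format, of n]] L2_grad[OF sm] by (simp add: L2_on_measurable)
    then show ?thesis using poincare_span[OF Y(1)[rule_format, of n]] by (simp add: V_def L2_norm_sq dot_square_norm)
  qed
  have "V * (gap * (L2_norm \<Omega> u)\<^sup>2) \<le> V * (L2_norm \<Omega> (wgrad r0 r1 u))\<^sup>2 + gap * 0\<^sup>2"
  proof (rule LIMSEQ_le)
    show "(\<lambda>n. V * (gap * (L2_norm \<Omega> (Y n))\<^sup>2)) \<longlonglongrightarrow> V * (gap * (L2_norm \<Omega> u)\<^sup>2)"
      by (intro tendsto_intros lim)
    show "(\<lambda>n. V * (L2_norm \<Omega> (wgrad r0 r1 (Y n)))\<^sup>2 + gap * (\<integral>z. Y n z \<partial>(lebesgue_on \<Omega>))\<^sup>2)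
        \<longlonglongrightarrow> V * (L2_norm \<Omega> (wgrad r0 r1 u))\<^sup>2 + gap * 0\<^sup>2"
      by (intro tendsto_intros lim(2) lim(3)[unfolded mean])
  qed (use ineq in blast)
  moreover have "V > 0"
  proof -
    have "V \<noteq> 0"
    proof
      assume "V = 0"
      then have "measure lebesgue \<Omega> = 0" by (simp add: V_def measure_restrict_space)
      moreover have "\<Omega> \<in> lmeasurable" by (simp add: Omega_box)
      ultimately have "negligible \<Omega>" by (simp add: negligible_iff_measure)
      moreover have "vector [(r0 + r1) / 2, pi, 0] \<in> \<Omega>" using r0_less by (simp add: Omega_def)
      ultimately show False using open_not_negligible[OF Omega_open] by blast
    qed
    moreover have "V \<ge> 0" unfolding V_def by (intro integral_nonneg_AE AE_I2) simp
    ultimately show ?thesis by simp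
  qed
  ultimately show ?thesis by simp
qed

end

section \<open>Traces\<close>

context strip
begin

lemma L2_compose_continuous:
  assumes "Q \<in> sets borel" "bounded Q" "continuous_on UNIV (p :: real \<times> real \<Rightarrow> real ^ 3)" "smooth_periodic v"
  shows "L2_on Q (\<lambda>y. v (p y))"
  using continuous_on_compose2[OF C1_continuous[OF smooth_periodic_C1[OF assms(4)]] assms(3)]
  by (intro L2_on_continuous assms) auto

lemma partial_coord: "partial i (\<lambda>z. a * (z $ j) + b) z = (if i = j then a else 0)"
proof (rule partial_eqI)
  have "((\<lambda>z. a * (z $ j) + b) has_derivative (\<lambda>h. a * h $ j)) (at z)"
    using has_derivative_add_const[OF has_derivative_mult_right[OF bounded_linear_imp_has_derivative[OF bounded_linear_vec_nth]]] .
  moreover have "(\<lambda>h :: real ^ 3. a * h $ j) = (\<lambda>h. \<Sum>i\<in>UNIV. h $ i * (if i = j then a else 0))"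
    by (simp add: if_distrib[of "\<lambda>x. _ * x"] mult.commute cong: if_cong)
  ultimately show "((\<lambda>z. a * (z $ j) + b) has_derivative (\<lambda>h. \<Sum>i\<in>UNIV. h $ i * (if i = j then a else 0))) (at z)"
    by simp
qed

lemma C1_coord: "C1 (\<lambda>z. a * (z $ j) + b)"
proof -
  have "elem (\<lambda>z. a * (z $ j) + b)" by (intro elem_intros)
  then show ?thesis by (auto simp: C1_def elem_differentiable intro!: elem_continuous elem_partial)
qed

text \<open>The affine weight will be \<open>1\<close> or \<open>-1\<close> on one face and \<open>0\<close> on the opposite one.\<close>

lemma trace_inequality:
  assumes v: "smooth_periodic v" and b: "\<And>z. z \<in> \<Omega> \<Longrightarrow> \<bar>a * (z $ i) + b\<bar> \<le> 1"
  shows "(\<integral>z. partial i (\<lambda>z. (a * (z $ i) + b) * (v z * v z)) z \<partial>(lebesgue_on \<Omega>)) \<le> (\<bar>a\<bar> + 1) * (H1_norm r0 r1 v)\<^sup>2"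
proof -
  have C: "C1 v" by (rule smooth_periodic_C1[OF v])
  have Cv: "C1 (\<lambda>z. v z * v z)" by (rule C1_mult[OF C C])
  have p: "partial i (\<lambda>z. (a * (z $ i) + b) * (v z * v z)) z
      = a * (v z)\<^sup>2 + (a * (z $ i) + b) * (2 * v z * partial i v z)" for z
    using C Cv C1_coord[of a i b] by (simp add: C1_def partial_mult partial_coord power2_eq_square)
  have i1: "integrable (lebesgue_on \<Omega>) (\<lambda>z. (v z)\<^sup>2)" "integrable (lebesgue_on \<Omega>) (\<lambda>z. grad v z \<bullet> grad v z)"
    using L2_on_integrable[OF H1_D(1)[OF smooth_periodic_H1[OF v]]] L2_inner_integrable[OF L2_grad[OF v] L2_grad[OF v]] by simp_all
  have "(\<integral>z. partial i (\<lambda>z. (a * (z $ i) + b) * (v z * v z)) z \<partial>(lebesgue_on \<Omega>))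
      \<le> (\<integral>z. (\<bar>a\<bar> + 1) * (v z)\<^sup>2 + grad v z \<bullet> grad v z \<partial>(lebesgue_on \<Omega>))"
  proof (rule integral_mono)
    show "integrable (lebesgue_on \<Omega>) (partial i (\<lambda>z. (a * (z $ i) + b) * (v z * v z)))"
      using C1_mult[OF C1_coord Cv] by (intro integrable_on_continuous Omega_bounded Omega_sets) (simp add: C1_def)
    show "integrable (lebesgue_on \<Omega>) (\<lambda>z. (\<bar>a\<bar> + 1) * (v z)\<^sup>2 + grad v z \<bullet> grad v z)" using i1 by simp
    fix z assume "z \<in> space (lebesgue_on \<Omega>)"
    then have z: "\<bar>a * (z $ i) + b\<bar> \<le> 1" using b by simp
    have "(a * (z $ i) + b) * (2 * v z * partial i v z) \<le> \<bar>a * (z $ i) + b\<bar> * \<bar>2 * v z * partial i v z\<bar>"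
      by (metis abs_ge_self abs_mult)
    also have "\<dots> \<le> 1 * \<bar>2 * v z * partial i v z\<bar>" using z by (intro mult_right_mono) auto
    also have "\<dots> \<le> (v z)\<^sup>2 + (partial i v z)\<^sup>2"
      using sum_squares_bound[of "\<bar>v z\<bar>" "\<bar>partial i v z\<bar>"] by (simp add: abs_mult)
    also have "(partial i v z)\<^sup>2 \<le> grad v z \<bullet> grad v z"
      using member_le_sum[of i UNIV "\<lambda>i. (partial i v z)\<^sup>2"] by (simp add: inner_vec_def power2_eq_square)
    finally have "(a * (z $ i) + b) * (2 * v z * partial i v z) \<le> (v z)\<^sup>2 + grad v z \<bullet> grad v z" by simp
    moreover have "a * (v z)\<^sup>2 \<le> \<bar>a\<bar> * (v z)\<^sup>2" by (intro mult_right_mono) auto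
    ultimately show "partial i (\<lambda>z. (a * (z $ i) + b) * (v z * v z)) z \<le> (\<bar>a\<bar> + 1) * (v z)\<^sup>2 + grad v z \<bullet> grad v z"
      unfolding p by (simp add: algebra_simps)
  qed
  also have "\<dots> = (\<bar>a\<bar> + 1) * (\<integral>z. (v z)\<^sup>2 \<partial>(lebesgue_on \<Omega>)) + (\<integral>z. grad v z \<bullet> grad v z \<partial>(lebesgue_on \<Omega>))"
    using i1 by simp
  also have "\<dots> \<le> (\<bar>a\<bar> + 1) * (\<integral>z. (v z)\<^sup>2 \<partial>(lebesgue_on \<Omega>)) + (\<bar>a\<bar> + 1) * (\<integral>z. grad v z \<bullet> grad v z \<partial>(lebesgue_on \<Omega>))"
    using mult_right_mono[of 1 "\<bar>a\<bar> + 1" "\<integral>z. grad v z \<bullet> grad v z \<partial>(lebesgue_on \<Omega>)"]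
    by (simp add: integral_nonneg_AE)
  finally show ?thesis by (simp add: H1_norm_smooth_sq[OF v] distrib_left)
qed

text \<open>The trace theory below uses only these properties, so the four faces are treated at
  once. The bound is left existential and is fixed later as \<open>trace_bound\<close>.\<close>

definition face :: "(real \<times> real) set \<Rightarrow> (real \<times> real \<Rightarrow> real ^ 3) \<Rightarrow> bool" where
  "face Q p \<longleftrightarrow> Q \<in> sets borel \<and> bounded Q \<and> continuous_on UNIV p \<and>
     (\<exists>K\<ge>0. \<forall>v. smooth_periodic v \<longrightarrow> L2_norm Q (\<lambda>y. v (p y)) \<le> K * H1_norm r0 r1 v)"

lemma faceI:
  assumes "Q \<in> sets borel" "bounded Q" "continuous_on UNIV p"
    and b: "\<And>z. z \<in> \<Omega> \<Longrightarrow> \<bar>a * (z $ i) + b\<bar> \<le> 1"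
    and eq: "\<And>v. smooth_periodic v \<Longrightarrow> (\<integral>y. v (p y) * v (p y) \<partial>(lebesgue_on Q)) =
      (\<integral>z. partial i (\<lambda>z. (a * (z $ i) + b) * (v z * v z)) z \<partial>(lebesgue_on \<Omega>))"
  shows "face Q p"
  unfolding face_def
proof (intro conjI assms(1-3) exI[of _ "sqrt (\<bar>a\<bar> + 1)"] allI impI)
  fix v assume v: "smooth_periodic v"
  have "(L2_norm Q (\<lambda>y. v (p y)))\<^sup>2 \<le> (\<bar>a\<bar> + 1) * (H1_norm r0 r1 v)\<^sup>2"
  proof -
    have "(L2_norm Q (\<lambda>y. v (p y)))\<^sup>2 = (\<integral>y. v (p y) * v (p y) \<partial>(lebesgue_on Q))"
      unfolding L2_norm_sq by (simp add: power2_eq_square)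
    then show ?thesis unfolding eq[OF v] using trace_inequality[OF v b] by simp
  qed
  then have "L2_norm Q (\<lambda>y. v (p y)) \<le> sqrt ((\<bar>a\<bar> + 1) * (H1_norm r0 r1 v)\<^sup>2)" by (rule real_le_rsqrt)
  also have "\<dots> = sqrt (\<bar>a\<bar> + 1) * H1_norm r0 r1 v"
    by (simp add: real_sqrt_mult H1_norm_def)
  finally show "L2_norm Q (\<lambda>y. v (p y)) \<le> sqrt (\<bar>a\<bar> + 1) * H1_norm r0 r1 v" .
qed simp

text \<open>The weights are \<open>(z $ 1 - r1) / (r1 - r0)\<close> and
  \<open>(z $ 1 - r0) / (r1 - r0)\<close>. The first equals \<open>-1\<close> on the face
  \<open>r0\<close>, which cancels the minus sign of that face in the divergence theorem.\<close>

lemma face_end: "face cell_end (end_pt r0)" "face cell_end (end_pt r1)"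
proof -
  define L where "L = r1 - r0"
  have L: "L > 0" using r0_less by (simp add: L_def)
  have C: "smooth_periodic v \<Longrightarrow> C1 (\<lambda>z. (a * (z $ 1) + b) * (v z * v z))" for v a b
    by (intro C1_mult C1_coord smooth_periodic_C1)
  have e: "end_pt r y $ 1 = r" for r y by (simp add: end_pt_def split_beta)
  have q: "1 / L * x + - y / L = (x - y) / L" for x y by (simp add: diff_divide_distrib)
  have r1': "1 / L * r1 + - r0 / L = 1" "1 / L * r0 + - r0 / L = 0" "1 / L * r1 + - r1 / L = 0" "1 / L * r0 + - r1 / L = -1"
    using r0_less unfolding q by (simp_all add: L_def field_simps)
  show "face cell_end (end_pt r0)"
  proof (rule faceI[where i=1 and a="1 / L" and b="- r1 / L"])
    fix z assume "z \<in> \<Omega>"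
    then show "\<bar>1 / L * (z $ 1) + - r1 / L\<bar> \<le> 1" using L unfolding q by (auto simp: Omega_def L_def abs_divide)
  next
    fix v assume v: "smooth_periodic v"
    show "(\<integral>y. v (end_pt r0 y) * v (end_pt r0 y) \<partial>(lebesgue_on cell_end)) =
      (\<integral>z. partial 1 (\<lambda>z. (1 / L * (z $ 1) + - r1 / L) * (v z * v z)) z \<partial>(lebesgue_on \<Omega>))"
      unfolding integral_partial_1[OF C[OF v] less_imp_le[OF r0_less]] e r1' by simp
  qed (auto intro: end_pt_continuous cell_end_bounded)
  show "face cell_end (end_pt r1)"
  proof (rule faceI[where i=1 and a="1 / L" and b="- r0 / L"])
    fix z assume "z \<in> \<Omega>"
    then show "\<bar>1 / L * (z $ 1) + - r0 / L\<bar> \<le> 1" using L unfolding q by (auto simp: Omega_def L_def abs_divide)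
  next
    fix v assume v: "smooth_periodic v"
    show "(\<integral>y. v (end_pt r1 y) * v (end_pt r1 y) \<partial>(lebesgue_on cell_end)) =
      (\<integral>z. partial 1 (\<lambda>z. (1 / L * (z $ 1) + - r0 / L) * (v z * v z)) z \<partial>(lebesgue_on \<Omega>))"
      unfolding integral_partial_1[OF C[OF v] less_imp_le[OF r0_less]] e r1' by simp
  qed (auto intro: end_pt_continuous cell_end_bounded)
qed

lemma face_wall: "face (cell_wall r0 r1) (wall_pt 1)" "face (cell_wall r0 r1) (wall_pt (-1))"
proof -
  have C: "smooth_periodic v \<Longrightarrow> C1 (\<lambda>z. (a * (z $ 3) + b) * (v z * v z))" for v a b
    by (intro C1_mult C1_coord smooth_periodic_C1)
  have e: "wall_pt s y $ 3 = s" for s y by (simp add: wall_pt_def split_beta)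
  show "face (cell_wall r0 r1) (wall_pt 1)"
  proof (rule faceI[where i=3 and a="1 / 2" and b="1 / 2"])
    fix z assume "z \<in> \<Omega>"
    then show "\<bar>1 / 2 * (z $ 3) + 1 / 2\<bar> \<le> 1" by (simp add: Omega_def abs_le_iff)
  next
    fix v assume v: "smooth_periodic v"
    show "(\<integral>y. v (wall_pt 1 y) * v (wall_pt 1 y) \<partial>(lebesgue_on (cell_wall r0 r1))) =
      (\<integral>z. partial 3 (\<lambda>z. (1 / 2 * (z $ 3) + 1 / 2) * (v z * v z)) z \<partial>(lebesgue_on \<Omega>))"
      unfolding integral_partial_3[OF C[OF v]] e by simp
  qed (auto intro: wall_pt_continuous cell_wall_bounded)
  show "face (cell_wall r0 r1) (wall_pt (-1))"
  proof (rule faceI[where i=3 and a="1 / 2" and b="- 1 / 2"])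
    fix z assume "z \<in> \<Omega>"
    then show "\<bar>1 / 2 * (z $ 3) + - 1 / 2\<bar> \<le> 1" by (simp add: Omega_def abs_le_iff)
  next
    fix v assume v: "smooth_periodic v"
    show "(\<integral>y. v (wall_pt (-1) y) * v (wall_pt (-1) y) \<partial>(lebesgue_on (cell_wall r0 r1))) =
      (\<integral>z. partial 3 (\<lambda>z. (1 / 2 * (z $ 3) + - 1 / 2) * (v z * v z)) z \<partial>(lebesgue_on \<Omega>))"
      unfolding integral_partial_3[OF C[OF v]] e by simp
  qed (auto intro: wall_pt_continuous cell_wall_bounded)
qed

context
  fixes Q :: "(real \<times> real) set" and p :: "real \<times> real \<Rightarrow> real ^ 3"
  assumes face: "face Q p"
begin

lemma L2_face: "smooth_periodic v \<Longrightarrow> L2_on Q (\<lambda>y. v (p y))"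
  using face by (intro L2_compose_continuous) (auto simp: face_def)

definition trace_bound :: real where
  "trace_bound = (SOME K. K \<ge> 0 \<and> (\<forall>v. smooth_periodic v \<longrightarrow> L2_norm Q (\<lambda>y. v (p y)) \<le> K * H1_norm r0 r1 v))"

lemma trace_bound: "0 \<le> trace_bound"
    "smooth_periodic v \<Longrightarrow> L2_norm Q (\<lambda>y. v (p y)) \<le> trace_bound * H1_norm r0 r1 v"
proof -
  have "\<exists>K. K \<ge> 0 \<and> (\<forall>v. smooth_periodic v \<longrightarrow> L2_norm Q (\<lambda>y. v (p y)) \<le> K * H1_norm r0 r1 v)"
    using face by (auto simp: face_def)
  from someI_ex[OF this] show "0 \<le> trace_bound"
    "smooth_periodic v \<Longrightarrow> L2_norm Q (\<lambda>y. v (p y)) \<le> trace_bound * H1_norm r0 r1 v"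
    by (auto simp: trace_bound_def)
qed

text \<open>The estimate holds for the smooth approximants and both norms converge along them. It
  thus holds for every \<open>T\<close> that qualifies as a trace, whichever sequence witnesses
  it.\<close>

lemma has_trace_bound:
  assumes u: "u \<in> H1 r0 r1" and T: "has_trace r0 r1 Q p u T"
  shows "L2_norm Q T \<le> trace_bound * H1_norm r0 r1 u"
proof -
  obtain v where L: "L2_on Q T" and v: "\<And>n::nat. smooth_periodic (v n)"
    "(\<lambda>n. H1_norm r0 r1 (\<lambda>z. v n z - u z)) \<longlonglongrightarrow> 0" "(\<lambda>n. L2_norm Q (\<lambda>y. v n (p y) - T y)) \<longlonglongrightarrow> 0"
    using T by (auto simp: has_trace_def)
  have vH: "v n \<in> H1 r0 r1" for n by (rule smooth_periodic_H1[OF v(1)])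
  have "H1_norm r0 r1 (\<lambda>z. v n z - u z) = H1.nrm (v n - u)" for n
    using H1_nrm_eq[OF H1.V_closed(3)[OF vH u]] by (simp add: fun_diff_def)
  then have lim: "(\<lambda>n. H1.nrm (v n - u)) \<longlonglongrightarrow> 0" using v(2) by simp
  have "(\<lambda>n. L2_norm Q (\<lambda>y. v n (p y))) \<longlonglongrightarrow> L2_norm Q T"
  proof -
    have "(\<lambda>n. L2_norm Q (\<lambda>y. v n (p y)) - L2_norm Q T) \<longlonglongrightarrow> 0"
      by (rule Lim_null_comparison[OF _ v(3)]) (simp add: L2_norm_diff_abs L2_face v(1) L)
    then show ?thesis by (simp add: LIM_zero_iff)
  qed
  moreover have "(\<lambda>n. trace_bound * H1_norm r0 r1 (v n)) \<longlonglongrightarrow> trace_bound * H1_norm r0 r1 u"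
  proof (intro tendsto_mult_left)
    have "(\<lambda>n. H1.nrm (v n)) \<longlonglongrightarrow> H1.nrm u"
      by (rule H1.tendsto_by_nrm[OF _ u lim, where K=1]) (use vH H1.nrm_diff_abs in auto)
    then show "(\<lambda>n. H1_norm r0 r1 (v n)) \<longlonglongrightarrow> H1_norm r0 r1 u" by (simp add: H1_nrm_eq u vH)
  qed
  ultimately show ?thesis by (rule LIMSEQ_le) (use trace_bound(2)[OF v(1)] in blast)
qed

lemma has_trace_add:
  assumes u: "u \<in> H1 r0 r1" "has_trace r0 r1 Q p u T" and w: "w \<in> H1 r0 r1" "has_trace r0 r1 Q p w S"
  shows "has_trace r0 r1 Q p (u + w) (\<lambda>y. T y + S y)"
proof -
  obtain v where v: "L2_on Q T" "\<And>n::nat. smooth_periodic (v n)"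
    "(\<lambda>n. H1_norm r0 r1 (\<lambda>z. v n z - u z)) \<longlonglongrightarrow> 0" "(\<lambda>n. L2_norm Q (\<lambda>y. v n (p y) - T y)) \<longlonglongrightarrow> 0"
    using u(2) by (auto simp: has_trace_def)
  obtain x where x: "L2_on Q S" "\<And>n::nat. smooth_periodic (x n)"
    "(\<lambda>n. H1_norm r0 r1 (\<lambda>z. x n z - w z)) \<longlonglongrightarrow> 0" "(\<lambda>n. L2_norm Q (\<lambda>y. x n (p y) - S y)) \<longlonglongrightarrow> 0"
    using w(2) by (auto simp: has_trace_def)
  have vH: "(\<lambda>z. v n z - u z) \<in> H1 r0 r1" "(\<lambda>z. x n z - w z) \<in> H1 r0 r1" for n
    using H1.V_closed(3)[OF smooth_periodic_H1[OF v(2)] u(1)] H1.V_closed(3)[OF smooth_periodic_H1[OF x(2)] w(1)]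
    by (simp_all add: fun_diff_def)
  show ?thesis unfolding has_trace_def
  proof (intro conjI exI[of _ "\<lambda>n z. v n z + x n z"] allI)
    show "L2_on Q (\<lambda>y. T y + S y)" by (intro L2_on_add v x)
    show "smooth_periodic (\<lambda>z. v n z + x n z)" for n by (intro smooth_periodic_add v x)
    show "(\<lambda>n. H1_norm r0 r1 (\<lambda>z. v n z + x n z - (u + w) z)) \<longlonglongrightarrow> 0"
    proof (rule Lim_null_comparison)
      show "(\<lambda>n. H1_norm r0 r1 (\<lambda>z. v n z - u z) + H1_norm r0 r1 (\<lambda>z. x n z - w z)) \<longlonglongrightarrow> 0"
        using tendsto_add[OF v(3) x(3)] by simp
      have "norm (H1_norm r0 r1 (\<lambda>z. v n z + x n z - (u + w) z)) \<le> H1_norm r0 r1 (\<lambda>z. v n z - u z) + H1_norm r0 r1 (\<lambda>z. x n z - w z)" for n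
      proof -
        have "(\<lambda>z. v n z + x n z - (u + w) z) = (\<lambda>z. v n z - u z) + (\<lambda>z. x n z - w z)" by (auto simp: fun_eq_iff)
        then show ?thesis
          using H1.nrm_triangle[OF vH, of n n] H1.nrm_ge_0[OF H1.V_closed(2)[OF vH, of n n]]
          by (simp only: H1_nrm_eq[OF vH(1)] H1_nrm_eq[OF vH(2)] H1_nrm_eq[OF H1.V_closed(2)[OF vH]] real_norm_def abs_of_nonneg)
      qed
      then show "\<forall>\<^sub>F n in sequentially. norm (H1_norm r0 r1 (\<lambda>z. v n z + x n z - (u + w) z)) \<le> H1_norm r0 r1 (\<lambda>z. v n z - u z) + H1_norm r0 r1 (\<lambda>z. x n z - w z)"
        by simp
    qed
    show "(\<lambda>n. L2_norm Q (\<lambda>y. v n (p y) + x n (p y) - (T y + S y))) \<longlonglongrightarrow> 0"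
    proof (rule Lim_null_comparison)
      show "(\<lambda>n. L2_norm Q (\<lambda>y. v n (p y) - T y) + L2_norm Q (\<lambda>y. x n (p y) - S y)) \<longlonglongrightarrow> 0"
        using tendsto_add[OF v(4) x(4)] by simp
      have "norm (L2_norm Q (\<lambda>y. v n (p y) + x n (p y) - (T y + S y))) \<le> L2_norm Q (\<lambda>y. v n (p y) - T y) + L2_norm Q (\<lambda>y. x n (p y) - S y)" for n
        using L2_norm_triangle[OF L2_on_diff[OF L2_face[OF v(2)] v(1)] L2_on_diff[OF L2_face[OF x(2)] x(1)], of n n]
        by (simp add: algebra_simps)
      then show "\<forall>\<^sub>F n in sequentially. norm (L2_norm Q (\<lambda>y. v n (p y) + x n (p y) - (T y + S y))) \<le> L2_norm Q (\<lambda>y. v n (p y) - T y) + L2_norm Q (\<lambda>y. x n (p y) - S y)"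
        by simp
    qed
  qed
qed

lemma has_trace_scaleR:
  assumes u: "u \<in> H1 r0 r1" "has_trace r0 r1 Q p u T"
  shows "has_trace r0 r1 Q p (c *\<^sub>R u) (\<lambda>y. c * T y)"
proof -
  obtain v where v: "L2_on Q T" "\<And>n::nat. smooth_periodic (v n)"
    "(\<lambda>n. H1_norm r0 r1 (\<lambda>z. v n z - u z)) \<longlonglongrightarrow> 0" "(\<lambda>n. L2_norm Q (\<lambda>y. v n (p y) - T y)) \<longlonglongrightarrow> 0"
    using u(2) by (auto simp: has_trace_def)
  have vH: "(\<lambda>z. v n z - u z) \<in> H1 r0 r1" for n
    using H1.V_closed(3)[OF smooth_periodic_H1[OF v(2)] u(1)] by (simp add: fun_diff_def)
  show ?thesis unfolding has_trace_def
  proof (intro conjI exI[of _ "\<lambda>n z. c * v n z"] allI)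
    show "L2_on Q (\<lambda>y. c * T y)" by (intro L2_on_cmult v)
    show "smooth_periodic (\<lambda>z. c * v n z)" for n by (intro smooth_periodic_cmult v)
    have "H1_norm r0 r1 (\<lambda>z. c * v n z - (c *\<^sub>R u) z) = \<bar>c\<bar> * H1_norm r0 r1 (\<lambda>z. v n z - u z)" for n
    proof -
      have "(\<lambda>z. c * v n z - (c *\<^sub>R u) z) = c *\<^sub>R (\<lambda>z. v n z - u z)" by (auto simp: fun_eq_iff algebra_simps)
      then show ?thesis
        using H1.nrm_scaleR[OF vH, of c n] H1_nrm_eq[OF vH] H1_nrm_eq[OF H1.V_closed(4)[OF vH]] by simp
    qed
    then show "(\<lambda>n. H1_norm r0 r1 (\<lambda>z. c * v n z - (c *\<^sub>R u) z)) \<longlonglongrightarrow> 0"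
      using tendsto_mult_right_zero[OF v(3), of "\<bar>c\<bar>"] by simp
    have "L2_norm Q (\<lambda>y. c * v n (p y) - c * T y) = \<bar>c\<bar> * L2_norm Q (\<lambda>y. v n (p y) - T y)" for n
      using L2_norm_scaleR[OF L2_on_diff[OF L2_face[OF v(2)] v(1)], of c n] by (simp add: algebra_simps)
    then show "(\<lambda>n. L2_norm Q (\<lambda>y. c * v n (p y) - c * T y)) \<longlonglongrightarrow> 0"
      using tendsto_mult_right_zero[OF v(4), of "\<bar>c\<bar>"] by simp
  qed
qed

text \<open>By linearity the difference of two traces of \<open>u\<close> is a trace of
  \<open>0\<close>, and the trace bound makes it null.\<close>

lemma has_trace_unique:
  assumes u: "u \<in> H1 r0 r1" "has_trace r0 r1 Q p u T" "has_trace r0 r1 Q p u S"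
  shows "AE y in lebesgue_on Q. T y = S y"
proof -
  have L: "L2_on Q T" "L2_on Q S" using u by (auto simp: has_trace_def)
  note m = has_trace_scaleR[OF u(1,3), of "-1"]
  have "has_trace r0 r1 Q p (u + (-1) *\<^sub>R u) (\<lambda>y. T y + -1 * S y)"
    by (rule has_trace_add[OF u(1,2) H1.V_closed(4)[OF u(1)] m])
  then have t: "has_trace r0 r1 Q p 0 (\<lambda>y. T y - S y)" by simp
  have "H1_norm r0 r1 0 = 0" using H1_nrm_eq[of 0] by (simp add: H1.nrm_def)
  then have "L2_norm Q (\<lambda>y. T y - S y) \<le> 0" using has_trace_bound[OF _ t] by simp
  then have "L2_norm Q (\<lambda>y. T y - S y) = 0" by (simp add: antisym)
  from L2_norm_eq_0_AE[OF L2_on_diff[OF L] this] show ?thesis by simp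
qed

text \<open>The trace inequality turns smooth approximants that are Cauchy in \<open>H1\<close> into
  restrictions that are Cauchy in L2 of the face.\<close>

lemma has_trace_exists:
  assumes u: "u \<in> H1 r0 r1"
  shows "\<exists>T. has_trace r0 r1 Q p u T"
proof -
  obtain Y where Y: "\<forall>n. Y n \<in> span eigs" "(\<lambda>n. H1.nrm (Y n - u)) \<longlonglongrightarrow> 0" using span_eigs_dense[OF u] .
  have sm: "smooth_periodic (Y n)" for n using Y(1) span_eigs_smooth by blast
  note YH = smooth_periodic_H1[OF sm]
  obtain T where T: "L2_on Q T" "(\<lambda>n. L2_norm Q (\<lambda>y. Y n (p y) - T y)) \<longlonglongrightarrow> 0"
  proof (rule L2_complete[of Q "\<lambda>n y. Y n (p y)"])
    show "L2_on Q (\<lambda>y. Y n (p y))" for n by (rule L2_face[OF sm])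
    fix e :: real assume e: "e > 0"
    \<comment> \<open>The \<open>+ 1\<close> keeps the denominator positive when the trace bound is
      \<open>0\<close>; the factor \<open>2\<close> pays for the triangle inequality through
      \<open>u\<close>.\<close>
    define d where "d = e / (2 * (trace_bound + 1))"
    have d: "d > 0" using e trace_bound(1) by (simp add: d_def)
    obtain N where N: "\<And>n. n \<ge> N \<Longrightarrow> H1.nrm (Y n - u) < d"
      using order_tendstoD(2)[OF Y(2) d] by (auto simp: eventually_sequentially)
    have "L2_norm Q (\<lambda>y. Y m (p y) - Y n (p y)) < e" if "m \<ge> N" "n \<ge> N" for m n
    proof -
      have "L2_norm Q (\<lambda>y. Y m (p y) - Y n (p y)) \<le> trace_bound * H1_norm r0 r1 (Y m - Y n)"
        using trace_bound(2)[OF smooth_periodic_diff[OF sm sm], of m n] by (simp add: fun_diff_def)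
      also have "\<dots> = trace_bound * H1.nrm (Y m - Y n)" by (simp add: H1_nrm_eq YH)
      also have "\<dots> \<le> trace_bound * (2 * d)"
      proof (rule mult_left_mono[OF _ trace_bound(1)])
        have "H1.nrm (Y m - Y n) \<le> H1.nrm (Y m - u) + H1.nrm (u - Y n)" by (rule H1.nrm_triangle_diff[OF YH u YH])
        then show "H1.nrm (Y m - Y n) \<le> 2 * d"
          using N[OF that(1)] N[OF that(2)] H1.nrm_minus_commute[OF u YH, of n] by linarith
      qed
      also have "\<dots> < (trace_bound + 1) * (2 * d)" using d by simp
      also have "\<dots> = e" unfolding d_def using trace_bound(1) by (simp add: add_nonneg_eq_0_iff field_simps)
      finally show ?thesis .
    qed
    then show "\<exists>N. \<forall>m\<ge>N. \<forall>n\<ge>N. L2_norm Q (\<lambda>y. Y m (p y) - Y n (p y)) < e" by blast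
  qed
  have "H1_norm r0 r1 (\<lambda>z. Y n z - u z) = H1.nrm (Y n - u)" for n
    using H1_nrm_eq[OF H1.V_closed(3)[OF YH u]] by (simp add: fun_diff_def)
  then have "has_trace r0 r1 Q p u T" unfolding has_trace_def using T sm Y(2) by (auto intro!: exI[of _ Y])
  then show ?thesis by blast
qed

text \<open>If \<open>T\<close> is a trace of \<open>u\<close>, then \<open>- T\<close> is a trace
  of \<open>X n - u\<close>, so \<open>T\<close> is null. Admissibility asks for the zero function
  itself, hence the final replacement of \<open>T\<close> by \<open>0\<close>.\<close>

lemma has_trace_zero_closed:
  assumes X: "\<forall>n. X n \<in> H1 r0 r1" "\<forall>n. has_trace r0 r1 Q p (X n) (\<lambda>_. 0)"
    and u: "u \<in> H1 r0 r1" and lim: "(\<lambda>n. H1.nrm (X n - u)) \<longlonglongrightarrow> 0"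
  shows "has_trace r0 r1 Q p u (\<lambda>_. 0)"
proof -
  obtain T where T: "has_trace r0 r1 Q p u T" using has_trace_exists[OF u] by blast
  have L: "L2_on Q T" using T by (auto simp: has_trace_def)
  have "L2_norm Q T \<le> trace_bound * H1.nrm (X n - u)" for n
  proof -
    have "has_trace r0 r1 Q p (X n + (-1) *\<^sub>R u) (\<lambda>y. 0 + -1 * T y)"
      by (rule has_trace_add[OF X(1)[rule_format] X(2)[rule_format] H1.V_closed(4)[OF u] has_trace_scaleR[OF u T]])
    then have "has_trace r0 r1 Q p (X n - u) (\<lambda>y. - T y)" by simp
    from has_trace_bound[OF H1.V_closed(3)[OF X(1)[rule_format] u] this] show ?thesis
      using H1_nrm_eq[OF H1.V_closed(3)[OF X(1)[rule_format] u]] by simp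
  qed
  moreover have "(\<lambda>n. trace_bound * H1.nrm (X n - u)) \<longlonglongrightarrow> 0" by (rule tendsto_mult_right_zero[OF lim])
  ultimately have "L2_norm Q T \<le> 0" by (intro LIMSEQ_le_const) auto
  then have "L2_norm Q T = 0" by (simp add: antisym)
  from L2_norm_eq_0_AE[OF L this] have T0: "AE y in lebesgue_on Q. T y = 0" .
  obtain v where v: "\<And>n::nat. smooth_periodic (v n)"
    "(\<lambda>n. H1_norm r0 r1 (\<lambda>z. v n z - u z)) \<longlonglongrightarrow> 0" "(\<lambda>n. L2_norm Q (\<lambda>y. v n (p y) - T y)) \<longlonglongrightarrow> 0"
    using T by (auto simp: has_trace_def)
  have "L2_norm Q (\<lambda>y. v n (p y) - T y) = L2_norm Q (\<lambda>y. v n (p y) - 0)" for n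
    by (rule L2_norm_AE_cong) (use T0 in eventually_elim, simp_all add: L2_on_measurable L2_on_diff L2_face v L)
  then show ?thesis unfolding has_trace_def using v by auto
qed

text \<open>\<open>SOME\<close> chooses a trace for each function separately; uniqueness almost
  everywhere makes the pairing with \<open>g\<close> linear nonetheless.\<close>

lemma trace_pairing:
  assumes g: "L2_on Q g"
  defines "tr \<equiv> \<lambda>u. \<integral>y. g y * (SOME T. has_trace r0 r1 Q p u T) y \<partial>(lebesgue_on Q)"
  shows "\<lbrakk>u \<in> H1 r0 r1; w \<in> H1 r0 r1\<rbrakk> \<Longrightarrow> tr (u + w) = tr u + tr w"
    "u \<in> H1 r0 r1 \<Longrightarrow> tr (c *\<^sub>R u) = c * tr u"
    "u \<in> H1 r0 r1 \<Longrightarrow> \<bar>tr u\<bar> \<le> trace_bound * L2_norm Q g * H1_norm r0 r1 u"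
proof -
  define T where "T u = (SOME T. has_trace r0 r1 Q p u T)" for u
  have T: "has_trace r0 r1 Q p u (T u)" "L2_on Q (T u)" if "u \<in> H1 r0 r1" for u
  proof -
    show "has_trace r0 r1 Q p u (T u)" using has_trace_exists[OF that] unfolding T_def by (rule someI_ex)
    then show "L2_on Q (T u)" by (simp add: has_trace_def)
  qed
  have tr: "tr u = (\<integral>y. g y * T u y \<partial>(lebesgue_on Q))" for u by (simp add: tr_def T_def)
  have m: "(\<lambda>y. g y * T u y) \<in> borel_measurable (lebesgue_on Q)" if "u \<in> H1 r0 r1" for u
    by (rule borel_measurable_integrable[OF L2_mult_integrable[OF g T(2)[OF that]]])
  show "tr (u + w) = tr u + tr w" if u: "u \<in> H1 r0 r1" and w: "w \<in> H1 r0 r1"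
  proof -
    note uw = H1.V_closed(2)[OF u w]
    have "tr (u + w) = (\<integral>y. g y * T u y + g y * T w y \<partial>(lebesgue_on Q))"
      unfolding tr
    proof (rule integral_cong_AE)
      show "AE y in lebesgue_on Q. g y * T (u + w) y = g y * T u y + g y * T w y"
        using has_trace_unique[OF uw T(1)[OF uw] has_trace_add[OF u T(1)[OF u] w T(1)[OF w]]]
        by eventually_elim (simp add: distrib_left)
    qed (use m u w uw in auto)
    also have "\<dots> = tr u + tr w"
      unfolding tr using L2_mult_integrable[OF g T(2)[OF u]] L2_mult_integrable[OF g T(2)[OF w]] by simp
    finally show ?thesis .
  qed
  show "tr (c *\<^sub>R u) = c * tr u" if u: "u \<in> H1 r0 r1"
  proof -
    note cu = H1.V_closed(4)[OF u, of c]
    have "tr (c *\<^sub>R u) = (\<integral>y. c * (g y * T u y) \<partial>(lebesgue_on Q))"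
      unfolding tr
    proof (rule integral_cong_AE)
      show "AE y in lebesgue_on Q. g y * T (c *\<^sub>R u) y = c * (g y * T u y)"
        using has_trace_unique[OF cu T(1)[OF cu] has_trace_scaleR[OF u T(1)[OF u]]] by eventually_elim simp
    qed (use m u cu in auto)
    then show ?thesis by (simp add: tr)
  qed
  show "\<bar>tr u\<bar> \<le> trace_bound * L2_norm Q g * H1_norm r0 r1 u" if u: "u \<in> H1 r0 r1"
  proof -
    have "\<bar>tr u\<bar> \<le> L2_norm Q g * L2_norm Q (T u)" using L2_Cauchy_Schwarz[OF g T(2)[OF u]] by (simp add: tr)
    also have "\<dots> \<le> L2_norm Q g * (trace_bound * H1_norm r0 r1 u)"
      by (intro mult_left_mono has_trace_bound[OF u T(1)[OF u]]) simp
    finally show ?thesis by (simp add: mult_ac)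
  qed
qed

end

end

section \<open>Subsonicity of the background flow\<close>

lemma smooth_on_Icc_derivative:
  assumes "smooth_on_Icc a b f"
  obtains f' where "\<And>x. x \<in> {a..b} \<Longrightarrow> (f has_real_derivative f' x) (at x within {a..b})"
proof -
  obtain D where D: "\<forall>x\<in>{a..b}. D 0 x = f x" "\<forall>n. \<forall>x\<in>{a..b}. (D n has_real_derivative D (Suc n) x) (at x within {a..b})"
    using assms by (auto simp: smooth_on_Icc_def)
  have "(f has_real_derivative D (Suc 0) x) (at x within {a..b})" if "x \<in> {a..b}" for x
    by (rule has_field_derivative_transform_within[OF D(2)[rule_format, OF that] zero_less_one that]) (use D(1) in auto)
  then show thesis by (rule that)
qed

lemma vector_derivative_Icc:
  fixes f :: "real \<Rightarrow> real"
  assumes "a < b" "x \<in> {a..b}" "(f has_real_derivative d) (at x within {a..b})"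
  shows "vector_derivative f (at x within {a..b}) = d"
  using vector_derivative_within_cbox[of a b x f d] assms
  by (simp add: has_real_derivative_iff_has_vector_derivative)

text \<open>The sign is asked only on the open interval, because in the application \<open>t\<close>
  is the first point where the required positivity may fail.\<close>

lemma nondecreasing_if_derivative_nonneg:
  fixes f :: "real \<Rightarrow> real"
  assumes d: "\<And>x. x \<in> {a..b} \<Longrightarrow> (f has_real_derivative f' x) (at x within {a..b})"
    and t: "a \<le> t" "t \<le> b" and nn: "\<And>x. \<lbrakk>a < x; x < t\<rbrakk> \<Longrightarrow> 0 \<le> f' x"
  shows "f a \<le> f t"
proof (rule DERIV_nonneg_imp_increasing_open[OF t(1)])
  show "continuous_on {a..t} f"
    using t by (intro continuous_on_subset[OF DERIV_continuous_on[OF d]]) auto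
  fix x assume x: "a < x" "x < t"
  have "(f has_real_derivative f' x) (at x within {a<..<b})"
    by (rule has_field_derivative_subset[OF d]) (use x t in auto)
  then have "(f has_real_derivative f' x) (at x)"
    using x t by (subst (asm) at_within_open) auto
  then show "\<exists>y. (f has_real_derivative y) (at x) \<and> 0 \<le> y" using nn[OF x] by blast
qed

text \<open>Three inequalities sustain one another. Subsonicity and \<open>E > 0\<close> make
  \<open>\<rho>\<close> increase; \<open>\<rho> > b0\<close> makes \<open>x * E x\<close> increase;
  and a larger density raises the sound speed while the conserved fluxes force the velocities
  down.\<close>

lemma background_subsonic:
  assumes \<gamma>: "\<gamma> > 1" and r: "0 < r0" "r0 < r1"
    and bg: "background_flow \<gamma> r0 r1 b0 \<rho>0 U10 U20 A0 E0 \<rho> U1 U2 A E"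
  shows "\<And>x. x \<in> {r0..r1} \<Longrightarrow> (U1 x)\<^sup>2 + (U2 x)\<^sup>2 < \<gamma> * A0 * \<rho> x powr (\<gamma> - 1)"
    "\<And>x. x \<in> {r0..r1} \<Longrightarrow> \<rho> x > 0" "A0 > 0"
    "continuous_on {r0..r1} \<rho>" "continuous_on {r0..r1} U1" "continuous_on {r0..r1} U2"
proof -
  let ?I = "{r0..r1}"
  note bg' = bg[unfolded background_flow_def Let_def]
  obtain \<rho>' where d\<rho>: "\<And>x. x \<in> ?I \<Longrightarrow> (\<rho> has_real_derivative \<rho>' x) (at x within ?I)"
    using smooth_on_Icc_derivative[of r0 r1 \<rho>] bg' by blast
  obtain U1' where dU1: "\<And>x. x \<in> ?I \<Longrightarrow> (U1 has_real_derivative U1' x) (at x within ?I)"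
    using smooth_on_Icc_derivative[of r0 r1 U1] bg' by blast
  obtain U2' where dU2: "\<And>x. x \<in> ?I \<Longrightarrow> (U2 has_real_derivative U2' x) (at x within ?I)"
    using smooth_on_Icc_derivative[of r0 r1 U2] bg' by blast
  obtain E' where dE: "\<And>x. x \<in> ?I \<Longrightarrow> (E has_real_derivative E' x) (at x within ?I)"
    using smooth_on_Icc_derivative[of r0 r1 E] bg' by blast
  have pos: "\<rho> x > 0" "U1 x > 0" "A x = A0" if "x \<in> ?I" for x using bg' that by auto
  have init: "\<rho> r0 = \<rho>0" "U1 r0 = U10" "U2 r0 = U20" "E r0 = E0" "\<rho>0 > b0" "b0 > 0" "U10 > 0" "A0 > 0" "E0 > 0"
    "\<gamma> * A0 * \<rho>0 powr (\<gamma> - 1) > U10\<^sup>2 + U20\<^sup>2" using bg' by auto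
  have xp: "x > 0" if "x \<in> ?I" for x using that r by auto
  show c\<rho>: "continuous_on ?I \<rho>" and cU1: "continuous_on ?I U1" and cU2: "continuous_on ?I U2"
    using DERIV_continuous_on d\<rho> dU1 dU2 by blast+
  have cE: "continuous_on ?I E" using DERIV_continuous_on dE by blast
  show "\<And>x. x \<in> ?I \<Longrightarrow> \<rho> x > 0" "A0 > 0" using pos init by auto
  define c2 where "c2 x = \<gamma> * A0 * \<rho> x powr (\<gamma> - 1)" for x
  have vd: "vector_derivative f (at x within ?I) = d" if "x \<in> ?I" "(f has_real_derivative d) (at x within ?I)" for f d x
    by (rule vector_derivative_Icc[OF r(2) that])
  have ode1: "\<rho> x * U1 x + x * \<rho>' x * U1 x + x * \<rho> x * U1' x = 0" if x: "x \<in> ?I" for x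
  proof -
    have "((\<lambda>s. s * \<rho> s * U1 s) has_real_derivative \<rho> x * U1 x + x * \<rho>' x * U1 x + x * \<rho> x * U1' x) (at x within ?I)"
      by (auto intro!: derivative_eq_intros d\<rho>[OF x] dU1[OF x] simp: algebra_simps)
    from vd[OF x this] show ?thesis using bg' x by simp
  qed
  have ode2: "U1 x * U1' x + c2 x * \<rho>' x / \<rho> x - (U2 x)\<^sup>2 / x = E x" if x: "x \<in> ?I" for x
  proof -
    have "((\<lambda>s. A0 * \<rho> s powr \<gamma>) has_real_derivative c2 x * \<rho>' x) (at x within ?I)"
      using pos(1)[OF x] by (auto intro!: derivative_eq_intros d\<rho>[OF x] simp: c2_def)
    then have "((\<lambda>s. A s * \<rho> s powr \<gamma>) has_real_derivative c2 x * \<rho>' x) (at x within ?I)"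
      by (rule has_field_derivative_transform_within[OF _ zero_less_one x]) (simp add: pos(3))
    note v = vd[OF x this] vd[OF x dU1[OF x]]
    have "U1 x * vector_derivative U1 (at x within ?I) + 1 / \<rho> x * vector_derivative (\<lambda>s. A s * \<rho> s powr \<gamma>) (at x within ?I)
        - 1 / x * (U2 x)\<^sup>2 = E x" using bg' x by blast
    then show ?thesis unfolding v by simp
  qed
  have ode3: "U2 x + x * U2' x = 0" if x: "x \<in> ?I" for x
  proof -
    have "U1 x * vector_derivative U2 (at x within ?I) + 1 / x * U1 x * U2 x = 0" using bg' x by blast
    then have "U1 x * U2' x + 1 / x * U1 x * U2 x = 0" unfolding vd[OF x dU2[OF x]] .
    then have "U1 x * (U2 x + x * U2' x) = 0" using xp[OF x] by (simp add: field_simps)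
    then show ?thesis using pos(2)[OF x] by simp
  qed
  have ode5: "E x + x * E' x = x * (\<rho> x - b0)" if x: "x \<in> ?I" for x
  proof -
    have "vector_derivative E (at x within ?I) + 1 / x * E x = \<rho> x - b0" using bg' x by blast
    then have "E' x + 1 / x * E x = \<rho> x - b0" unfolding vd[OF x dE[OF x]] .
    then show ?thesis using xp[OF x] by (simp add: field_simps)
  qed
  \<comment> \<open>Elimination of \<open>U1'\<close> between conservation of mass and the momentum
    equation. While the flow is subsonic the factor of \<open>\<rho>' x\<close> is positive, so the
    sign of the density derivative can be read off.\<close>
  have key: "(c2 x - (U1 x)\<^sup>2) * \<rho>' x = \<rho> x * (E x + ((U1 x)\<^sup>2 + (U2 x)\<^sup>2) / x)" if x: "x \<in> ?I" for x
  proof -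
    have u: "U1' x = - U1 x / x - U1 x * \<rho>' x / \<rho> x"
    proof -
      have "x * \<rho> x * U1' x = - (\<rho> x * U1 x + x * \<rho>' x * U1 x)" using ode1[OF x] by simp
      then have "U1' x = - (\<rho> x * U1 x + x * \<rho>' x * U1 x) / (x * \<rho> x)"
        using xp[OF x] pos(1)[OF x] by (simp add: field_simps)
      then show ?thesis using xp[OF x] pos(1)[OF x] by (simp add: field_simps)
    qed
    have "E x = U1 x * (- U1 x / x - U1 x * \<rho>' x / \<rho> x) + c2 x * \<rho>' x / \<rho> x - (U2 x)\<^sup>2 / x"
      using ode2[OF x] u by simp
    \<comment> \<open>With \<open>inverse\<close> and its defining relation the claim becomes a
      polynomial identity, which \<open>algebra\<close> can settle.\<close>
    moreover have "\<rho> x * inverse (\<rho> x) = 1" using pos(1)[OF x] by simp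
    ultimately show ?thesis unfolding divide_inverse by algebra
  qed
  \<comment> \<open>The first integrals of the system, the fluxes of mass and of angular momentum.
    As \<open>x\<close> and the density grow, the velocities cannot.\<close>
  have "\<exists>c. \<forall>x\<in>?I. x * \<rho> x * U1 x = c"
  proof (rule has_field_derivative_zero_constant)
    fix x assume x: "x \<in> ?I"
    show "((\<lambda>x. x * \<rho> x * U1 x) has_real_derivative 0) (at x within ?I)"
      using ode1[OF x] by (auto intro!: derivative_eq_intros d\<rho>[OF x] dU1[OF x] simp: algebra_simps)
  qed simp
  then have const1: "x * \<rho> x * U1 x = r0 * \<rho>0 * U10" if "x \<in> ?I" for x
    using that r init by (metis atLeastAtMost_iff less_imp_le order_refl)
  have "\<exists>c. \<forall>x\<in>?I. x * U2 x = c"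
  proof (rule has_field_derivative_zero_constant)
    fix x assume x: "x \<in> ?I"
    show "((\<lambda>x. x * U2 x) has_real_derivative 0) (at x within ?I)"
      using ode3[OF x] by (auto intro!: derivative_eq_intros dU2[OF x] simp: algebra_simps)
  qed simp
  then have const2: "x * U2 x = r0 * U20" if "x \<in> ?I" for x
    using that r init by (metis atLeastAtMost_iff less_imp_le order_refl)
  define q where "q x = c2 x - (U1 x)\<^sup>2 - (U2 x)\<^sup>2" for x
  \<comment> \<open>The three margins that must stay positive, bundled so that a single first point
    of failure serves all of them.\<close>
  define m where "m x = min (q x) (min (\<rho> x - b0) (E x))" for x
  have cc2: "continuous_on ?I c2"
    unfolding c2_def by (intro continuous_intros c\<rho>) (use pos in force)+
  have cm: "continuous_on ?I m"
    unfolding m_def q_def by (intro continuous_intros cc2 cU1 cU2 c\<rho> cE)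
  txt \<open>At the first point where \<open>m\<close> fails to be positive, the monotonicity up to that point gives a contradiction.\<close>
  have mpos: "m x > 0" if x: "x \<in> ?I" for x
  proof (rule ccontr)
    assume neg: "\<not> m x > 0"
    define Z where "Z = {x \<in> ?I. m x \<le> 0}"
    have "Z = ?I \<inter> m -` {..0}" by (auto simp: Z_def)
    then have "closed Z" using continuous_closed_preimage[OF cm, of "{..0}"] by simp
    moreover have "bounded Z" by (rule bounded_subset[of ?I]) (auto simp: Z_def)
    moreover have "Z \<noteq> {}" using neg x by (auto simp: Z_def)
    ultimately obtain t where t: "t \<in> Z" "\<And>s. s \<in> Z \<Longrightarrow> t \<le> s"
      using compact_attains_inf[of Z] by (auto simp: compact_eq_bounded_closed)
    have tI: "t \<in> ?I" and mt: "m t \<le> 0" using t(1) by (auto simp: Z_def)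
    have t2: "r0 \<le> t" "t \<le> r1" "t > 0" using tI r by auto
    \<comment> \<open>For \<open>t = r0\<close> the interval before \<open>t\<close> is empty and
      the comparisons with the data are trivial, so the initial point needs no separate
      treatment.\<close>
    have before: "q s > 0" "\<rho> s > b0" "E s > 0" if "r0 < s" "s < t" for s
    proof -
      have "m s > 0" using t(2)[of s] that t2 by (force simp: Z_def not_le)
      then show "q s > 0" "\<rho> s > b0" "E s > 0" by (auto simp: m_def)
    qed
    have \<rho>t: "\<rho>0 \<le> \<rho> t"
      unfolding init(1)[symmetric]
    proof (rule nondecreasing_if_derivative_nonneg[OF d\<rho> t2(1,2)])
      fix s assume s: "r0 < s" "s < t"
      then have sI: "s \<in> ?I" using t2 by auto
      have "c2 s - (U1 s)\<^sup>2 > 0" using before(1)[OF s] zero_le_power2[of "U2 s"] unfolding q_def by linarith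
      moreover have "0 \<le> (c2 s - (U1 s)\<^sup>2) * \<rho>' s" unfolding key[OF sI]
        using before(3)[OF s] pos(1)[OF sI] xp[OF sI] by (intro mult_nonneg_nonneg add_nonneg_nonneg divide_nonneg_pos) auto
      ultimately show "0 \<le> \<rho>' s" by (simp add: zero_le_mult_iff)
    qed
    have "r0 * E r0 \<le> t * E t"
    proof (rule nondecreasing_if_derivative_nonneg[where f'="\<lambda>x. E x + x * E' x", OF _ t2(1,2)])
      fix s assume "s \<in> ?I"
      then show "((\<lambda>x. x * E x) has_real_derivative E s + s * E' s) (at s within ?I)"
        by (auto intro!: derivative_eq_intros dE)
    next
      fix s assume s: "r0 < s" "s < t"
      then have "s \<in> ?I" using t2 by auto
      then show "0 \<le> E s + s * E' s" using ode5 before(2)[OF s] xp[of s] by (simp add: less_imp_le)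
    qed
    moreover have "r0 * E r0 > 0" using r init by simp
    ultimately have "0 < t * E t" by linarith
    then have Et: "E t > 0" using t2(3) by (rule zero_less_mult_pos)
    have "U1 t \<le> U10"
    proof -
      have "t * \<rho> t * U1 t = r0 * \<rho>0 * U10" by (rule const1[OF tI])
      also have "\<dots> \<le> t * \<rho> t * U10"
        using \<rho>t t2 r init by (intro mult_right_mono mult_mono) auto
      finally show ?thesis using t2(3) pos(1)[OF tI] by simp
    qed
    then have U1t: "(U1 t)\<^sup>2 \<le> U10\<^sup>2" using pos(2)[OF tI] by (intro power_mono) auto
    have "\<bar>U2 t\<bar> \<le> \<bar>U20\<bar>"
    proof -
      have "t * \<bar>U2 t\<bar> = r0 * \<bar>U20\<bar>" using arg_cong[OF const2[OF tI], of abs] t2(3) r by (simp add: abs_mult)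
      also have "\<dots> \<le> t * \<bar>U20\<bar>" using t2 by (intro mult_right_mono) auto
      finally show ?thesis using t2(3) by simp
    qed
    then have U2t: "(U2 t)\<^sup>2 \<le> U20\<^sup>2" by (simp add: abs_le_square_iff)
    have "\<rho>0 powr (\<gamma> - 1) \<le> \<rho> t powr (\<gamma> - 1)" using \<rho>t \<gamma> init by (intro powr_mono2) auto
    then have "\<gamma> * A0 * \<rho>0 powr (\<gamma> - 1) \<le> c2 t" unfolding c2_def using \<gamma> init by (intro mult_left_mono) auto
    then have "q t > 0" using U1t U2t init(10) unfolding q_def by linarith
    then show False using mt Et \<rho>t init(5) by (auto simp: m_def min_def split: if_splits)
  qed
  show "(U1 x)\<^sup>2 + (U2 x)\<^sup>2 < \<gamma> * A0 * \<rho> x powr (\<gamma> - 1)" if "x \<in> ?I" for x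
  proof -
    have "q x > 0" using mpos[OF that] by (simp add: m_def)
    then show ?thesis unfolding q_def c2_def by linarith
  qed
qed

section \<open>The variational problem\<close>

lemma L2_on_continuous_compact:
  fixes f :: "'a::euclidean_space \<Rightarrow> 'b::euclidean_space"
  assumes f: "continuous_on K f" and K: "compact K" "S \<subseteq> K" and S: "S \<in> sets borel"
  shows "L2_on S f"
proof -
  obtain B where B: "\<And>x. x \<in> K \<Longrightarrow> norm (f x) \<le> B"
    using compact_imp_bounded[OF compact_continuous_image[OF f K(1)]] by (auto simp: bounded_iff)
  show ?thesis
  proof (rule L2_onI)
    show "f \<in> borel_measurable (lebesgue_on S)"
      by (rule continuous_imp_measurable_on_sets_lebesgue[OF continuous_on_subset[OF f K(2)]]) (use S in simp)
    show "integrable (lebesgue_on S) (\<lambda>_. B\<^sup>2)"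
      by (rule integrable_on_continuous[OF S bounded_subset[OF compact_imp_bounded[OF K(1)] K(2)]]) simp
    show "AE x in lebesgue_on S. (norm (f x))\<^sup>2 \<le> B\<^sup>2"
      using B K(2) by (intro AE_I2 power_mono) auto
  qed
qed

lemma holder_on_continuous:
  assumes "holder_on \<beta> S f" "\<beta> > 0"
  shows "continuous_on S f"
  unfolding continuous_on_def
proof
  fix x assume x: "x \<in> S"
  obtain K where K: "\<forall>x\<in>S. \<forall>y\<in>S. dist (f x) (f y) \<le> K * dist x y powr \<beta>"
    using assms(1) by (auto simp: holder_on_def)
  have "((\<lambda>y. dist y x) \<longlongrightarrow> dist x x) (at x within S)" by (intro tendsto_intros)
  then have "((\<lambda>y. dist y x powr \<beta>) \<longlongrightarrow> 0) (at x within S)"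
    using assms(2) by (intro tendsto_zero_powrI[where b=\<beta>]) auto
  then have "((\<lambda>y. K * dist y x powr \<beta>) \<longlongrightarrow> 0) (at x within S)" by (rule tendsto_mult_right_zero)
  then have "((\<lambda>y. dist (f y) (f x)) \<longlongrightarrow> 0) (at x within S)"
    by (rule Lim_null_comparison[rotated]) (use K x in \<open>auto simp: eventually_at intro!: exI[of _ 1]\<close>)
  then show "(f \<longlongrightarrow> f x) (at x within S)" by (rule iffD2[OF tendsto_dist_iff])
qed

lemma C1_holder_on_continuous:
  assumes "C1_holder_on \<beta> S f"
  shows "continuous_on S f"
proof -
  obtain f' where "\<forall>x\<in>S. (f has_derivative blinfun_apply (f' x)) (at x within S)"
    using assms by (auto simp: C1_holder_on_def)
  then show ?thesis by (intro has_derivative_continuous_on[of S f "\<lambda>x. blinfun_apply (f' x)"]) simp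
qed

text \<open>Hoelder data are continuous up to the boundary, hence bounded on the compact closures of
  the cell and of its faces.\<close>

lemma (in strip) regular_data_L2:
  assumes "regular_data \<beta> r0 r1 F G g0 g1" "0 < \<beta>"
  shows "L2_on \<Omega> F" "L2_on \<Omega> G"
    "L2_on cell_end (\<lambda>y. g0 y - F (end_pt r0 y) $ 1)" "L2_on cell_end (\<lambda>y. g1 y - F (end_pt r1 y) $ 1)"
    "L2_on (cell_wall r0 r1) (\<lambda>y. F (wall_pt 1 y) $ 3)" "L2_on (cell_wall r0 r1) (\<lambda>y. F (wall_pt (-1) y) $ 3)"
proof -
  have F: "continuous_on (Omega_bar r0 r1) F" and G: "continuous_on (Omega_bar r0 r1) G"
    and g: "continuous_on closed_end g0" "continuous_on closed_end g1"
  proof -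
    have "C1_holder_on \<beta> (Omega_bar r0 r1) F" "holder_on \<beta> (Omega_bar r0 r1) G"
      "C1_holder_on \<beta> closed_end g0" "C1_holder_on \<beta> closed_end g1"
      using assms by (simp_all add: regular_data_def)
    then show "continuous_on (Omega_bar r0 r1) F" "continuous_on (Omega_bar r0 r1) G"
      "continuous_on closed_end g0" "continuous_on closed_end g1"
      by (simp_all add: C1_holder_on_continuous holder_on_continuous[OF _ assms(2)])
  qed
  let ?K = "cbox (vector [r0, 0, -1]) (vector [r1, 2 * pi, 1]) :: (real ^ 3) set"
  have K: "?K \<subseteq> Omega_bar r0 r1" "\<Omega> \<subseteq> ?K"
    by (auto simp: Omega_bar_def Omega_box mem_box_cart forall_3)
  show "L2_on \<Omega> F" "L2_on \<Omega> G"
    by (rule L2_on_continuous_compact[OF continuous_on_subset[OF F K(1)] compact_cbox K(2) Omega_sets(1)],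
        rule L2_on_continuous_compact[OF continuous_on_subset[OF G K(1)] compact_cbox K(2) Omega_sets(1)])
  let ?E = "{0..2 * pi} \<times> {-1..1::real}" and ?W = "{r0..r1} \<times> {0..2 * pi}"
  have E: "compact ?E" "cell_end \<subseteq> ?E" "?E \<subseteq> closed_end" and W: "compact ?W" "cell_wall r0 r1 \<subseteq> ?W"
    by (auto simp: cell_end_def cell_wall_def closed_end_def intro!: compact_Times)
  have "continuous_on ?E (\<lambda>y. F (end_pt r y))" if "r0 \<le> r" "r \<le> r1" for r
    by (rule continuous_on_compose2[OF F end_pt_continuous]) (use that in \<open>auto simp: end_pt_def Omega_bar_def\<close>)
  then show "L2_on cell_end (\<lambda>y. g0 y - F (end_pt r0 y) $ 1)" "L2_on cell_end (\<lambda>y. g1 y - F (end_pt r1 y) $ 1)"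
    using r0_less by (auto intro!: L2_on_continuous_compact[OF _ E(1,2)] continuous_intros continuous_on_subset[OF g(1) E(3)]
        continuous_on_subset[OF g(2) E(3)])
  have "continuous_on ?W (\<lambda>y. F (wall_pt s y))" if "-1 \<le> s" "s \<le> 1" for s
    by (rule continuous_on_compose2[OF F wall_pt_continuous]) (use that in \<open>auto simp: wall_pt_def Omega_bar_def\<close>)
  then show "L2_on (cell_wall r0 r1) (\<lambda>y. F (wall_pt 1 y) $ 3)" "L2_on (cell_wall r0 r1) (\<lambda>y. F (wall_pt (-1) y) $ 3)"
    by (auto intro!: L2_on_continuous_compact[OF _ W] continuous_intros)
qed

section \<open>The Hilbert space of admissible pairs and the functional on it\<close>

context strip
begin

type_synonym jets = "(real \<times> (real ^ 3)) \<times> (real \<times> (real ^ 3))"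

definition jets :: "(real ^ 3 \<Rightarrow> real) \<times> (real ^ 3 \<Rightarrow> real) \<Rightarrow> real ^ 3 \<Rightarrow> jets" where
  "jets u z = (jet (fst u) z, jet (snd u) z)"

lemma admissible_D:
  assumes "u \<in> admissible r0 r1"
  shows "fst u \<in> H1 r0 r1" "snd u \<in> H1 r0 r1" "(\<integral>z. fst u z \<partial>(lebesgue_on \<Omega>)) = 0"
    "has_trace r0 r1 cell_end (end_pt r0) (snd u) (\<lambda>_. 0)" "has_trace r0 r1 cell_end (end_pt r1) (snd u) (\<lambda>_. 0)"
  using assms by (auto simp: admissible_def)

lemma H1_nrm_diff_jet:
  assumes "u \<in> H1 r0 r1" "v \<in> H1 r0 r1"
  shows "H1.nrm (u - v) = L2_norm \<Omega> (\<lambda>z. jet u z - jet v z)"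
proof -
  note uv = H1.V_closed(3)[OF assms]
  have "AE z in lebesgue_on \<Omega>. jet (u - v) z = jet u z - jet v z"
    using jet_add[OF uv assms(2)] by eventually_elim simp
  then show ?thesis unfolding H1_nrm_eq[OF uv] L2_norm_jet[OF uv, symmetric]
    by (rule L2_norm_AE_cong) (intro L2_on_measurable L2_on_diff L2_jet uv assms)+
qed

lemma L2_jets: "u \<in> admissible r0 r1 \<Longrightarrow> L2_on \<Omega> (jets u)"
  unfolding jets_def using admissible_D[of u] by (simp add: L2_on_Pair_iff L2_jet)

lemma subspace_admissible: "subspace (admissible r0 r1)"
proof (rule subspaceI)
  \<comment> \<open>Some trace of \<open>0\<close> exists by the general theory; scaling it by
    \<open>0\<close> yields the zero function.\<close>
  have "has_trace r0 r1 Q p 0 (\<lambda>_. 0)" if face: "face Q p" for Q p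
  proof -
    obtain T where "has_trace r0 r1 Q p 0 T" using has_trace_exists[OF face H1.V_closed(1)] by blast
    from has_trace_scaleR[OF face H1.V_closed(1) this, of 0] show ?thesis by simp
  qed
  then show "0 \<in> admissible r0 r1"
    using face_end H1.V_closed(1) by (auto simp: admissible_def zero_prod_def) (simp add: zero_fun_def)
next
  fix u v assume uv: "u \<in> admissible r0 r1" "v \<in> admissible r0 r1"
  note u = admissible_D[OF uv(1)] and v = admissible_D[OF uv(2)]
  have "has_trace r0 r1 cell_end (end_pt r) (snd u + snd v) (\<lambda>_. 0)" if "r = r0 \<or> r = r1" for r
    using that has_trace_add[OF face_end(1) u(2,4) v(2,4)] has_trace_add[OF face_end(2) u(2,5) v(2,5)] by auto
  moreover have "(\<integral>z. (fst u + fst v) z \<partial>(lebesgue_on \<Omega>)) = 0"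
    using u(3) v(3) L2_Omega_integrable[OF H1_D(1)[OF u(1)]] L2_Omega_integrable[OF H1_D(1)[OF v(1)]] by simp
  ultimately show "u + v \<in> admissible r0 r1"
    using u(1,2) v(1,2) by (auto simp: admissible_def split_beta plus_prod_def simp del: plus_fun_apply)
next
  fix c u assume u: "u \<in> admissible r0 r1"
  note u = admissible_D[OF u]
  have "has_trace r0 r1 cell_end (end_pt r) (c *\<^sub>R snd u) (\<lambda>_. 0)" if "r = r0 \<or> r = r1" for r
    using that has_trace_scaleR[OF face_end(1) u(2,4), of c] has_trace_scaleR[OF face_end(2) u(2,5), of c] by auto
  moreover have "(\<integral>z. (c *\<^sub>R fst u) z \<partial>(lebesgue_on \<Omega>)) = 0" using u(3) by simp
  ultimately show "c *\<^sub>R u \<in> admissible r0 r1"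
    using u(1,2) by (auto simp: admissible_def split_beta scaleR_prod_def simp del: scaleR_fun_apply)
qed

lemma jets_add:
  assumes "u \<in> admissible r0 r1" "v \<in> admissible r0 r1"
  shows "AE z in lebesgue_on \<Omega>. jets (u + v) z = jets u z + jets v z"
  using jet_add[OF admissible_D(1)[OF assms(1)] admissible_D(1)[OF assms(2)]]
    jet_add[OF admissible_D(2)[OF assms(1)] admissible_D(2)[OF assms(2)]]
  by eventually_elim (simp add: jets_def)

lemma jets_scaleR:
  assumes "u \<in> admissible r0 r1"
  shows "AE z in lebesgue_on \<Omega>. jets (c *\<^sub>R u) z = c *\<^sub>R jets u z"
  using jet_scaleR[OF admissible_D(1)[OF assms], of c] jet_scaleR[OF admissible_D(2)[OF assms], of c]
  by eventually_elim (simp add: jets_def)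

text \<open>Each constraint survives \<open>H1\<close> convergence: the mean by continuity of the
  integral, the boundary values by \<open>has_trace_zero_closed\<close>. The two components of the
  limit are recovered separately from their jets.\<close>

lemma admissible_closed:
  assumes X: "\<forall>n. X n \<in> admissible r0 r1" and L: "L2_on \<Omega> L" "(\<lambda>n. L2_norm \<Omega> (\<lambda>z. jets (X n) z - L z)) \<longlonglongrightarrow> 0"
  shows "\<exists>u\<in>admissible r0 r1. AE z in lebesgue_on \<Omega>. jets u z = L z"
proof -
  define f g where "f = (\<lambda>z. fst (L z))" and "g = (\<lambda>z. snd (L z))"
  have L': "L = (\<lambda>z. (f z, g z))" by (simp add: f_def g_def)
  have fg: "L2_on \<Omega> f" "L2_on \<Omega> g" using L(1) unfolding L' L2_on_Pair_iff by auto
  note XH = admissible_D[OF X[rule_format]]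
  have d: "(\<lambda>z. jets (X n) z - L z) = (\<lambda>z. (jet (fst (X n)) z - f z, jet (snd (X n)) z - g z))" for n
    by (simp add: jets_def L')
  have Ld: "L2_on \<Omega> (\<lambda>z. (jet (fst (X n)) z - f z, jet (snd (X n)) z - g z))" for n
    unfolding L2_on_Pair_iff by (intro conjI L2_on_diff L2_jet XH fg)
  have lf: "(\<lambda>n. L2_norm \<Omega> (\<lambda>z. jet (fst (X n)) z - f z)) \<longlonglongrightarrow> 0"
    by (rule Lim_null_comparison[OF _ L(2)]) (use L2_norm_fst_le[OF Ld] in \<open>auto simp: d\<close>)
  have lg: "(\<lambda>n. L2_norm \<Omega> (\<lambda>z. jet (snd (X n)) z - g z)) \<longlonglongrightarrow> 0"
    by (rule Lim_null_comparison[OF _ L(2)]) (use L2_norm_snd_le[OF Ld] in \<open>auto simp: d\<close>)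
  obtain \<psi> where \<psi>: "\<psi> \<in> H1 r0 r1" "AE z in lebesgue_on \<Omega>. jet \<psi> z = f z"
    using H1_jet_closed[of "\<lambda>n. fst (X n)" f] XH(1) fg(1) lf by blast
  obtain \<phi> where \<phi>: "\<phi> \<in> H1 r0 r1" "AE z in lebesgue_on \<Omega>. jet \<phi> z = g z"
    using H1_jet_closed[of "\<lambda>n. snd (X n)" g] XH(2) fg(2) lg by blast
  have "H1.nrm (fst (X n) - \<psi>) = L2_norm \<Omega> (\<lambda>z. jet (fst (X n)) z - f z)" for n
    unfolding H1_nrm_diff_jet[OF XH(1) \<psi>(1)]
    by (rule L2_norm_AE_cong) (use \<psi>(2) in eventually_elim, simp, (intro L2_on_measurable L2_on_diff L2_jet XH fg \<psi>)+)
  then have l\<psi>: "(\<lambda>n. H1.nrm (fst (X n) - \<psi>)) \<longlonglongrightarrow> 0" using lf by presburger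
  have "H1.nrm (snd (X n) - \<phi>) = L2_norm \<Omega> (\<lambda>z. jet (snd (X n)) z - g z)" for n
    unfolding H1_nrm_diff_jet[OF XH(2) \<phi>(1)]
    by (rule L2_norm_AE_cong) (use \<phi>(2) in eventually_elim, simp, (intro L2_on_measurable L2_on_diff L2_jet XH fg \<phi>)+)
  then have l\<phi>: "(\<lambda>n. H1.nrm (snd (X n) - \<phi>)) \<longlonglongrightarrow> 0" using lg by presburger
  have "(\<integral>z. \<psi> z \<partial>(lebesgue_on \<Omega>)) = 0"
    using H1_tendsto_parts(3)[OF _ \<psi>(1) l\<psi>] XH(1,3) by (simp add: LIMSEQ_const_iff)
  moreover have "has_trace r0 r1 cell_end (end_pt r0) \<phi> (\<lambda>_. 0)"
    by (rule has_trace_zero_closed[OF face_end(1) _ _ \<phi>(1) l\<phi>]) (use XH in auto)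
  moreover have "has_trace r0 r1 cell_end (end_pt r1) \<phi> (\<lambda>_. 0)"
    by (rule has_trace_zero_closed[OF face_end(2) _ _ \<phi>(1) l\<phi>]) (use XH in auto)
  ultimately have "(\<psi>, \<phi>) \<in> admissible r0 r1" using \<psi>(1) \<phi>(1) by (simp add: admissible_def)
  moreover have "AE z in lebesgue_on \<Omega>. jets (\<psi>, \<phi>) z = L z"
    using \<psi>(2) \<phi>(2) by eventually_elim (simp add: jets_def L')
  ultimately show ?thesis by blast
qed

definition adm_ip where "adm_ip u v = L2_ip \<Omega> (jets u) (jets v)"

sublocale adm: semi_hilbert "admissible r0 r1" adm_ip
  unfolding adm_ip_def[abs_def]
  by (rule semi_hilbert_pullback[OF subspace_admissible L2_jets jets_add jets_scaleR admissible_closed])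

lemma adm_nrm: "adm.nrm u = L2_norm \<Omega> (jets u)"
  unfolding adm.nrm_def adm_ip_def by (simp add: L2.nrm_def flip: L2_nrm_eq)

lemma adm_nrm_sq:
  assumes "u \<in> admissible r0 r1"
  shows "(adm.nrm u)\<^sup>2 = (H1_norm r0 r1 (fst u))\<^sup>2 + (H1_norm r0 r1 (snd u))\<^sup>2"
  unfolding adm_nrm jets_def using admissible_D[OF assms] by (simp add: L2_norm_Pair_sq L2_jet L2_norm_jet)

lemma H1_norm_sq: "(H1_norm r0 r1 u)\<^sup>2 = (L2_norm \<Omega> u)\<^sup>2 + (L2_norm \<Omega> (wgrad r0 r1 u))\<^sup>2"
  by (simp add: H1_norm_def)

lemma H1_norm_le_adm_nrm:
  assumes "u \<in> admissible r0 r1"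
  shows "H1_norm r0 r1 (fst u) \<le> adm.nrm u" "H1_norm r0 r1 (snd u) \<le> adm.nrm u"
  by (rule power2_le_imp_le; use adm_nrm_sq[OF assms] adm.nrm_ge_0[OF assms] in simp)+

text \<open>\<open>D\<close> is the data norm of the final estimate. Each of the two volume
  integrals is at most \<open>D\<close> times the norm of \<open>u\<close>, which gives the
  \<open>2\<close> in \<open>K\<close>; each of the four boundary integrals adds the trace constant
  of its face.\<close>

lemma weak_rhs_linear_bounded:
  assumes F: "L2_on \<Omega> F" "L2_on \<Omega> G"
    and g: "L2_on cell_end (\<lambda>y. g0 y - F (end_pt r0 y) $ 1)" "L2_on cell_end (\<lambda>y. g1 y - F (end_pt r1 y) $ 1)"
    and w: "L2_on (cell_wall r0 r1) (\<lambda>y. F (wall_pt 1 y) $ 3)" "L2_on (cell_wall r0 r1) (\<lambda>y. F (wall_pt (-1) y) $ 3)"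
  defines "l \<equiv> \<lambda>u. weak_rhs r0 r1 F G g0 g1 (fst u) (snd u)"
    and "K \<equiv> 2 + trace_bound cell_end (end_pt r0) + trace_bound cell_end (end_pt r1)
      + trace_bound (cell_wall r0 r1) (wall_pt 1) + trace_bound (cell_wall r0 r1) (wall_pt (-1))"
    and "D \<equiv> L2_norm \<Omega> (\<lambda>z. (F z, G z)) + L2_norm cell_end (\<lambda>y. g0 y - F (end_pt r0 y) $ 1)
      + L2_norm cell_end (\<lambda>y. g1 y - F (end_pt r1 y) $ 1)
      + sqrt ((L2_norm (cell_wall r0 r1) (\<lambda>y. F (wall_pt 1 y) $ 3))\<^sup>2 + (L2_norm (cell_wall r0 r1) (\<lambda>y. F (wall_pt (-1) y) $ 3))\<^sup>2)"
  shows "\<lbrakk>u \<in> admissible r0 r1; v \<in> admissible r0 r1\<rbrakk> \<Longrightarrow> l (u + v) = l u + l v"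
    "u \<in> admissible r0 r1 \<Longrightarrow> l (c *\<^sub>R u) = c * l u"
    "u \<in> admissible r0 r1 \<Longrightarrow> \<bar>l u\<bar> \<le> K * D * adm.nrm u"
proof -
  define t where "t Q p h u = (\<integral>y. h y * (SOME T. has_trace r0 r1 Q p u T) y \<partial>(lebesgue_on Q))"
    for Q p and h :: "real \<times> real \<Rightarrow> real" and u :: "real ^ 3 \<Rightarrow> real"
  define b where "b u = (\<integral>z. F z \<bullet> wgrad r0 r1 (fst u) z \<partial>(lebesgue_on \<Omega>)) - (\<integral>z. G z * snd u z \<partial>(lebesgue_on \<Omega>))" for u
  have i: "integrable (lebesgue_on \<Omega>) (\<lambda>z. F z \<bullet> wgrad r0 r1 (fst u) z)" "integrable (lebesgue_on \<Omega>) (\<lambda>z. G z * snd u z)"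
    if "u \<in> admissible r0 r1" for u
    using admissible_D[OF that] by (auto intro!: L2_inner_integrable L2_mult_integrable F H1_D)
  have l: "l u = b u + t cell_end (end_pt r1) (\<lambda>y. g1 y - F (end_pt r1 y) $ 1) (fst u)
     - t cell_end (end_pt r0) (\<lambda>y. g0 y - F (end_pt r0 y) $ 1) (fst u)
     - t (cell_wall r0 r1) (wall_pt 1) (\<lambda>y. F (wall_pt 1 y) $ 3) (fst u)
     + t (cell_wall r0 r1) (wall_pt (-1)) (\<lambda>y. F (wall_pt (-1) y) $ 3) (fst u)" if "u \<in> admissible r0 r1" for u
    \<comment> \<open>Unfolding \<open>trace_end\<close> and \<open>trace_wall\<close> exposes their
      \<open>SOME\<close> terms, the form in which \<open>trace_pairing\<close> handles
      them.\<close>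
    using i[OF that] by (simp add: l_def weak_rhs_def b_def t_def trace_end_def trace_wall_def inner_vec_def)
  note t = trace_pairing[OF face_end(1) g(1), folded t_def] trace_pairing[OF face_end(2) g(2), folded t_def]
    trace_pairing[OF face_wall(1) w(1), folded t_def] trace_pairing[OF face_wall(2) w(2), folded t_def]
  show "l (u + v) = l u + l v" if u: "u \<in> admissible r0 r1" and v: "v \<in> admissible r0 r1"
  proof -
    note uv = adm.V_closed(2)[OF u v]
    have "(\<integral>z. F z \<bullet> wgrad r0 r1 (fst (u + v)) z \<partial>(lebesgue_on \<Omega>))
        = (\<integral>z. F z \<bullet> wgrad r0 r1 (fst u) z + F z \<bullet> wgrad r0 r1 (fst v) z \<partial>(lebesgue_on \<Omega>))"
    proof (rule integral_cong_AE)
      show "AE z in lebesgue_on \<Omega>. F z \<bullet> wgrad r0 r1 (fst (u + v)) z = F z \<bullet> wgrad r0 r1 (fst u) z + F z \<bullet> wgrad r0 r1 (fst v) z"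
        using jets_add[OF u v] by eventually_elim (simp add: jets_def jet_def inner_add_right)
    qed (use i[OF u] i[OF v] i[OF uv] in auto)
    then have "b (u + v) = b u + b v" using i[OF u] i[OF v] by (simp add: b_def distrib_left)
    then show ?thesis unfolding l[OF u] l[OF v] l[OF uv] using t admissible_D[OF u] admissible_D[OF v] by simp
  qed
  show "l (c *\<^sub>R u) = c * l u" if u: "u \<in> admissible r0 r1"
  proof -
    note cu = adm.V_closed(4)[OF u, of c]
    have "(\<integral>z. F z \<bullet> wgrad r0 r1 (fst (c *\<^sub>R u)) z \<partial>(lebesgue_on \<Omega>)) = (\<integral>z. c * (F z \<bullet> wgrad r0 r1 (fst u) z) \<partial>(lebesgue_on \<Omega>))"
    proof (rule integral_cong_AE)
      show "AE z in lebesgue_on \<Omega>. F z \<bullet> wgrad r0 r1 (fst (c *\<^sub>R u)) z = c * (F z \<bullet> wgrad r0 r1 (fst u) z)"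
        using jets_scaleR[OF u, of c] by eventually_elim (simp add: jets_def jet_def)
    qed (use i[OF u] i[OF cu] in auto)
    then have "b (c *\<^sub>R u) = c * b u" by (simp add: b_def right_diff_distrib mult.left_commute)
    then show ?thesis unfolding l[OF u] l[OF cu] using t admissible_D[OF u] by (simp add: algebra_simps)
  qed
  show "\<bar>l u\<bar> \<le> K * D * adm.nrm u" if u: "u \<in> admissible r0 r1"
  proof -
    note uD = admissible_D[OF u]
    let ?n = "adm.nrm u"
    have n: "0 \<le> ?n" using u by simp
    have FG: "L2_on \<Omega> (\<lambda>z. (F z, G z))" using F by (simp add: L2_on_Pair_iff)
    have D0: "L2_norm \<Omega> F \<le> D" "L2_norm \<Omega> G \<le> D" "L2_norm cell_end (\<lambda>y. g0 y - F (end_pt r0 y) $ 1) \<le> D"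
      "L2_norm cell_end (\<lambda>y. g1 y - F (end_pt r1 y) $ 1) \<le> D" "L2_norm (cell_wall r0 r1) (\<lambda>y. F (wall_pt 1 y) $ 3) \<le> D"
      "L2_norm (cell_wall r0 r1) (\<lambda>y. F (wall_pt (-1) y) $ 3) \<le> D"
    proof -
      define a e0 e1 w1 w2 where "a = L2_norm \<Omega> (\<lambda>z. (F z, G z))" and "e0 = L2_norm cell_end (\<lambda>y. g0 y - F (end_pt r0 y) $ 1)"
        and "e1 = L2_norm cell_end (\<lambda>y. g1 y - F (end_pt r1 y) $ 1)" and "w1 = L2_norm (cell_wall r0 r1) (\<lambda>y. F (wall_pt 1 y) $ 3)"
        and "w2 = L2_norm (cell_wall r0 r1) (\<lambda>y. F (wall_pt (-1) y) $ 3)"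
      have D': "D = a + e0 + e1 + sqrt (w1\<^sup>2 + w2\<^sup>2)" by (simp add: D_def a_def e0_def e1_def w1_def w2_def)
      have nn: "0 \<le> a" "0 \<le> e0" "0 \<le> e1" by (simp_all add: a_def e0_def e1_def)
      have s: "w1 \<le> sqrt (w1\<^sup>2 + w2\<^sup>2)" "w2 \<le> sqrt (w1\<^sup>2 + w2\<^sup>2)" "0 \<le> sqrt (w1\<^sup>2 + w2\<^sup>2)"
        by (simp_all add: real_le_rsqrt)
      have "L2_norm \<Omega> F \<le> a" "L2_norm \<Omega> G \<le> a"
        using L2_norm_fst_le[OF FG] L2_norm_snd_le[OF FG] by (simp_all add: a_def)
      then show "L2_norm \<Omega> F \<le> D" "L2_norm \<Omega> G \<le> D" "L2_norm cell_end (\<lambda>y. g0 y - F (end_pt r0 y) $ 1) \<le> D"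
        "L2_norm cell_end (\<lambda>y. g1 y - F (end_pt r1 y) $ 1) \<le> D" "L2_norm (cell_wall r0 r1) (\<lambda>y. F (wall_pt 1 y) $ 3) \<le> D"
        "L2_norm (cell_wall r0 r1) (\<lambda>y. F (wall_pt (-1) y) $ 3) \<le> D"
        using nn s unfolding D' e0_def[symmetric] e1_def[symmetric] w1_def[symmetric] w2_def[symmetric] by linarith+
    qed
    have "L2_norm \<Omega> (wgrad r0 r1 (fst u)) \<le> ?n" "L2_norm \<Omega> (snd u) \<le> ?n"
      using L2_norm_le_H1[OF uD(1)] L2_norm_le_H1[OF uD(2)] H1_norm_le_adm_nrm[OF u] by (simp_all add: H1_nrm_eq uD)
    then have "L2_norm \<Omega> F * L2_norm \<Omega> (wgrad r0 r1 (fst u)) \<le> D * ?n" "L2_norm \<Omega> G * L2_norm \<Omega> (snd u) \<le> D * ?n"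
      using D0 order_trans[OF L2_norm_ge_0 D0(1)] by (auto intro!: mult_mono)
    then have b: "\<bar>b u\<bar> \<le> 2 * (D * ?n)"
      using L2_Cauchy_Schwarz[OF F(1) H1_D(3)[OF uD(1)]] L2_Cauchy_Schwarz[OF F(2) H1_D(1)[OF uD(2)]]
      unfolding b_def inner_real_def by linarith
    have tb: "B * N * H1_norm r0 r1 (fst u) \<le> B * (D * ?n)" if "0 \<le> B" "N \<le> D" "0 \<le> N" for B N
      using that H1_norm_le_adm_nrm(1)[OF u] n unfolding mult.assoc by (intro mult_left_mono mult_mono) (auto simp: H1_norm_def)
    note B = trace_bound(1)[OF face_end(1)] trace_bound(1)[OF face_end(2)] trace_bound(1)[OF face_wall(1)] trace_bound(1)[OF face_wall(2)]
    have "K * D * ?n = 2 * (D * ?n) + trace_bound cell_end (end_pt r0) * (D * ?n) + trace_bound cell_end (end_pt r1) * (D * ?n)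
        + trace_bound (cell_wall r0 r1) (wall_pt 1) * (D * ?n) + trace_bound (cell_wall r0 r1) (wall_pt (-1)) * (D * ?n)"
      by (simp add: K_def algebra_simps)
    then show ?thesis unfolding l[OF u]
      using b order_trans[OF t(3)[OF uD(1)] tb[OF B(1) D0(3) L2_norm_ge_0]] order_trans[OF t(6)[OF uD(1)] tb[OF B(2) D0(4) L2_norm_ge_0]]
        order_trans[OF t(9)[OF uD(1)] tb[OF B(3) D0(5) L2_norm_ge_0]] order_trans[OF t(12)[OF uD(1)] tb[OF B(4) D0(6) L2_norm_ge_0]]
      by linarith
  qed
qed

end

lemma continuous_compact_bound:
  fixes f :: "real \<Rightarrow> real"
  assumes "continuous_on {a..b} f"
  obtains B where "B \<ge> 0" "\<And>x. x \<in> {a..b} \<Longrightarrow> \<bar>f x\<bar> \<le> B"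
proof -
  have "bounded (f ` {a..b})" by (intro compact_imp_bounded compact_continuous_image assms compact_Icc)
  then obtain B where "B > 0" "\<And>x. x \<in> {a..b} \<Longrightarrow> \<bar>f x\<bar> \<le> B" by (auto simp: bounded_pos)
  then show thesis using that[of B] by auto
qed

lemma sum_symmetric_block:
  fixes p q :: "real ^ 3"
  shows "(\<Sum>i\<in>UNIV. \<Sum>j\<in>UNIV. vector [vector [a, b, 0], vector [b, c, 0], vector [0, 0, d]] $ i $ j * p $ j * q $ i)
    = a * (p $ 1 * q $ 1) + b * (p $ 2 * q $ 1) + b * (p $ 1 * q $ 2) + c * (p $ 2 * q $ 2) + d * (p $ 3 * q $ 3)"
  by (simp add: sum_3)

text \<open>What the variational argument takes from the flow: continuous coefficients on a compact
  interval and strict subsonicity at each of its points, so that compactness yields uniform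
  constants.\<close>

locale subsonic_strip = strip +
  fixes \<gamma> A0 :: real and \<rho> U1 U2 :: "real \<Rightarrow> real"
  assumes r0_pos: "0 < r0" and gamma_pos: "\<gamma> > 0" and A0_pos: "A0 > 0"
    and \<rho>_pos: "\<And>x. x \<in> {r0..r1} \<Longrightarrow> \<rho> x > 0"
    and subsonic: "\<And>x. x \<in> {r0..r1} \<Longrightarrow> (U1 x)\<^sup>2 + (U2 x)\<^sup>2 < \<gamma> * A0 * \<rho> x powr (\<gamma> - 1)"
    and cont: "continuous_on {r0..r1} \<rho>" "continuous_on {r0..r1} U1" "continuous_on {r0..r1} U2"
begin

definition c2 :: "real \<Rightarrow> real" where "c2 x = \<gamma> * A0 * \<rho> x powr (\<gamma> - 1)"

lemma c2_pos: "x \<in> {r0..r1} \<Longrightarrow> c2 x > 0"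
  using gamma_pos A0_pos \<rho>_pos[of x] by (simp add: c2_def)

lemma sound_speed_sq: "x \<in> {r0..r1} \<Longrightarrow> (sound_speed \<gamma> A0 \<rho> x)\<^sup>2 = c2 x"
  using c2_pos[of x] by (simp add: sound_speed_def c2_def)

text \<open>The coefficients as functions of \<open>z $ 1\<close>. Mach numbers occur in
  \<open>matA\<close> only in products of two, so dividing by \<open>c2\<close> removes the square
  root of the sound speed.\<close>

definition a11 where "a11 x = x * \<rho> x * (1 - (U1 x)\<^sup>2 / c2 x)"
definition a12 where "a12 x = - (\<rho> x * (U1 x * U2 x / c2 x))"
definition a22 where "a22 x = 1 / x * \<rho> x * (1 - (U2 x)\<^sup>2 / c2 x)"
definition a33 where "a33 x = x * \<rho> x"
definition d1 where "d1 x = x * \<rho> x * U1 x / c2 x"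
definition d2 where "d2 x = \<rho> x * U2 x / c2 x"
definition d3 where "d3 x = x * \<rho> x / c2 x"

lemma x_pos: "x \<in> {r0..r1} \<Longrightarrow> x > 0" using r0_pos by auto

lemma continuous_c2: "continuous_on {r0..r1} c2"
  unfolding c2_def using \<rho>_pos by (intro continuous_intros cont) force+

lemma continuous_coeffs:
  "continuous_on {r0..r1} a11" "continuous_on {r0..r1} a12" "continuous_on {r0..r1} a22" "continuous_on {r0..r1} a33"
  "continuous_on {r0..r1} d1" "continuous_on {r0..r1} d2" "continuous_on {r0..r1} d3"
  "continuous_on {r0..r1} (\<lambda>x. x)" "continuous_on {r0..r1} (\<lambda>x. 1 / x)"
proof -
  have nz: "\<forall>x\<in>{r0..r1}. c2 x \<noteq> 0" "\<forall>x\<in>{r0..r1}. x \<noteq> 0" using c2_pos x_pos by force+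
  show "continuous_on {r0..r1} a11" unfolding a11_def by (intro continuous_intros cont continuous_c2 nz)
  show "continuous_on {r0..r1} a12" unfolding a12_def by (intro continuous_intros cont continuous_c2 nz)
  show "continuous_on {r0..r1} a22" unfolding a22_def by (intro continuous_intros cont continuous_c2 nz)
  show "continuous_on {r0..r1} a33" unfolding a33_def by (intro continuous_intros cont)
  show "continuous_on {r0..r1} d1" unfolding d1_def by (intro continuous_intros cont continuous_c2 nz)
  show "continuous_on {r0..r1} d2" unfolding d2_def by (intro continuous_intros cont continuous_c2 nz)
  show "continuous_on {r0..r1} d3" unfolding d3_def by (intro continuous_intros cont continuous_c2 nz)
  show "continuous_on {r0..r1} (\<lambda>x. x)" "continuous_on {r0..r1} (\<lambda>x. 1 / x)" by (intro continuous_intros nz)+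
qed

text \<open>The integrand of \<open>weak_lhs\<close> as a bilinear form in the pointwise values of
  the jets. Identities of jets that hold almost everywhere thereby transfer to the integrated form
  \<open>B\<close>.\<close>

definition form :: "real ^ 3 \<Rightarrow> jets \<Rightarrow> jets \<Rightarrow> real" where
  "form z P Q = (let x = z $ 1; f = fst (snd P); g = snd (fst P); h = snd (snd P);
      \<xi> = fst (snd Q); g' = snd (fst Q); h' = snd (snd Q) in
     a11 x * (g $ 1 * g' $ 1) + a12 x * (g $ 2 * g' $ 1) + a12 x * (g $ 1 * g' $ 2) + a22 x * (g $ 2 * g' $ 2)
     + a33 x * (g $ 3 * g' $ 3) + d1 x * (f * g' $ 1) + d2 x * (f * g' $ 2)
     + x * (h $ 1 * h' $ 1) + 1 / x * (h $ 2 * h' $ 2) + x * (h $ 3 * h' $ 3)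
     - d1 x * (g $ 1 * \<xi>) - d2 x * (g $ 2 * \<xi>) + d3 x * (f * \<xi>))"

lemma weak_lhs_form:
  "weak_lhs \<gamma> r0 r1 A0 \<rho> U1 U2 \<psi> \<phi> \<eta> \<xi> = (\<integral>z. form z (jets (\<psi>, \<phi>) z) (jets (\<eta>, \<xi>) z) \<partial>(lebesgue_on \<Omega>))"
  unfolding weak_lhs_def
proof (rule Bochner_Integration.integral_cong[OF refl])
  fix z assume "z \<in> space (lebesgue_on \<Omega>)"
  then have z: "z $ 1 \<in> {r0..r1}" by (auto simp: Omega_def)
  define s where "s = sound_speed \<gamma> A0 \<rho> (z $ 1)"
  have s2: "s\<^sup>2 = c2 (z $ 1)" unfolding s_def by (rule sound_speed_sq[OF z])
  have ss: "(a / s)\<^sup>2 = a\<^sup>2 / c2 (z $ 1)" "a / s * (b / s) = a * b / c2 (z $ 1)" for a b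
    unfolding s2[symmetric] by (simp_all add: power_divide power2_eq_square)
  let ?x = "z $ 1"
  have A: "matA \<gamma> A0 \<rho> U1 U2 z = vector [vector [a11 ?x, a12 ?x, 0], vector [a12 ?x, a22 ?x, 0], vector [0, 0, a33 ?x]]"
    unfolding matA_def Let_def s_def[symmetric] ss(1) using s2 by (simp add: a11_def a12_def a22_def a33_def power2_eq_square mult.assoc)
  have t: "?x * \<rho> ?x * U1 ?x / c2 ?x * p * q = d1 ?x * (p * q)" "\<rho> ?x * U2 ?x / c2 ?x * p * q = d2 ?x * (p * q)"
    "?x * \<rho> ?x / c2 ?x * p * q = d3 ?x * (p * q)" for p q by (simp_all add: d1_def d2_def d3_def)
  show "(let r = z $ 1; c2 = (sound_speed \<gamma> A0 \<rho> r)\<^sup>2; d = wgrad r0 r1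
        in (\<Sum>i\<in>UNIV. \<Sum>j\<in>UNIV. matA \<gamma> A0 \<rho> U1 U2 z $ i $ j * d \<psi> z $ j * d \<eta> z $ i)
        + r * \<rho> r * U1 r / c2 * \<phi> z * d \<eta> z $ 1
        + \<rho> r * U2 r / c2 * \<phi> z * d \<eta> z $ 2
        + (\<Sum>i\<in>UNIV. \<Sum>j\<in>UNIV. matB z $ i $ j * d \<phi> z $ j * d \<xi> z $ i)
        - r * \<rho> r * U1 r / c2 * d \<psi> z $ 1 * \<xi> z
        - \<rho> r * U2 r / c2 * d \<psi> z $ 2 * \<xi> z
        + r * \<rho> r / c2 * \<phi> z * \<xi> z) = form z (jets (\<psi>, \<phi>) z) (jets (\<eta>, \<xi>) z)"
    unfolding Let_def s_def[symmetric] s2 A matB_def sum_symmetric_block t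
    by (simp add: form_def Let_def jets_def jet_def)
qed

lemma form_bilinear:
  "form z (P + P') Q = form z P Q + form z P' Q" "form z (c *\<^sub>R P) Q = c * form z P Q"
  "form z P (Q + Q') = form z P Q + form z P Q'" "form z P (c *\<^sub>R Q) = c * form z P Q"
  by (simp_all add: form_def Let_def algebra_simps add_divide_distrib)

text \<open>Compactness bounds the sum of the moduli of all coefficients at once; \<open>13\<close>
  counts the summands of \<open>form\<close>.\<close>

lemma form_bound: "\<exists>K\<ge>0. \<forall>z\<in>\<Omega>. \<forall>P Q. \<bar>form z P Q\<bar> \<le> K * (norm P * norm Q)"
proof -
  have "continuous_on {r0..r1}
      (\<lambda>x. \<bar>a11 x\<bar> + \<bar>a12 x\<bar> + \<bar>a22 x\<bar> + \<bar>a33 x\<bar> + \<bar>d1 x\<bar> + \<bar>d2 x\<bar> + \<bar>d3 x\<bar> + \<bar>x\<bar> + \<bar>1 / x\<bar>)"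
    by (intro continuous_on_add continuous_on_rabs continuous_coeffs)
  from continuous_compact_bound[OF this] obtain B where B: "B \<ge> 0" "\<And>x. x \<in> {r0..r1} \<Longrightarrow>
    \<bar>\<bar>a11 x\<bar> + \<bar>a12 x\<bar> + \<bar>a22 x\<bar> + \<bar>a33 x\<bar> + \<bar>d1 x\<bar> + \<bar>d2 x\<bar> + \<bar>d3 x\<bar> + \<bar>x\<bar> + \<bar>1 / x\<bar>\<bar> \<le> B"
    by blast
  have "\<bar>form z P Q\<bar> \<le> 13 * B * (norm P * norm Q)" if z: "z \<in> \<Omega>" for z P Q
  proof -
    let ?x = "z $ 1"
    have x: "?x \<in> {r0..r1}" using z by (auto simp: Omega_def)
    have parts: "p1 \<le> X \<and> p2 \<le> X \<and> p3 \<le> X \<and> p4 \<le> X \<and> p5 \<le> X \<and> p6 \<le> X \<and> p7 \<le> X \<and> p8 \<le> X \<and> p9 \<le> X"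
      if "p1 + p2 + p3 + p4 + p5 + p6 + p7 + p8 + p9 \<le> X" "0 \<le> p1" "0 \<le> p2" "0 \<le> p3" "0 \<le> p4" "0 \<le> p5"
        "0 \<le> p6" "0 \<le> p7" "0 \<le> p8" "0 \<le> p9" for p1 p2 p3 p4 p5 p6 p7 p8 p9 X :: real
      using that by (intro conjI) linarith+
    have c: "\<bar>a11 ?x\<bar> \<le> B" "\<bar>a12 ?x\<bar> \<le> B" "\<bar>a22 ?x\<bar> \<le> B" "\<bar>a33 ?x\<bar> \<le> B"
      "\<bar>d1 ?x\<bar> \<le> B" "\<bar>d2 ?x\<bar> \<le> B" "\<bar>d3 ?x\<bar> \<le> B" "\<bar>?x\<bar> \<le> B" "\<bar>1 / ?x\<bar> \<le> B"
      using parts[OF abs_le_D1[OF B(2)[OF x]] abs_ge_zero abs_ge_zero abs_ge_zero abs_ge_zero abs_ge_zero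
          abs_ge_zero abs_ge_zero abs_ge_zero abs_ge_zero] by blast+
    have n: "\<bar>fst (snd R)\<bar> \<le> norm R" "\<bar>snd (fst R) $ i\<bar> \<le> norm R" "\<bar>snd (snd R) $ i\<bar> \<le> norm R" for R :: jets and i
    proof -
      have "norm (fst R) \<le> norm R" "norm (snd R) \<le> norm R" by (metis norm_fst_le norm_snd_le prod.collapse)+
      moreover have "norm (fst (snd R)) \<le> norm (snd R)" "norm (snd (snd R)) \<le> norm (snd R)" "norm (snd (fst R)) \<le> norm (fst R)"
        by (metis norm_fst_le norm_snd_le prod.collapse)+
      ultimately show "\<bar>fst (snd R)\<bar> \<le> norm R" "\<bar>snd (fst R) $ i\<bar> \<le> norm R" "\<bar>snd (snd R) $ i\<bar> \<le> norm R"
        using component_le_norm_cart[of "snd (fst R)" i] component_le_norm_cart[of "snd (snd R)" i] by auto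
    qed
    have t: "\<bar>k * (p * q)\<bar> \<le> B * (norm P * norm Q)" if "\<bar>k\<bar> \<le> B" "\<bar>p\<bar> \<le> norm P" "\<bar>q\<bar> \<le> norm Q" for k p q
      unfolding abs_mult using that B(1) by (intro mult_mono) auto
    have sum13: "\<bar>t1 + t2 + t3 + t4 + t5 + t6 + t7 + t8 + t9 + t10 - t11 - t12 + t13\<bar> \<le> 13 * X"
      if "\<bar>t1\<bar> \<le> X" "\<bar>t2\<bar> \<le> X" "\<bar>t3\<bar> \<le> X" "\<bar>t4\<bar> \<le> X" "\<bar>t5\<bar> \<le> X" "\<bar>t6\<bar> \<le> X" "\<bar>t7\<bar> \<le> X"
        "\<bar>t8\<bar> \<le> X" "\<bar>t9\<bar> \<le> X" "\<bar>t10\<bar> \<le> X" "\<bar>t11\<bar> \<le> X" "\<bar>t12\<bar> \<le> X" "\<bar>t13\<bar> \<le> X"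
      for t1 t2 t3 t4 t5 t6 t7 t8 t9 t10 t11 t12 t13 X :: real
      using that[THEN abs_le_D1] that[THEN abs_le_D2] by (intro abs_leI) linarith+
    have "\<bar>form z P Q\<bar> \<le> 13 * (B * (norm P * norm Q))"
      unfolding form_def Let_def by (rule sum13; intro t n c)
    then show ?thesis by (simp add: mult.assoc)
  qed
  then show ?thesis using B(1) by (intro exI[of _ "13 * B"]) auto
qed

text \<open>The terms with \<open>d1\<close> and \<open>d2\<close> cancel on the diagonal. The
  constant is the minimum over the interval of the smallest coefficient \<open>m\<close>. The value
  of the first function, \<open>fst (fst P)\<close>, is absent on the left: pointwise only its
  gradient is controlled.\<close>

lemma form_coercive:
  "\<exists>\<alpha>>0. \<forall>z\<in>\<Omega>. \<forall>P. \<alpha> * ((norm (snd (fst P)))\<^sup>2 + (norm (snd P))\<^sup>2) \<le> form z P P"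
proof -
  define m where "m x = min (x * \<rho> x * (1 - ((U1 x)\<^sup>2 + (U2 x)\<^sup>2) / c2 x)) (min (1 / x * \<rho> x * (1 - ((U1 x)\<^sup>2 + (U2 x)\<^sup>2) / c2 x))
    (min x (min (1 / x) (d3 x))))" for x
  have nz: "\<forall>x\<in>{r0..r1}. c2 x \<noteq> 0" "\<forall>x\<in>{r0..r1}. x \<noteq> 0" using c2_pos x_pos by force+
  have "continuous_on {r0..r1} m"
    unfolding m_def by (intro continuous_intros cont continuous_c2 continuous_coeffs nz)
  then obtain x0 where x0: "x0 \<in> {r0..r1}" "\<And>x. x \<in> {r0..r1} \<Longrightarrow> m x0 \<le> m x"
    using continuous_attains_inf[of "{r0..r1}" m] r0_less by auto
  have M: "((U1 x)\<^sup>2 + (U2 x)\<^sup>2) / c2 x < 1" if "x \<in> {r0..r1}" for x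
    using subsonic[OF that] c2_pos[OF that] by (simp add: c2_def)
  have "m x0 > 0"
    using x_pos[OF x0(1)] \<rho>_pos[OF x0(1)] c2_pos[OF x0(1)] M[OF x0(1)] by (simp add: m_def d3_def)
  moreover have "m x0 * ((norm (snd (fst P)))\<^sup>2 + (norm (snd P))\<^sup>2) \<le> form z P P" if z: "z \<in> \<Omega>" for z P
  proof -
    define x f g h where "x = z $ 1" and "f = fst (snd P)" and "g = snd (fst P)" and "h = snd (snd P)"
    have xI: "x \<in> {r0..r1}" using z by (auto simp: Omega_def x_def)
    note p = x_pos[OF xI] \<rho>_pos[OF xI] c2_pos[OF xI]
    have mx: "m x0 \<le> x * \<rho> x * (1 - ((U1 x)\<^sup>2 + (U2 x)\<^sup>2) / c2 x)"
      "m x0 \<le> 1 / x * \<rho> x * (1 - ((U1 x)\<^sup>2 + (U2 x)\<^sup>2) / c2 x)" "m x0 \<le> x" "m x0 \<le> 1 / x" "m x0 \<le> d3 x"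
      using x0(2)[OF xI] by (simp_all add: m_def)
    \<comment> \<open>The third diagonal entry carries no Mach factor, so it dominates the first
      entry of the minimum.\<close>
    have "x * \<rho> x * (1 - ((U1 x)\<^sup>2 + (U2 x)\<^sup>2) / c2 x) \<le> x * \<rho> x * 1"
      using p by (intro mult_left_mono) auto
    then have m33: "m x0 \<le> a33 x" using mx(1) by (simp add: a33_def)
    \<comment> \<open>\<open>y\<close> is the angular component of the gradient in polar
      coordinates. In the variables \<open>g $ 1\<close> and \<open>y\<close> the upper block of
      \<open>matA\<close> is \<open>x * \<rho> x\<close> times the identity minus the dyad of the
      velocity divided by \<open>c2 x\<close>; Cauchy-Schwarz bounds the dyad by the squared
      speed.\<close>
    define y where "y = g $ 2 / x"
    have y: "g $ 2 = x * y" using p by (simp add: y_def)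
    have cs: "(U1 x * g $ 1 + U2 x * y)\<^sup>2 \<le> ((U1 x)\<^sup>2 + (U2 x)\<^sup>2) * ((g $ 1)\<^sup>2 + y\<^sup>2)"
    proof -
      have "((U1 x)\<^sup>2 + (U2 x)\<^sup>2) * ((g $ 1)\<^sup>2 + y\<^sup>2) - (U1 x * g $ 1 + U2 x * y)\<^sup>2 = (U1 x * y - U2 x * g $ 1)\<^sup>2"
        by (simp add: power2_eq_square algebra_simps)
      then show ?thesis using zero_le_power2[of "U1 x * y - U2 x * g $ 1"] by linarith
    qed
    have A: "a11 x * (g $ 1 * g $ 1) + a12 x * (g $ 2 * g $ 1) + a12 x * (g $ 1 * g $ 2) + a22 x * (g $ 2 * g $ 2)
        = x * \<rho> x * (((g $ 1)\<^sup>2 + y\<^sup>2) - (U1 x * g $ 1 + U2 x * y)\<^sup>2 / c2 x)"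
      unfolding a11_def a12_def a22_def y using p by (simp add: field_simps power2_eq_square)
    have "x * \<rho> x * (1 - ((U1 x)\<^sup>2 + (U2 x)\<^sup>2) / c2 x) * (g $ 1)\<^sup>2 + 1 / x * \<rho> x * (1 - ((U1 x)\<^sup>2 + (U2 x)\<^sup>2) / c2 x) * (g $ 2)\<^sup>2
        = x * \<rho> x * (((g $ 1)\<^sup>2 + y\<^sup>2) - ((U1 x)\<^sup>2 + (U2 x)\<^sup>2) * ((g $ 1)\<^sup>2 + y\<^sup>2) / c2 x)"
      unfolding y using p by (simp add: field_simps power2_eq_square)
    also have "\<dots> \<le> x * \<rho> x * (((g $ 1)\<^sup>2 + y\<^sup>2) - (U1 x * g $ 1 + U2 x * y)\<^sup>2 / c2 x)"
      using p cs by (intro mult_left_mono diff_left_mono divide_right_mono) auto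
    finally have A': "x * \<rho> x * (1 - ((U1 x)\<^sup>2 + (U2 x)\<^sup>2) / c2 x) * (g $ 1)\<^sup>2 + 1 / x * \<rho> x * (1 - ((U1 x)\<^sup>2 + (U2 x)\<^sup>2) / c2 x) * (g $ 2)\<^sup>2
        \<le> a11 x * (g $ 1 * g $ 1) + a12 x * (g $ 2 * g $ 1) + a12 x * (g $ 1 * g $ 2) + a22 x * (g $ 2 * g $ 2)"
      unfolding A .
    have nrm: "(norm (snd (fst P)))\<^sup>2 + (norm (snd P))\<^sup>2 = (g $ 1)\<^sup>2 + (g $ 2)\<^sup>2 + (g $ 3)\<^sup>2 + f\<^sup>2 + (h $ 1)\<^sup>2 + (h $ 2)\<^sup>2 + (h $ 3)\<^sup>2"
    proof -
      have "(norm v)\<^sup>2 = (v $ 1)\<^sup>2 + (v $ 2)\<^sup>2 + (v $ 3)\<^sup>2" for v :: "real ^ 3"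
        unfolding power2_norm_eq_inner by (simp add: inner_vec_def sum_3 power2_eq_square)
      moreover have "(norm (snd P))\<^sup>2 = f\<^sup>2 + (norm h)\<^sup>2" unfolding norm_prod_def f_def h_def by simp
      ultimately show ?thesis by (simp add: g_def)
    qed
    have s: "m x0 * q\<^sup>2 \<le> k * q\<^sup>2" if "m x0 \<le> k" for k q using that by (intro mult_right_mono) auto
    have "form z P P = (a11 x * (g $ 1 * g $ 1) + a12 x * (g $ 2 * g $ 1) + a12 x * (g $ 1 * g $ 2) + a22 x * (g $ 2 * g $ 2))
        + a33 x * (g $ 3)\<^sup>2 + d3 x * f\<^sup>2 + x * (h $ 1)\<^sup>2 + 1 / x * (h $ 2)\<^sup>2 + x * (h $ 3)\<^sup>2"
      by (simp add: form_def Let_def x_def f_def g_def h_def power2_eq_square)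
    then show ?thesis
      using A' s[OF mx(1), of "g $ 1"] s[OF mx(2), of "g $ 2"] s[OF m33, of "g $ 3"] s[OF mx(5), of f]
        s[OF mx(3), of "h $ 1"] s[OF mx(4), of "h $ 2"] s[OF mx(3), of "h $ 3"]
      unfolding nrm distrib_left by linarith
  qed
  ultimately show ?thesis by blast
qed

lemma form_integrable:
  assumes f: "L2_on \<Omega> f" and g: "L2_on \<Omega> g"
  shows "integrable (lebesgue_on \<Omega>) (\<lambda>z. form z (f z) (g z))"
proof -
  have comp: "L2_on \<Omega> (\<lambda>z. fst (snd (u z)))" "L2_on \<Omega> (\<lambda>z. snd (fst (u z)) $ i)" "L2_on \<Omega> (\<lambda>z. snd (snd (u z)) $ i)"
    if "L2_on \<Omega> u" for u :: "real ^ 3 \<Rightarrow> jets" and i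
    using L2_on_inner_right[OF that, of "((0, 0), (1, 0))"] L2_on_inner_right[OF that, of "((0, axis i 1), (0, 0))"]
      L2_on_inner_right[OF that, of "((0, 0), (0, axis i 1))"]
    by (simp_all add: inner_prod_def inner_axis)
  have weighted: "integrable (lebesgue_on \<Omega>) (\<lambda>z. k (z $ 1) * (p z * q z))"
    if k: "continuous_on {r0..r1} k" and p: "L2_on \<Omega> p" and q: "L2_on \<Omega> q" for k :: "real \<Rightarrow> real" and p q
  proof -
    obtain B where B: "B \<ge> 0" "\<And>x. x \<in> {r0..r1} \<Longrightarrow> \<bar>k x\<bar> \<le> B" using continuous_compact_bound[OF k] by blast
    have pq: "integrable (lebesgue_on \<Omega>) (\<lambda>z. p z * q z)" by (rule L2_mult_integrable[OF p q])
    show ?thesis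
    proof (rule Bochner_Integration.integrable_bound)
      show "integrable (lebesgue_on \<Omega>) (\<lambda>z. B * (p z * q z))" using pq by simp
      have "continuous_on \<Omega> (\<lambda>z. k (z $ 1))"
        by (rule continuous_on_compose2[OF k]) (auto simp: Omega_def intro!: continuous_intros)
      then have "(\<lambda>z. k (z $ 1)) \<in> borel_measurable (lebesgue_on \<Omega>)"
        by (rule continuous_imp_measurable_on_sets_lebesgue) simp
      then show "(\<lambda>z. k (z $ 1) * (p z * q z)) \<in> borel_measurable (lebesgue_on \<Omega>)"
        by (rule borel_measurable_times[OF _ borel_measurable_integrable[OF pq]])
      show "AE z in lebesgue_on \<Omega>. norm (k (z $ 1) * (p z * q z)) \<le> norm (B * (p z * q z))"
      proof (rule AE_I2)
        fix z assume "z \<in> space (lebesgue_on \<Omega>)"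
        then have "\<bar>k (z $ 1)\<bar> \<le> \<bar>B\<bar>" using B by (auto simp: Omega_def)
        then show "norm (k (z $ 1) * (p z * q z)) \<le> norm (B * (p z * q z))"
          unfolding real_norm_def abs_mult by (intro mult_right_mono) auto
      qed
    qed
  qed
  show ?thesis unfolding form_def Let_def
    by (intro Bochner_Integration.integrable_add Bochner_Integration.integrable_diff weighted[OF continuous_coeffs(1)]
      weighted[OF continuous_coeffs(2)] weighted[OF continuous_coeffs(3)] weighted[OF continuous_coeffs(4)] weighted[OF continuous_coeffs(5)]
      weighted[OF continuous_coeffs(6)] weighted[OF continuous_coeffs(7)] weighted[OF continuous_coeffs(8)] weighted[OF continuous_coeffs(9)]
      comp f g)
qed

definition B where "B u v = (\<integral>z. form z (jets u z) (jets v z) \<partial>(lebesgue_on \<Omega>))"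

lemma B_add:
  assumes u: "u \<in> admissible r0 r1" and v: "v \<in> admissible r0 r1" and w: "w \<in> admissible r0 r1"
  shows "B (u + v) w = B u w + B v w" "B w (u + v) = B w u + B w v"
proof -
  note L = L2_jets[OF u] L2_jets[OF v] L2_jets[OF w] L2_jets[OF adm.V_closed(2)[OF u v]]
  have "B (u + v) w = (\<integral>z. form z (jets u z) (jets w z) + form z (jets v z) (jets w z) \<partial>(lebesgue_on \<Omega>))"
    unfolding B_def
  proof (rule integral_cong_AE)
    show "AE z in lebesgue_on \<Omega>. form z (jets (u + v) z) (jets w z) = form z (jets u z) (jets w z) + form z (jets v z) (jets w z)"
      using jets_add[OF u v] by eventually_elim (simp add: form_bilinear)
  qed (intro borel_measurable_integrable form_integrable L borel_measurable_add)+
  then show "B (u + v) w = B u w + B v w" using form_integrable L by (simp add: B_def)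
  have "B w (u + v) = (\<integral>z. form z (jets w z) (jets u z) + form z (jets w z) (jets v z) \<partial>(lebesgue_on \<Omega>))"
    unfolding B_def
  proof (rule integral_cong_AE)
    show "AE z in lebesgue_on \<Omega>. form z (jets w z) (jets (u + v) z) = form z (jets w z) (jets u z) + form z (jets w z) (jets v z)"
      using jets_add[OF u v] by eventually_elim (simp add: form_bilinear)
  qed (intro borel_measurable_integrable form_integrable L borel_measurable_add)+
  then show "B w (u + v) = B w u + B w v" using form_integrable L by (simp add: B_def)
qed

lemma B_scaleR:
  assumes u: "u \<in> admissible r0 r1" and w: "w \<in> admissible r0 r1"
  shows "B (c *\<^sub>R u) w = c * B u w" "B w (c *\<^sub>R u) = c * B w u"
proof -
  note L = L2_jets[OF u] L2_jets[OF w] L2_jets[OF adm.V_closed(4)[OF u, of c]]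
  have "B (c *\<^sub>R u) w = (\<integral>z. c * form z (jets u z) (jets w z) \<partial>(lebesgue_on \<Omega>))"
    unfolding B_def
  proof (rule integral_cong_AE)
    show "AE z in lebesgue_on \<Omega>. form z (jets (c *\<^sub>R u) z) (jets w z) = c * form z (jets u z) (jets w z)"
      using jets_scaleR[OF u, of c] by eventually_elim (simp add: form_bilinear)
  qed (intro borel_measurable_integrable Bochner_Integration.integrable_mult_right form_integrable L)+
  then show "B (c *\<^sub>R u) w = c * B u w" by (simp add: B_def)
  have "B w (c *\<^sub>R u) = (\<integral>z. c * form z (jets w z) (jets u z) \<partial>(lebesgue_on \<Omega>))"
    unfolding B_def
  proof (rule integral_cong_AE)
    show "AE z in lebesgue_on \<Omega>. form z (jets w z) (jets (c *\<^sub>R u) z) = c * form z (jets w z) (jets u z)"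
      using jets_scaleR[OF u, of c] by eventually_elim (simp add: form_bilinear)
  qed (intro borel_measurable_integrable Bochner_Integration.integrable_mult_right form_integrable L)+
  then show "B w (c *\<^sub>R u) = c * B w u" by (simp add: B_def)
qed

lemma B_bounded: "\<exists>K. \<forall>u\<in>admissible r0 r1. \<forall>v\<in>admissible r0 r1. \<bar>B u v\<bar> \<le> K * adm.nrm u * adm.nrm v"
proof -
  obtain K where K: "K \<ge> 0" "\<And>z P Q. z \<in> \<Omega> \<Longrightarrow> \<bar>form z P Q\<bar> \<le> K * (norm P * norm Q)" using form_bound by blast
  have "\<bar>B u v\<bar> \<le> K * adm.nrm u * adm.nrm v" if u: "u \<in> admissible r0 r1" and v: "v \<in> admissible r0 r1" for u v
  proof -
    note L = L2_jets[OF u] L2_jets[OF v]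
    have N: "L2_on \<Omega> (\<lambda>z. norm (f z))" "L2_norm \<Omega> (\<lambda>z. norm (f z)) = L2_norm \<Omega> f" if "L2_on \<Omega> f" for f :: "real ^ 3 \<Rightarrow> jets"
    proof -
      have "(\<lambda>z. norm (f z)) \<in> borel_measurable (lebesgue_on \<Omega>)" using L2_on_measurable[OF that] by measurable
      then show "L2_on \<Omega> (\<lambda>z. norm (f z))" by (rule L2_on_bound[OF _ that, where C=1]) simp
    qed (simp add: L2_norm_def)
    have "\<bar>B u v\<bar> \<le> (\<integral>z. \<bar>form z (jets u z) (jets v z)\<bar> \<partial>(lebesgue_on \<Omega>))"
      unfolding B_def by (rule integral_abs_bound)
    also have "\<dots> \<le> (\<integral>z. K * (norm (jets u z) * norm (jets v z)) \<partial>(lebesgue_on \<Omega>))"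
    proof (rule integral_mono)
      show "integrable (lebesgue_on \<Omega>) (\<lambda>z. \<bar>form z (jets u z) (jets v z)\<bar>)" by (intro integrable_abs form_integrable L)
      show "integrable (lebesgue_on \<Omega>) (\<lambda>z. K * (norm (jets u z) * norm (jets v z)))"
        by (intro Bochner_Integration.integrable_mult_right L2_mult_integrable N L)
    qed (use K in auto)
    also have "\<dots> = K * (\<integral>z. norm (jets u z) \<bullet> norm (jets v z) \<partial>(lebesgue_on \<Omega>))" by simp
    also have "\<dots> \<le> K * (adm.nrm u * adm.nrm v)"
      using L2_Cauchy_Schwarz[OF N(1)[OF L(1)] N(1)[OF L(2)]] N(2)[OF L(1)] N(2)[OF L(2)]
      by (intro mult_left_mono K(1)) (simp add: adm_nrm)
    finally show ?thesis by (simp add: mult.assoc)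
  qed
  then show ?thesis by blast
qed

text \<open>The pointwise bound controls \<open>b + c\<close>, all but the squared L2 norm
  \<open>a\<close> of the first component, which is at most \<open>b / gap\<close>. The full squared
  norm is then at most \<open>(1 / gap + 1) * (b + c)\<close>.\<close>

lemma B_coercive: "\<exists>\<alpha>>0. \<forall>u\<in>admissible r0 r1. \<alpha> * (adm.nrm u)\<^sup>2 \<le> B u u"
proof -
  obtain \<alpha> where \<alpha>: "\<alpha> > 0" "\<And>z P. z \<in> \<Omega> \<Longrightarrow> \<alpha> * ((norm (snd (fst P)))\<^sup>2 + (norm (snd P))\<^sup>2) \<le> form z P P"
    using form_coercive by blast
  have "\<alpha> / (1 / gap + 1) * (adm.nrm u)\<^sup>2 \<le> B u u" if u: "u \<in> admissible r0 r1" for u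
  proof -
    note uD = admissible_D[OF u]
    define a b c where "a = (L2_norm \<Omega> (fst u))\<^sup>2" and "b = (L2_norm \<Omega> (wgrad r0 r1 (fst u)))\<^sup>2" and "c = (H1_norm r0 r1 (snd u))\<^sup>2"
    have n: "(adm.nrm u)\<^sup>2 = a + b + c" unfolding adm_nrm_sq[OF u] a_def b_def c_def by (simp add: H1_norm_sq)
    have nn: "0 \<le> b" "0 \<le> c" by (simp_all add: b_def c_def)
    have "gap * a \<le> b" using poincare[OF uD(1,3)] by (simp add: a_def b_def)
    then have "a \<le> 1 / gap * b" using gap_pos by (simp add: field_simps)
    then have "(adm.nrm u)\<^sup>2 \<le> (1 / gap + 1) * b + c" unfolding n by (simp add: algebra_simps)
    also have "\<dots> \<le> (1 / gap + 1) * b + (1 / gap + 1) * c" using nn gap_pos by (simp add: algebra_simps)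
    finally have 1: "(adm.nrm u)\<^sup>2 \<le> (1 / gap + 1) * (b + c)" by (simp add: distrib_left)
    have "0 < 1 / gap + 1" using gap_pos by (simp add: add_pos_pos)
    then have "\<alpha> / (1 / gap + 1) * (adm.nrm u)\<^sup>2 \<le> \<alpha> / (1 / gap + 1) * ((1 / gap + 1) * (b + c))"
      using 1 \<alpha>(1) by (intro mult_left_mono) auto
    also have "\<dots> = \<alpha> * (b + c)" using \<open>0 < 1 / gap + 1\<close> by simp
    also have "\<dots> = (\<integral>z. \<alpha> * ((norm (snd (fst (jets u z))))\<^sup>2 + (norm (snd (jets u z)))\<^sup>2) \<partial>(lebesgue_on \<Omega>))"
    proof -
      have "c = (L2_norm \<Omega> (jet (snd u)))\<^sup>2" by (simp add: c_def L2_norm_jet uD)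
      then show ?thesis using L2_on_integrable[OF H1_D(3)[OF uD(1)]] L2_on_integrable[OF L2_jet[OF uD(2)]]
        by (simp add: jets_def jet_def[of "fst u"] b_def L2_norm_sq)
    qed
    also have "\<dots> \<le> B u u" unfolding B_def
    proof (rule integral_mono)
      show "integrable (lebesgue_on \<Omega>) (\<lambda>z. \<alpha> * ((norm (snd (fst (jets u z))))\<^sup>2 + (norm (snd (jets u z)))\<^sup>2))"
        using L2_on_integrable[OF H1_D(3)[OF uD(1)]] L2_on_integrable[OF L2_jet[OF uD(2)]]
        by (simp add: jets_def jet_def[of "fst u"])
      show "integrable (lebesgue_on \<Omega>) (\<lambda>z. form z (jets u z) (jets u z))" by (intro form_integrable L2_jets u)
    qed (use \<alpha>(2) in simp)
    finally show ?thesis .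
  qed
  moreover have "\<alpha> / (1 / gap + 1) > 0" using \<alpha>(1) gap_pos by (simp add: add_pos_pos)
  ultimately show ?thesis by blast
qed

lemma weak_solution_iff:
  "weak_solution \<gamma> r0 r1 A0 \<rho> U1 U2 F G g0 g1 \<psi> \<phi> \<longleftrightarrow> (\<psi>, \<phi>) \<in> admissible r0 r1 \<and>
     (\<forall>v\<in>admissible r0 r1. B (\<psi>, \<phi>) v = weak_rhs r0 r1 F G g0 g1 (fst v) (snd v))"
  by (auto simp: weak_solution_def B_def weak_lhs_form split_beta)

lemma well_posed:
  "\<exists>C>0. \<forall>\<beta> F G g0 g1. 0 < \<beta> \<and> \<beta> < 1 \<and> regular_data \<beta> r0 r1 F G g0 g1 \<longrightarrow>
    (\<exists>\<psi> \<phi>. weak_solution \<gamma> r0 r1 A0 \<rho> U1 U2 F G g0 g1 \<psi> \<phi> \<and>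
      (\<forall>\<psi>' \<phi>'. weak_solution \<gamma> r0 r1 A0 \<rho> U1 U2 F G g0 g1 \<psi>' \<phi>' \<longrightarrow>
         (AE z in lebesgue_on (Omega r0 r1). \<psi>' z = \<psi> z \<and> \<phi>' z = \<phi> z)) \<and>
      sqrt ((H1_norm r0 r1 \<psi>)\<^sup>2 + (H1_norm r0 r1 \<phi>)\<^sup>2) \<le>
        C * (L2_norm (Omega r0 r1) (\<lambda>z. (F z, G z))
             + L2_norm cell_end (\<lambda>y. g0 y - F (end_pt r0 y) $ 1)
             + L2_norm cell_end (\<lambda>y. g1 y - F (end_pt r1 y) $ 1)
             + sqrt ((L2_norm (cell_wall r0 r1) (\<lambda>y. F (wall_pt 1 y) $ 3))\<^sup>2
                     + (L2_norm (cell_wall r0 r1) (\<lambda>y. F (wall_pt (-1) y) $ 3))\<^sup>2)))"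
proof -
  obtain \<alpha> where \<alpha>: "\<alpha> > 0" "\<And>u. u \<in> admissible r0 r1 \<Longrightarrow> \<alpha> * (adm.nrm u)\<^sup>2 \<le> B u u" using B_coercive by blast
  obtain KB where KB: "\<And>u v. \<lbrakk>u \<in> admissible r0 r1; v \<in> admissible r0 r1\<rbrakk> \<Longrightarrow> \<bar>B u v\<bar> \<le> KB * adm.nrm u * adm.nrm v"
    using B_bounded by blast
  define K where "K = 2 + trace_bound cell_end (end_pt r0) + trace_bound cell_end (end_pt r1)
      + trace_bound (cell_wall r0 r1) (wall_pt 1) + trace_bound (cell_wall r0 r1) (wall_pt (-1))"
  have K: "K > 0"
    using trace_bound(1)[OF face_end(1)] trace_bound(1)[OF face_end(2)] trace_bound(1)[OF face_wall(1)] trace_bound(1)[OF face_wall(2)]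
    by (simp add: K_def)
  show ?thesis
  proof (intro exI[of _ "K / \<alpha>"] conjI allI impI)
    show "0 < K / \<alpha>" using K \<alpha>(1) by simp
    fix \<beta> F G g0 g1 assume "0 < \<beta> \<and> \<beta> < 1 \<and> regular_data \<beta> r0 r1 F G g0 g1"
    then have data: "regular_data \<beta> r0 r1 F G g0 g1" "0 < \<beta>" by auto
    let ?D = "L2_norm \<Omega> (\<lambda>z. (F z, G z)) + L2_norm cell_end (\<lambda>y. g0 y - F (end_pt r0 y) $ 1)
      + L2_norm cell_end (\<lambda>y. g1 y - F (end_pt r1 y) $ 1)
      + sqrt ((L2_norm (cell_wall r0 r1) (\<lambda>y. F (wall_pt 1 y) $ 3))\<^sup>2 + (L2_norm (cell_wall r0 r1) (\<lambda>y. F (wall_pt (-1) y) $ 3))\<^sup>2)"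
    define l where "l u = weak_rhs r0 r1 F G g0 g1 (fst u) (snd u)" for u
    note l = weak_rhs_linear_bounded[OF regular_data_L2[OF data], folded l_def K_def]
    have "0 \<le> K * ?D" using K by (intro mult_nonneg_nonneg add_nonneg_nonneg) auto
    from adm.lax_milgram[of B KB \<alpha> l "K * ?D", OF B_add(1) B_scaleR(1) B_add(2) B_scaleR(2) KB \<alpha> l this]
    obtain u where u: "u \<in> admissible r0 r1" "\<forall>v\<in>admissible r0 r1. B u v = l v" "adm.nrm u \<le> K * ?D / \<alpha>"
      by blast
    show "\<exists>\<psi> \<phi>. weak_solution \<gamma> r0 r1 A0 \<rho> U1 U2 F G g0 g1 \<psi> \<phi> \<and>
      (\<forall>\<psi>' \<phi>'. weak_solution \<gamma> r0 r1 A0 \<rho> U1 U2 F G g0 g1 \<psi>' \<phi>' \<longrightarrow>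
         (AE z in lebesgue_on (Omega r0 r1). \<psi>' z = \<psi> z \<and> \<phi>' z = \<phi> z)) \<and>
      sqrt ((H1_norm r0 r1 \<psi>)\<^sup>2 + (H1_norm r0 r1 \<phi>)\<^sup>2) \<le> K / \<alpha> * ?D"
    proof (rule exI[of _ "fst u"], rule exI[of _ "snd u"], intro conjI allI impI)
      show "weak_solution \<gamma> r0 r1 A0 \<rho> U1 U2 F G g0 g1 (fst u) (snd u)"
        using u by (simp add: weak_solution_iff l_def)
      have "sqrt ((H1_norm r0 r1 (fst u))\<^sup>2 + (H1_norm r0 r1 (snd u))\<^sup>2) = adm.nrm u"
        unfolding adm_nrm_sq[OF u(1), symmetric] using u(1) by simp
      then show "sqrt ((H1_norm r0 r1 (fst u))\<^sup>2 + (H1_norm r0 r1 (snd u))\<^sup>2) \<le> K / \<alpha> * ?D" using u(3) by simp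
      fix \<psi>' \<phi>' assume sol: "weak_solution \<gamma> r0 r1 A0 \<rho> U1 U2 F G g0 g1 \<psi>' \<phi>'"
      define w where "w = (\<psi>', \<phi>')"
      have wA: "w \<in> admissible r0 r1" and wB: "\<forall>v\<in>admissible r0 r1. B w v = l v"
        using sol by (simp_all add: weak_solution_iff l_def w_def)
      note d = adm.V_closed(3)[OF wA u(1)]
      \<comment> \<open>The difference of two solutions is tested with itself; coercivity makes its
        norm vanish, which for functions means equality almost everywhere.\<close>
      have "B (w - u) (w - u) = 0"
        using B_add(1)[OF d u(1) d] wB[rule_format, OF d] u(2)[rule_format, OF d] by simp
      then have "\<alpha> * (adm.nrm (w - u))\<^sup>2 \<le> 0" using \<alpha>(2)[OF d] by simp
      then have "adm.nrm (w - u) = 0" using \<alpha>(1) by (simp add: mult_le_0_iff)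
      then have "L2_norm \<Omega> (jets (w - u)) = 0" by (simp add: adm_nrm)
      from L2_norm_eq_0_AE[OF L2_jets[OF d] this] jets_add[OF d u(1)]
      have "AE z in lebesgue_on \<Omega>. jets w z = jets u z" by eventually_elim simp
      then show "AE z in lebesgue_on (Omega r0 r1). \<psi>' z = fst u z \<and> \<phi>' z = snd u z"
        by eventually_elim (simp add: jets_def jet_def w_def)
    qed
  qed
qed

end

theorem lemma3p3:
  fixes \<gamma> r0 r1 b0 \<rho>0 U10 U20 A0 E0 :: real
    and \<rho> U1 U2 A E :: "real \<Rightarrow> real"
  assumes "\<gamma> > 1" and "0 < r0" and "r0 < r1"
    and "background_flow \<gamma> r0 r1 b0 \<rho>0 U10 U20 A0 E0 \<rho> U1 U2 A E"
  shows "\<exists>C>0. \<forall>\<beta> F G g0 g1. 0 < \<beta> \<and> \<beta> < 1 \<and> regular_data \<beta> r0 r1 F G g0 g1 \<longrightarrow>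
    (\<exists>\<psi> \<phi>. weak_solution \<gamma> r0 r1 A0 \<rho> U1 U2 F G g0 g1 \<psi> \<phi> \<and>
      (\<forall>\<psi>' \<phi>'. weak_solution \<gamma> r0 r1 A0 \<rho> U1 U2 F G g0 g1 \<psi>' \<phi>' \<longrightarrow>
         (AE z in lebesgue_on (Omega r0 r1). \<psi>' z = \<psi> z \<and> \<phi>' z = \<phi> z)) \<and>
      sqrt ((H1_norm r0 r1 \<psi>)\<^sup>2 + (H1_norm r0 r1 \<phi>)\<^sup>2) \<le>
        C * (L2_norm (Omega r0 r1) (\<lambda>z. (F z, G z))
             + L2_norm cell_end (\<lambda>y. g0 y - F (end_pt r0 y) $ 1)
             + L2_norm cell_end (\<lambda>y. g1 y - F (end_pt r1 y) $ 1)
             + sqrt ((L2_norm (cell_wall r0 r1) (\<lambda>y. F (wall_pt 1 y) $ 3))\<^sup>2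
                     + (L2_norm (cell_wall r0 r1) (\<lambda>y. F (wall_pt (-1) y) $ 3))\<^sup>2)))"
proof -
  \<comment> \<open>Subsonicity, prescribed only at \<open>r0\<close>, becomes available on the
    whole interval.\<close>
  note bg = background_subsonic[OF assms]
  interpret subsonic_strip r0 r1 \<gamma> A0 \<rho> U1 U2
    by unfold_locales (use assms(1-3) bg in auto)
  show ?thesis by (rule well_posed)
qed

end
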